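(* Let $C\colon \mathscr{M}od(\mathbb{Z})^\Delta\to \mathscr{C}(\mathbb{Z})^-$ be the (unnormalized) chain complex functor from simplicial abelian groups to non-positively graded complexes of abelian groups, with the Alexander–Whitney colax-monoidal structure $AW_{A,B}\colon C(A\otimes B)\to C(A)\otimes C(B)$ and the Eilenberg–MacLane shuffle lax-monoidal structure $\nabla_{A,B}\colon C(A)\otimes C(B)\to C(A\otimes B)$. Then the pair $(AW,\nabla)$ on $C$ obeys the bialgebra axiom, that is, for all simplicial abelian groups $X,Y,Z,W$ the following two morphisms $C(X\otimes Y)\otimes C(Z\otimes W)\to C(X\otimes Z)\otimes C(Y\otimes W)$ are equal (on the nose, not only up to homotopy): $$C(X\otimes Y)\otimes C(Z\otimes W)\xrightarrow{\nabla}C(X\otimes Y\otimes Z\otimes W)\xrightarrow{C(\mathrm{id}\otimes\sigma\otimes\mathrm{id})}C(X\otimes Z\otimes Y\otimes W)\xrightarrow{AW}C(X\otimes Z)\otimes C(Y\otimes W)$$ and $$C(X\otimes Y)\otimes C(Z\otimes W)\xrightarrow{AW\otimes AW}C(X)\otimes C(Y)\otimes C(Z)\otimes C(W)\xrightarrow{\mathrm{id}\otimes\sigma\otimes\mathrm{id}}C(X)\otimes C(Z)\otimes C(Y)\otimes C(W)\xrightarrow{\nabla\otimes\nabla}C(X\otimes Z)\otimes C(Y\otimes W).$$ Consequently, the normalized chain complex functor $N\colon \mathscr{M}od(\mathbb{Z})^\Delta\to \mathscr{C}(\mathbb{Z})^-$, with its Alexander–Whitney and shuffle structures, obeys the bialgebra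 axiom as well (the same two composites with $C$ replaced by $N$ are equal).
   Context: $\mathscr{M}od(\mathbb{Z})^\Delta$ is the category of simplicial abelian groups, symmetric monoidal under the levelwise tensor product $(A\otimes B)_n=A_n\otimes_{\mathbb Z} B_n$ with symmetry the levelwise swap. $\mathscr{C}(\mathbb{Z})^-$ is the category of non-positively graded (cohomological grading) complexes of abelian groups, equivalently chain complexes in non-negative homological degrees, symmetric monoidal under the usual tensor product with symmetry $\sigma(u\otimes v)=(-1)^{|u||v|}v\otimes u$. Associativity isomorphisms are suppressed (the monoidal categories are treated as strict). $C(A)$ is the chain complex with $A_n$ in homological degree $n$ and differential $\sum_i(-1)^i d_i$. $N(A)$ is the quotient of $C(A)$ by the subcomplex generated by degenerate simplices (elements in the images of the degeneracies $s_i$). Alexander–Whitney map: for $a\in A_k$, $b\in B_k$, $$AW(a\otimes b)=\sum_{i+j=k} d_{\mathrm{fin}}^{\,i}a\otimes d_0^{\,j}b,$$ where $d_0$ and $d_{\mathrm{fin}}$ denote the first and the last simplicial face maps (so $d_{\mathrm{fin}}=d_n$ on $n$-simplices). Shuffle map: for $a\in A_k$, $b\in B_\ell$, $$\nabla(a\otimes b)=\sum_{(\alpha,\beta)}(-1)^{(\alpha,\beta)}S_\beta a\otimes S_\alpha b,$$ the sum being over all $(k,\ell)$-shuffles, i.e. disjoint subsets $\alpha=\{\alpha_1<\dots<\alpha_k\}$, $\beta=\{\beta_1<\dots<\beta_\ell\}$ of $\{0,1,\dots,k+\ell-1\}$, with $S_\alpha=s_{\alpha_k}\cdots s_{\alpha_1}$,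 $S_\beta=s_{\beta_\ell}\cdots s_{\beta_1}$ ($s_i$ the simplicial degeneracies), and $(-1)^{(\alpha,\beta)}$ the sign of the permutation $(\alpha_1,\dots,\alpha_k,\beta_1,\dots,\beta_\ell)$ of $(0,1,\dots,k+\ell-1)$. The maps $AW$ and $\nabla$ on $N$ are those given by the same formulas (induced on the quotients). *)

theory Defs
  imports "HOL-Algebra.Free_Abelian_Groups" "HOL-Combinatorics.Permutations"
begin

text \<open>
  Abelian groups are \<^const>\<open>comm_group\<close>s, hence written multiplicatively: an integer coefficient
  becomes an exponent (in particular a sign \<open>(-1)^k\<close> does), and a sum becomes a \<^const>\<open>finprod\<close>.
\<close>

section \<open>Tensor products of abelian groups\<close>

definition tensor_relations ::
  "('a, 'm) monoid_scheme \<Rightarrow> ('b, 'n) monoid_scheme \<Rightarrow> ('a \<times> 'b \<Rightarrow>\<^sub>0 int) set" where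
  "tensor_relations G H =
     {frag_of (g \<otimes>\<^bsub>G\<^esub> g', h) - frag_of (g, h) - frag_of (g', h) |g g' h.
        g \<in> carrier G \<and> g' \<in> carrier G \<and> h \<in> carrier H} \<union>
     {frag_of (g, h \<otimes>\<^bsub>H\<^esub> h') - frag_of (g, h) - frag_of (g, h') |g h h'.
        g \<in> carrier G \<and> h \<in> carrier H \<and> h' \<in> carrier H}"

definition tensor_kernel ::
  "('a, 'm) monoid_scheme \<Rightarrow> ('b, 'n) monoid_scheme \<Rightarrow> ('a \<times> 'b \<Rightarrow>\<^sub>0 int) set" where
  "tensor_kernel G H =
     generate (free_Abelian_group (carrier G \<times> carrier H)) (tensor_relations G H)"

definition tensor_group ::
  "('a, 'm) monoid_scheme \<Rightarrow> ('b, 'n) monoid_scheme \<Rightarrow> ('a \<times> 'b \<Rightarrow>\<^sub>0 int) set monoid" where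
  "tensor_group G H = free_Abelian_group (carrier G \<times> carrier H) Mod tensor_kernel G H"

definition tensor_elt ::
  "('a, 'm) monoid_scheme \<Rightarrow> ('b, 'n) monoid_scheme \<Rightarrow> 'a \<Rightarrow> 'b \<Rightarrow> ('a \<times> 'b \<Rightarrow>\<^sub>0 int) set" where
  "tensor_elt G H g h =
     tensor_kernel G H #>\<^bsub>free_Abelian_group (carrier G \<times> carrier H)\<^esub> frag_of (g, h)"

text \<open>
  \<open>tensor_lift K f\<close> is the homomorphism into \<open>K\<close> that a biadditive map \<open>f\<close> induces on the tensor
  product; it has the expected values by the universal property proved below.
\<close>

definition tensor_lift ::
  "('c, 'k) monoid_scheme \<Rightarrow> ('a \<Rightarrow> 'b \<Rightarrow> 'c) \<Rightarrow> ('a \<times> 'b \<Rightarrow>\<^sub>0 int) set \<Rightarrow> 'c" where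
  "tensor_lift K f t =
     the_elem ((\<lambda>c. \<Otimes>\<^bsub>K\<^esub>w\<in>Poly_Mapping.keys c.
                      f (fst w) (snd w) [^]\<^bsub>K\<^esub> Poly_Mapping.lookup c w) ` t)"

definition biadditive ::
  "('a, 'm) monoid_scheme \<Rightarrow> ('b, 'n) monoid_scheme \<Rightarrow> ('c, 'k) monoid_scheme \<Rightarrow>
   ('a \<Rightarrow> 'b \<Rightarrow> 'c) \<Rightarrow> bool" where
  "biadditive G H K f \<longleftrightarrow>
     (\<forall>g\<in>carrier G. f g \<in> hom H K) \<and> (\<forall>h\<in>carrier H. (\<lambda>g. f g h) \<in> hom G K)"

lemma keys_frag_diff_subset:
  assumes "x \<in> A" and "y \<in> A" and "z \<in> A"
  shows "Poly_Mapping.keys (frag_of x - frag_of y - frag_of z) \<subseteq> A"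
proof -
  have "Poly_Mapping.keys (frag_of x - frag_of y) \<subseteq> A"
    using keys_diff[of "frag_of x" "frag_of y"] assms by auto
  then show ?thesis
    using keys_diff[of "frag_of x - frag_of y" "frag_of z"] assms by auto
qed

lemma tensor_relations_closed:
  assumes "group G" and "group H"
  shows "tensor_relations G H \<subseteq> carrier (free_Abelian_group (carrier G \<times> carrier H))"
proof -
  interpret G: group G by fact
  interpret H: group H by fact
  show ?thesis
    unfolding tensor_relations_def
    by (intro subsetI, unfold carrier_free_Abelian_group_iff, elim UnE CollectE exE conjE)
      (simp_all only:, (rule keys_frag_diff_subset; simp)+)
qed

lemma tensor_kernel_normal:
  assumes "group G" and "group H"
  shows "tensor_kernel G H \<lhd> free_Abelian_group (carrier G \<times> carrier H)"
  unfolding tensor_kernel_def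
  by (rule comm_group.subgroup_imp_normal[OF abelian_free_Abelian_group
      group.generate_is_subgroup[OF group_free_Abelian_group tensor_relations_closed[OF assms]]])

lemma comm_group_tensor_group:
  assumes "group G" and "group H"
  shows "comm_group (tensor_group G H)"
  unfolding tensor_group_def
  by (rule comm_group.abelian_FactGroup[OF abelian_free_Abelian_group
      normal_imp_subgroup[OF tensor_kernel_normal[OF assms]]])

lemma tensor_elt_closed:
  assumes "g \<in> carrier G" and "h \<in> carrier H"
  shows "tensor_elt G H g h \<in> carrier (tensor_group G H)"
  using assms by (auto simp: tensor_elt_def tensor_group_def FactGroup_def RCOSETS_def)

lemma tensor_elt_biadditive:
  assumes "group G" and "group H"
  shows "biadditive G H (tensor_group G H) (tensor_elt G H)"
proof -
  let ?F = "free_Abelian_group (carrier G \<times> carrier H)"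
  interpret G: group G by fact
  interpret H: group H by fact
  interpret K: normal "tensor_kernel G H" ?F
    using assms by (rule tensor_kernel_normal)
  have eq: "tensor_kernel G H #>\<^bsub>?F\<^esub> frag_of x =
      (tensor_kernel G H #>\<^bsub>?F\<^esub> frag_of y) <#>\<^bsub>?F\<^esub> (tensor_kernel G H #>\<^bsub>?F\<^esub> frag_of z)"
    if "frag_of x - frag_of y - frag_of z \<in> tensor_relations G H"
      and "x \<in> carrier G \<times> carrier H" "y \<in> carrier G \<times> carrier H" "z \<in> carrier G \<times> carrier H"
    for x y z
  proof -
    let ?yz = "frag_of y + frag_of z"
    have yz: "?yz \<in> carrier ?F"
      using that K.m_closed[of "frag_of y" "frag_of z"] by simp
    have "frag_of x - frag_of y - frag_of z \<in> tensor_kernel G H"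
      using that(1) by (auto simp: tensor_kernel_def intro: generate.incl)
    then have "frag_of x \<otimes>\<^bsub>?F\<^esub> inv\<^bsub>?F\<^esub> ?yz \<in> tensor_kernel G H"
      using yz by (simp add: algebra_simps)
    then have "tensor_kernel G H #>\<^bsub>?F\<^esub> frag_of x = tensor_kernel G H #>\<^bsub>?F\<^esub> ?yz"
      using that yz K.repr_independence K.rcos_module_rev[of "?yz" "frag_of x"] K.subgroup_axioms
      by (metis K.is_group frag_of_in_free_Abelian_group subgroup.rcos_module_rev)
    also have "\<dots> = (tensor_kernel G H #>\<^bsub>?F\<^esub> frag_of y) <#>\<^bsub>?F\<^esub> (tensor_kernel G H #>\<^bsub>?F\<^esub> frag_of z)"
      using that K.rcos_sum[of "frag_of y" "frag_of z"] by simp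
    finally show ?thesis .
  qed
  show ?thesis
    unfolding biadditive_def
  proof (intro conjI ballI homI)
    fix g h h' assume a: "g \<in> carrier G" "h \<in> carrier H" "h' \<in> carrier H"
    then have "frag_of (g, h \<otimes>\<^bsub>H\<^esub> h') - frag_of (g, h) - frag_of (g, h') \<in> tensor_relations G H"
      unfolding tensor_relations_def by blast
    then show "tensor_elt G H g (h \<otimes>\<^bsub>H\<^esub> h') =
        tensor_elt G H g h \<otimes>\<^bsub>tensor_group G H\<^esub> tensor_elt G H g h'"
      using a by (simp add: tensor_elt_def tensor_group_def FactGroup_def eq)
  next
    fix h g g' assume a: "h \<in> carrier H" "g \<in> carrier G" "g' \<in> carrier G"
    then have "frag_of (g \<otimes>\<^bsub>G\<^esub> g', h) - frag_of (g, h) - frag_of (g', h) \<in> tensor_relations G H"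
      unfolding tensor_relations_def by blast
    then show "tensor_elt G H (g \<otimes>\<^bsub>G\<^esub> g') h =
        tensor_elt G H g h \<otimes>\<^bsub>tensor_group G H\<^esub> tensor_elt G H g' h"
      using a by (simp add: tensor_elt_def tensor_group_def FactGroup_def eq)
  qed (auto intro: tensor_elt_closed)
qed

lemma tensor_lift_aux:
  assumes "group G" and "group H" and "comm_group K" and f: "biadditive G H K f"
  shows "\<exists>h\<in>hom (free_Abelian_group (carrier G \<times> carrier H)) K.
    (\<forall>x\<in>carrier G. \<forall>y\<in>carrier H. h (frag_of (x, y)) = f x y) \<and>
    (\<forall>c\<in>carrier (free_Abelian_group (carrier G \<times> carrier H)).
      tensor_lift K f (tensor_kernel G H #>\<^bsub>free_Abelian_group (carrier G \<times> carrier H)\<^esub> c) = h c)"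
proof -
  let ?B = "carrier G \<times> carrier H"
  let ?F = "free_Abelian_group ?B"
  interpret G: group G by fact
  interpret H: group H by fact
  interpret K: comm_group K by fact
  interpret F: comm_group ?F by (rule abelian_free_Abelian_group)
  define e where "e c = (\<Otimes>\<^bsub>K\<^esub>w\<in>Poly_Mapping.keys c.
      f (fst w) (snd w) [^]\<^bsub>K\<^esub> Poly_Mapping.lookup c w)"
    for c :: "_ \<Rightarrow>\<^sub>0 int"
  have fc: "f x y \<in> carrier K" if "x \<in> carrier G" "y \<in> carrier H" for x y
    using f that by (auto simp: biadditive_def hom_def)
  obtain h where h: "h \<in> hom ?F K" and h_of: "\<And>x. x \<in> ?B \<Longrightarrow> h (frag_of x) = f (fst x) (snd x)"
    using K.free_Abelian_group_universal[of "\<lambda>x. f (fst x) (snd x)" ?B] fc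
    by (auto simp: image_subset_iff)
  interpret h: group_hom ?F K h
    using h by unfold_locales
  have e_alt: "e c = (\<Otimes>\<^bsub>K\<^esub>w\<in>T. f (fst w) (snd w) [^]\<^bsub>K\<^esub> Poly_Mapping.lookup c w)"
    if "finite T" "Poly_Mapping.keys c \<subseteq> T" "T \<subseteq> ?B" for c T
    unfolding e_def
    by (rule K.finprod_mono_neutral_cong_left)
      (use that fc in \<open>auto simp: in_keys_iff subset_iff intro!: K.int_pow_closed\<close>)
  have e_diff: "e (a - b) = e a \<otimes>\<^bsub>K\<^esub> inv\<^bsub>K\<^esub> e b"
    if ab: "Poly_Mapping.keys a \<subseteq> ?B" "Poly_Mapping.keys b \<subseteq> ?B" for a b
  proof -
    define T where "T = Poly_Mapping.keys a \<union> Poly_Mapping.keys b"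
    have T: "finite T" "T \<subseteq> ?B" "Poly_Mapping.keys a \<subseteq> T" "Poly_Mapping.keys b \<subseteq> T"
      "Poly_Mapping.keys (a - b) \<subseteq> T"
      using ab keys_diff[of a b] by (auto simp: T_def)
    have fT: "f (fst w) (snd w) \<in> carrier K" if "w \<in> T" for w
      using T(2) that by (intro fc) auto
    let ?p = "\<lambda>c w. f (fst w) (snd w) [^]\<^bsub>K\<^esub> Poly_Mapping.lookup c w"
    have "e a = (\<Otimes>\<^bsub>K\<^esub>w\<in>T. ?p (a - b) w \<otimes>\<^bsub>K\<^esub> ?p b w)"
      unfolding e_alt[OF T(1,3,2)]
      by (rule K.finprod_cong') (use fT in \<open>auto simp: lookup_minus simp flip: K.int_pow_mult\<close>)
    also have "\<dots> = e (a - b) \<otimes>\<^bsub>K\<^esub> e b"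
      unfolding e_alt[OF T(1,5,2)] e_alt[OF T(1,4,2)]
      by (rule K.finprod_multf) (use fT in auto)
    finally have *: "e a = e (a - b) \<otimes>\<^bsub>K\<^esub> e b" .
    have "e (a - b) \<in> carrier K" "e b \<in> carrier K"
      unfolding e_alt[OF T(1,5,2)] e_alt[OF T(1,4,2)]
      using fT by (auto intro!: K.finprod_closed)
    then show ?thesis
      using * by (simp add: K.m_assoc)
  qed
  have he: "h c = e c" if "Poly_Mapping.keys c \<subseteq> ?B" for c
  proof -
    from that have "Poly_Mapping.keys c \<subseteq> ?B \<and> h c = e c"
    proof (induction c rule: frag_induction)
      case zero
      show ?case using h.hom_one by (simp add: e_def)
    next
      case (diff x y)
      have "h (x - y) = h (x \<otimes>\<^bsub>?F\<^esub> inv\<^bsub>?F\<^esub> y)"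
        using diff by simp
      also have "\<dots> = h x \<otimes>\<^bsub>K\<^esub> inv\<^bsub>K\<^esub> h y"
        using diff h.hom_mult[of x "inv\<^bsub>?F\<^esub> y"] h.hom_inv[of y] F.inv_closed[of y]
        by (metis carrier_free_Abelian_group_iff)
      finally show ?case
        using diff e_diff[of x y] keys_diff[of x y] by auto
    next
      case (one a)
      then show ?case
        using fc[of "fst a" "snd a"] h_of[of a]
        by (auto simp: e_def K.finprod_singleton mem_Times_iff)
    qed
    then show ?thesis by simp
  qed
  have rel: "h r = \<one>\<^bsub>K\<^esub>" if "r \<in> tensor_relations G H" for r
  proof -
    have *: "h (frag_of x - frag_of y - frag_of z) = \<one>\<^bsub>K\<^esub>"
      if "x \<in> ?B" "y \<in> ?B" "z \<in> ?B"
        and "f (fst x) (snd x) = f (fst y) (snd y) \<otimes>\<^bsub>K\<^esub> f (fst z) (snd z)" for x y z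
    proof -
      have c: "frag_of x \<in> carrier ?F" "frag_of y \<in> carrier ?F" "frag_of z \<in> carrier ?F"
        using that by simp_all
      have "frag_of x - frag_of y - frag_of z =
          frag_of x \<otimes>\<^bsub>?F\<^esub> inv\<^bsub>?F\<^esub> frag_of y \<otimes>\<^bsub>?F\<^esub> inv\<^bsub>?F\<^esub> frag_of z"
        using that by simp
      also have "h \<dots> = h (frag_of x) \<otimes>\<^bsub>K\<^esub> inv\<^bsub>K\<^esub> h (frag_of y) \<otimes>\<^bsub>K\<^esub> inv\<^bsub>K\<^esub> h (frag_of z)"
        using c by (simp del: mult_free_Abelian_group inv_free_Abelian_group
            carrier_free_Abelian_group_iff)
      also have "\<dots> = \<one>\<^bsub>K\<^esub>"
        using that fc[of "fst y" "snd y"] fc[of "fst z" "snd z"]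
        by (simp add: h_of mem_Times_iff)
          (metis K.inv_closed K.inv_mult K.m_assoc K.m_closed K.r_inv)
      finally show ?thesis .
    qed
    from \<open>r \<in> _\<close> show ?thesis
      unfolding tensor_relations_def
    proof (elim UnE CollectE exE conjE)
      fix g g' y assume "r = frag_of (g \<otimes>\<^bsub>G\<^esub> g', y) - frag_of (g, y) - frag_of (g', y)"
        and "g \<in> carrier G" "g' \<in> carrier G" "y \<in> carrier H"
      with f show ?thesis
        by (auto simp: biadditive_def hom_def intro!: *)
    next
      fix g y y' assume "r = frag_of (g, y \<otimes>\<^bsub>H\<^esub> y') - frag_of (g, y) - frag_of (g, y')"
        and "g \<in> carrier G" "y \<in> carrier H" "y' \<in> carrier H"
      with f show ?thesis
        by (auto simp: biadditive_def hom_def intro!: *)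
    qed
  qed
  have ker: "tensor_kernel G H \<subseteq> kernel ?F K h"
    unfolding tensor_kernel_def
    by (rule F.generate_subgroup_incl[OF _ h.subgroup_kernel])
      (use rel tensor_relations_closed[OF assms(1,2)] in
        \<open>auto simp: kernel_def simp del: carrier_free_Abelian_group_iff\<close>)
  show ?thesis
  proof (intro bexI[OF _ h] conjI ballI)
    show "h (frag_of (x, y)) = f x y" if "x \<in> carrier G" "y \<in> carrier H" for x y
      using h_of[of "(x, y)"] that by simp
    show "tensor_lift K f (tensor_kernel G H #>\<^bsub>?F\<^esub> c) = h c" if c: "c \<in> carrier ?F" for c
    proof -
      interpret N: normal "tensor_kernel G H" ?F
        using assms(1,2) by (rule tensor_kernel_normal)
      have "e d = h c" if "d \<in> tensor_kernel G H #>\<^bsub>?F\<^esub> c" for d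
      proof -
        from that obtain k where k: "k \<in> tensor_kernel G H" "d = k \<otimes>\<^bsub>?F\<^esub> c"
          by (auto simp: r_coset_def)
        then have "k \<in> carrier ?F" "h k = \<one>\<^bsub>K\<^esub>"
          using ker by (auto simp: kernel_def)
        then have "h d = h c" "d \<in> carrier ?F"
          using c k(2) h.hom_mult[of k c] h.hom_closed[of c] F.m_closed[of k c]
          by (metis K.l_one, metis)
        then show ?thesis using he[of d] by simp
      qed
      moreover have "c \<in> tensor_kernel G H #>\<^bsub>?F\<^esub> c"
        using c by (rule F.rcos_self[OF _ N.subgroup_axioms])
      ultimately have "e ` (tensor_kernel G H #>\<^bsub>?F\<^esub> c) = {h c}"
        by (auto simp: image_iff)
      then show ?thesis
        by (simp add: tensor_lift_def e_def[abs_def])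
    qed
  qed
qed

lemma tensor_group_carrierE:
  assumes "t \<in> carrier (tensor_group G H)"
  obtains c where "c \<in> carrier (free_Abelian_group (carrier G \<times> carrier H))"
    and "t = tensor_kernel G H #>\<^bsub>free_Abelian_group (carrier G \<times> carrier H)\<^esub> c"
  using assms unfolding tensor_group_def carrier_FactGroup by blast

lemma tensor_lift_hom:
  assumes "group G" and "group H" and "comm_group K" and "biadditive G H K f"
  shows "tensor_lift K f \<in> hom (tensor_group G H) K"
proof -
  let ?F = "free_Abelian_group (carrier G \<times> carrier H)"
  interpret K: comm_group K by fact
  interpret N: normal "tensor_kernel G H" ?F
    using assms(1,2) by (rule tensor_kernel_normal)
  obtain h where h: "h \<in> hom ?F K"
    and "\<And>x y. \<lbrakk>x \<in> carrier G; y \<in> carrier H\<rbrakk> \<Longrightarrow> h (frag_of (x, y)) = f x y"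
    and lift: "\<And>c. c \<in> carrier ?F \<Longrightarrow> tensor_lift K f (tensor_kernel G H #>\<^bsub>?F\<^esub> c) = h c"
    using tensor_lift_aux[OF assms] by auto
  show ?thesis
  proof (rule homI)
    fix s t assume "s \<in> carrier (tensor_group G H)" "t \<in> carrier (tensor_group G H)"
    obtain c where c: "c \<in> carrier ?F" "s = tensor_kernel G H #>\<^bsub>?F\<^esub> c"
      using \<open>s \<in> _\<close> by (rule tensor_group_carrierE)
    obtain d where d: "d \<in> carrier ?F" "t = tensor_kernel G H #>\<^bsub>?F\<^esub> d"
      using \<open>t \<in> _\<close> by (rule tensor_group_carrierE)
    note cd = c d N.m_closed[OF c(1) d(1)]
    have "tensor_lift K f (s \<otimes>\<^bsub>tensor_group G H\<^esub> t) = h (c \<otimes>\<^bsub>?F\<^esub> d)"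
      by (simp add: cd tensor_group_def FactGroup_def N.rcos_sum lift
          del: carrier_free_Abelian_group_iff mult_free_Abelian_group)
    also have "\<dots> = tensor_lift K f s \<otimes>\<^bsub>K\<^esub> tensor_lift K f t"
      by (simp add: cd lift hom_mult[OF h]
          del: carrier_free_Abelian_group_iff mult_free_Abelian_group)
    finally show "tensor_lift K f (s \<otimes>\<^bsub>tensor_group G H\<^esub> t) =
        tensor_lift K f s \<otimes>\<^bsub>K\<^esub> tensor_lift K f t" .
  next
    fix s assume "s \<in> carrier (tensor_group G H)"
    then obtain c where "c \<in> carrier ?F" "s = tensor_kernel G H #>\<^bsub>?F\<^esub> c"
      by (rule tensor_group_carrierE)
    moreover from this have "h c \<in> carrier K"
      using h by (simp add: hom_def Pi_iff)
    ultimately show "tensor_lift K f s \<in> carrier K"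
      by (simp add: lift)
  qed
qed

lemma tensor_lift_elt:
  assumes "group G" and "group H" and "comm_group K" and "biadditive G H K f"
    and "g \<in> carrier G" and "h \<in> carrier H"
  shows "tensor_lift K f (tensor_elt G H g h) = f g h"
proof -
  let ?F = "free_Abelian_group (carrier G \<times> carrier H)"
  obtain e where "e \<in> hom ?F K"
    and e: "\<And>x y. \<lbrakk>x \<in> carrier G; y \<in> carrier H\<rbrakk> \<Longrightarrow> e (frag_of (x, y)) = f x y"
    and lift: "\<And>c. c \<in> carrier ?F \<Longrightarrow> tensor_lift K f (tensor_kernel G H #>\<^bsub>?F\<^esub> c) = e c"
    using tensor_lift_aux[OF assms(1-4)] by auto
  have "frag_of (g, h) \<in> carrier ?F"
    using assms(5,6) by simp
  from lift[OF this] e[OF assms(5,6)] show ?thesis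
    by (simp add: tensor_elt_def)
qed

lemma tensor_hom_eqI:
  assumes "group G" and "group H" and "group K"
    and \<phi>: "\<phi> \<in> hom (tensor_group G H) K" and \<psi>: "\<psi> \<in> hom (tensor_group G H) K"
    and eq: "\<And>g h. \<lbrakk>g \<in> carrier G; h \<in> carrier H\<rbrakk> \<Longrightarrow> \<phi> (tensor_elt G H g h) = \<psi> (tensor_elt G H g h)"
    and t: "t \<in> carrier (tensor_group G H)"
  shows "\<phi> t = \<psi> t"
proof -
  let ?F = "free_Abelian_group (carrier G \<times> carrier H)"
  let ?q = "\<lambda>c. tensor_kernel G H #>\<^bsub>?F\<^esub> c"
  interpret N: normal "tensor_kernel G H" ?F
    using assms(1,2) by (rule tensor_kernel_normal)
  interpret K: group K by fact
  have q: "?q \<in> hom ?F (tensor_group G H)"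
    unfolding tensor_group_def by (rule N.r_coset_hom_Mod)
  have hc: "group_hom ?F K (\<phi> \<circ> ?q)" "group_hom ?F K (\<psi> \<circ> ?q)"
    using hom_compose[OF q \<phi>] hom_compose[OF q \<psi>]
    by (auto simp: group_hom_def group_hom_axioms_def assms(3))
  have "\<phi> (?q c) = \<psi> (?q c)" if "Poly_Mapping.keys c \<subseteq> carrier G \<times> carrier H" for c
  proof -
    from that have "Poly_Mapping.keys c \<subseteq> carrier G \<times> carrier H \<and> \<phi> (?q c) = \<psi> (?q c)"
    proof (induction c rule: frag_induction)
      case zero
      show ?case
        using group_hom.hom_one[OF hc(1)] group_hom.hom_one[OF hc(2)] by simp
    next
      case (diff x y)
      have "\<theta> (?q (x - y)) = \<theta> (?q x) \<otimes>\<^bsub>K\<^esub> inv\<^bsub>K\<^esub> \<theta> (?q y)" if "group_hom ?F K (\<theta> \<circ> ?q)" for \<theta>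
      proof -
        have "x - y = x \<otimes>\<^bsub>?F\<^esub> inv\<^bsub>?F\<^esub> y" using diff by simp
        then show ?thesis
          using diff group_hom.hom_mult[OF that, of x "inv\<^bsub>?F\<^esub> y"] group_hom.hom_inv[OF that, of y]
            N.inv_closed[of y]
          by (metis carrier_free_Abelian_group_iff comp_apply)
      qed
      from this[OF hc(1)] this[OF hc(2)] show ?case
        using diff keys_diff[of x y] by auto
    next
      case (one a)
      then show ?case
        using eq[of "fst a" "snd a"] by (auto simp: tensor_elt_def mem_Times_iff)
    qed
    then show ?thesis by simp
  qed
  moreover obtain c where "c \<in> carrier ?F" "t = ?q c"
    using t by (rule tensor_group_carrierE)
  ultimately show ?thesis by simp
qed

definition tensor_map ::
  "('c, 'm) monoid_scheme \<Rightarrow> ('d, 'n) monoid_scheme \<Rightarrow> ('a \<Rightarrow> 'c) \<Rightarrow> ('b \<Rightarrow> 'd) \<Rightarrow>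
   ('a \<times> 'b \<Rightarrow>\<^sub>0 int) set \<Rightarrow> ('c \<times> 'd \<Rightarrow>\<^sub>0 int) set" where
  "tensor_map G' H' f g =
     tensor_lift (tensor_group G' H') (\<lambda>a b. tensor_elt G' H' (f a) (g b))"

lemma tensor_map_biadditive:
  assumes "group G'" and "group H'" and "f \<in> hom G G'" and "g \<in> hom H H'"
  shows "biadditive G H (tensor_group G' H') (\<lambda>a b. tensor_elt G' H' (f a) (g b))"
  using tensor_elt_biadditive[OF assms(1,2)] assms(3,4)
  by (auto simp: biadditive_def hom_def Pi_iff)

lemma tensor_map_hom:
  assumes "group G" "group H" "group G'" "group H'" "f \<in> hom G G'" "g \<in> hom H H'"
  shows "tensor_map G' H' f g \<in> hom (tensor_group G H) (tensor_group G' H')"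
  unfolding tensor_map_def
  using assms by (intro tensor_lift_hom comm_group_tensor_group tensor_map_biadditive)

lemma tensor_map_elt:
  assumes "group G" "group H" "group G'" "group H'" "f \<in> hom G G'" "g \<in> hom H H'"
    and "a \<in> carrier G" "b \<in> carrier H"
  shows "tensor_map G' H' f g (tensor_elt G H a b) = tensor_elt G' H' (f a) (g b)"
  unfolding tensor_map_def
  using assms by (intro tensor_lift_elt comm_group_tensor_group tensor_map_biadditive)

text \<open>Functoriality, in the form needed for the simplicial identities of a tensor product.\<close>

lemma tensor_map_comp_eqI:
  assumes grp: "group G" "group H" "group G1" "group H1" "group G2" "group H2" "group K" "group L"
    and hom: "f1 \<in> hom G G1" "g1 \<in> hom H H1" "f1' \<in> hom G1 K" "g1' \<in> hom H1 L"
      "f2 \<in> hom G G2" "g2 \<in> hom H H2" "f2' \<in> hom G2 K" "g2' \<in> hom H2 L"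
    and eq: "\<And>a. a \<in> carrier G \<Longrightarrow> f1' (f1 a) = f2' (f2 a)"
      "\<And>b. b \<in> carrier H \<Longrightarrow> g1' (g1 b) = g2' (g2 b)"
    and t: "t \<in> carrier (tensor_group G H)"
  shows "tensor_map K L f1' g1' (tensor_map G1 H1 f1 g1 t) =
    tensor_map K L f2' g2' (tensor_map G2 H2 f2 g2 t)"
proof -
  have "(tensor_map K L f1' g1' \<circ> tensor_map G1 H1 f1 g1) t =
    (tensor_map K L f2' g2' \<circ> tensor_map G2 H2 f2 g2) t"
  proof (rule tensor_hom_eqI[OF grp(1,2) _ _ _ _ t])
    show "group (tensor_group K L)"
      using comm_group_tensor_group[OF grp(7,8)] by (rule comm_group.axioms(2))
    show "tensor_map K L f1' g1' \<circ> tensor_map G1 H1 f1 g1 \<in> hom (tensor_group G H) (tensor_group K L)"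
      by (rule hom_compose[OF tensor_map_hom tensor_map_hom]) (use grp hom in auto)
    show "tensor_map K L f2' g2' \<circ> tensor_map G2 H2 f2 g2 \<in> hom (tensor_group G H) (tensor_group K L)"
      by (rule hom_compose[OF tensor_map_hom tensor_map_hom]) (use grp hom in auto)
    fix a b assume ab: "a \<in> carrier G" "b \<in> carrier H"
    then have "f1 a \<in> carrier G1" "g1 b \<in> carrier H1" "f2 a \<in> carrier G2" "g2 b \<in> carrier H2"
      using hom by (auto simp: hom_def)
    with ab show "(tensor_map K L f1' g1' \<circ> tensor_map G1 H1 f1 g1) (tensor_elt G H a b) =
        (tensor_map K L f2' g2' \<circ> tensor_map G2 H2 f2 g2) (tensor_elt G H a b)"
      using grp hom by (simp add: tensor_map_elt[of G H] tensor_map_elt[of G1 H1]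
          tensor_map_elt[of G2 H2] eq)
  qed
  then show ?thesis by simp
qed

lemma tensor_map_comp_idI:
  assumes grp: "group G" "group H" "group G1" "group H1"
    and hom: "f \<in> hom G G1" "g \<in> hom H H1" "f' \<in> hom G1 G" "g' \<in> hom H1 H"
    and eq: "\<And>a. a \<in> carrier G \<Longrightarrow> f' (f a) = a" "\<And>b. b \<in> carrier H \<Longrightarrow> g' (g b) = b"
    and t: "t \<in> carrier (tensor_group G H)"
  shows "tensor_map G H f' g' (tensor_map G1 H1 f g t) = t"
proof -
  have "(tensor_map G H f' g' \<circ> tensor_map G1 H1 f g) t = id t"
  proof (rule tensor_hom_eqI[OF grp(1,2) _ _ _ _ t])
    show "group (tensor_group G H)"
      using comm_group_tensor_group[OF grp(1,2)] by (rule comm_group.axioms(2))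
    show "tensor_map G H f' g' \<circ> tensor_map G1 H1 f g \<in> hom (tensor_group G H) (tensor_group G H)"
      by (rule hom_compose[OF tensor_map_hom tensor_map_hom]) (use grp hom in auto)
    show "id \<in> hom (tensor_group G H) (tensor_group G H)"
      by (simp add: hom_def)
    fix a b assume ab: "a \<in> carrier G" "b \<in> carrier H"
    then have "f a \<in> carrier G1" "g b \<in> carrier H1"
      using hom by (auto simp: hom_def)
    with ab show "(tensor_map G H f' g' \<circ> tensor_map G1 H1 f g) (tensor_elt G H a b) =
        id (tensor_elt G H a b)"
      using grp hom by (simp add: tensor_map_elt[of G H] tensor_map_elt[of G1 H1] eq)
  qed
  then show ?thesis by simp
qed

definition tensor_swap ::
  "('a, 'm) monoid_scheme \<Rightarrow> ('b, 'n) monoid_scheme \<Rightarrow>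
   ('a \<times> 'b \<Rightarrow>\<^sub>0 int) set \<Rightarrow> ('b \<times> 'a \<Rightarrow>\<^sub>0 int) set" where
  "tensor_swap G H = tensor_lift (tensor_group H G) (\<lambda>g h. tensor_elt H G h g)"

definition tensor_assoc where
  "tensor_assoc G H K =
     tensor_lift (tensor_group G (tensor_group H K))
       (\<lambda>t k. tensor_lift (tensor_group G (tensor_group H K))
          (\<lambda>g h. tensor_elt G (tensor_group H K) g (tensor_elt H K h k)) t)"

definition tensor_assoc_inv where
  "tensor_assoc_inv G H K =
     tensor_lift (tensor_group (tensor_group G H) K)
       (\<lambda>g. tensor_lift (tensor_group (tensor_group G H) K)
          (\<lambda>h k. tensor_elt (tensor_group G H) K (tensor_elt G H g h) k))"

text \<open>
  \<open>id \<otimes> \<sigma> \<otimes> id\<close> with the associativity isomorphisms, suppressed on paper, made explicit: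
  \<open>(G\<otimes>H)\<otimes>(K\<otimes>L) \<rightarrow> G\<otimes>(H\<otimes>(K\<otimes>L)) \<rightarrow> G\<otimes>((H\<otimes>K)\<otimes>L) \<rightarrow> G\<otimes>((K\<otimes>H)\<otimes>L) \<rightarrow> G\<otimes>(K\<otimes>(H\<otimes>L)) \<rightarrow> (G\<otimes>K)\<otimes>(H\<otimes>L)\<close>.
\<close>

definition tensor_middle_swap where
  "tensor_middle_swap G H K L =
     tensor_assoc_inv G K (tensor_group H L) \<circ>
     tensor_map G (tensor_group K (tensor_group H L)) id (tensor_assoc K H L) \<circ>
     tensor_map G (tensor_group (tensor_group K H) L) id
       (tensor_map (tensor_group K H) L (tensor_swap H K) id) \<circ>
     tensor_map G (tensor_group (tensor_group H K) L) id (tensor_assoc_inv H K L) \<circ>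
     tensor_assoc G H (tensor_group K L)"


section \<open>Simplicial abelian groups\<close>

text \<open>
  Both operators are indexed by the degree of their source: \<open>face A n i\<close> is
  \<open>d\<^sub>i : A\<^sub>n \<rightarrow> A\<^bsub>n-1\<^esub>\<close> (for \<open>n > 0\<close>) and \<open>degen A n i\<close> is \<open>s\<^sub>i : A\<^sub>n \<rightarrow> A\<^bsub>n+1\<^esub>\<close>, where \<open>i \<le> n\<close>.
\<close>

record 'a simplicial =
  sgroup :: "nat \<Rightarrow> 'a monoid"
  face :: "nat \<Rightarrow> nat \<Rightarrow> 'a \<Rightarrow> 'a"
  degen :: "nat \<Rightarrow> nat \<Rightarrow> 'a \<Rightarrow> 'a"

locale simplicial_abelian_group =
  fixes A :: "'a simplicial"
  assumes comm_group: "comm_group (sgroup A n)"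
    and face_hom: "i \<le> Suc n \<Longrightarrow> face A (Suc n) i \<in> hom (sgroup A (Suc n)) (sgroup A n)"
    and degen_hom: "i \<le> n \<Longrightarrow> degen A n i \<in> hom (sgroup A n) (sgroup A (Suc n))"
    and face_face: "\<lbrakk>i < j; j \<le> Suc (Suc n); x \<in> carrier (sgroup A (Suc (Suc n)))\<rbrakk> \<Longrightarrow>
      face A (Suc n) i (face A (Suc (Suc n)) j x) =
      face A (Suc n) (j - 1) (face A (Suc (Suc n)) i x)"
    and degen_degen: "\<lbrakk>i \<le> j; j \<le> n; x \<in> carrier (sgroup A n)\<rbrakk> \<Longrightarrow>
      degen A (Suc n) i (degen A n j x) = degen A (Suc n) (Suc j) (degen A n i x)"
    and face_degen_less: "\<lbrakk>i < j; j \<le> n; x \<in> carrier (sgroup A n)\<rbrakk> \<Longrightarrow>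
      face A (Suc n) i (degen A n j x) = degen A (n - 1) (j - 1) (face A n i x)"
    and face_degen_eq: "\<lbrakk>i = j \<or> i = Suc j; j \<le> n; x \<in> carrier (sgroup A n)\<rbrakk> \<Longrightarrow>
      face A (Suc n) i (degen A n j x) = x"
    and face_degen_greater: "\<lbrakk>Suc j < i; i \<le> Suc n; x \<in> carrier (sgroup A n)\<rbrakk> \<Longrightarrow>
      face A (Suc n) i (degen A n j x) = degen A (n - 1) j (face A n (i - 1) x)"

definition simp_tensor ::
  "'a simplicial \<Rightarrow> 'b simplicial \<Rightarrow> ('a \<times> 'b \<Rightarrow>\<^sub>0 int) set simplicial"
  (infixl "\<otimes>\<^sub>\<Delta>" 70) where
  "A \<otimes>\<^sub>\<Delta> B =
     \<lparr>sgroup = (\<lambda>n. tensor_group (sgroup A n) (sgroup B n)),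
      face = (\<lambda>n i. tensor_map (sgroup A (n - 1)) (sgroup B (n - 1)) (face A n i) (face B n i)),
      degen = (\<lambda>n i. tensor_map (sgroup A (Suc n)) (sgroup B (Suc n)) (degen A n i) (degen B n i))\<rparr>"

lemma simplicial_abelian_group_tensor:
  assumes "simplicial_abelian_group A" and "simplicial_abelian_group B"
  shows "simplicial_abelian_group (A \<otimes>\<^sub>\<Delta> B)"
proof -
  interpret A: simplicial_abelian_group A by fact
  interpret B: simplicial_abelian_group B by fact
  have grp: "group (sgroup A n)" "group (sgroup B n)" for n
    using A.comm_group B.comm_group by (auto intro: comm_group.axioms(2))
  have face_hom': "face A n i \<in> hom (sgroup A n) (sgroup A (n - 1))"
      "face B n i \<in> hom (sgroup B n) (sgroup B (n - 1))" if "0 < n" "i \<le> n" for n i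
    using A.face_hom[of i "n - 1"] B.face_hom[of i "n - 1"] that by auto
  have degen_hom': "degen A (n - 1) i \<in> hom (sgroup A (n - 1)) (sgroup A n)"
      "degen B (n - 1) i \<in> hom (sgroup B (n - 1)) (sgroup B n)" if "i < n" for n i
    using A.degen_hom[of i "n - 1"] B.degen_hom[of i "n - 1"] that by auto
  note homs = A.face_hom B.face_hom A.degen_hom B.degen_hom face_hom' degen_hom'
  note eq = tensor_map_comp_eqI[OF grp grp grp grp, rotated 10]
    and eq_id = tensor_map_comp_idI[OF grp grp, rotated 6]
  show ?thesis
  proof (rule simplicial_abelian_group.intro)
    fix n
    show "comm_group (sgroup (A \<otimes>\<^sub>\<Delta> B) n)"
      using grp by (simp add: simp_tensor_def comm_group_tensor_group)
  next
    fix i n assume "i \<le> Suc n"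
    then show "face (A \<otimes>\<^sub>\<Delta> B) (Suc n) i \<in> hom (sgroup (A \<otimes>\<^sub>\<Delta> B) (Suc n)) (sgroup (A \<otimes>\<^sub>\<Delta> B) n)"
      using grp homs by (simp add: simp_tensor_def tensor_map_hom)
  next
    fix i n :: nat assume "i \<le> n"
    then show "degen (A \<otimes>\<^sub>\<Delta> B) n i \<in> hom (sgroup (A \<otimes>\<^sub>\<Delta> B) n) (sgroup (A \<otimes>\<^sub>\<Delta> B) (Suc n))"
      using grp homs by (simp add: simp_tensor_def tensor_map_hom)
  next
    fix i j n x assume *: "i < j" "j \<le> Suc (Suc n)" "x \<in> carrier (sgroup (A \<otimes>\<^sub>\<Delta> B) (Suc (Suc n)))"
    show "face (A \<otimes>\<^sub>\<Delta> B) (Suc n) i (face (A \<otimes>\<^sub>\<Delta> B) (Suc (Suc n)) j x) =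
        face (A \<otimes>\<^sub>\<Delta> B) (Suc n) (j - 1) (face (A \<otimes>\<^sub>\<Delta> B) (Suc (Suc n)) i x)"
      unfolding simp_tensor_def simplicial.simps diff_Suc_1
      by (rule eq, rule *(3)[unfolded simp_tensor_def simplicial.simps])
        (use * in \<open>auto simp: A.face_face B.face_face intro!: homs\<close>)
  next
    fix i j n x assume *: "i \<le> j" "j \<le> n" "x \<in> carrier (sgroup (A \<otimes>\<^sub>\<Delta> B) n)"
    show "degen (A \<otimes>\<^sub>\<Delta> B) (Suc n) i (degen (A \<otimes>\<^sub>\<Delta> B) n j x) =
        degen (A \<otimes>\<^sub>\<Delta> B) (Suc n) (Suc j) (degen (A \<otimes>\<^sub>\<Delta> B) n i x)"
      unfolding simp_tensor_def simplicial.simps diff_Suc_1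
      by (rule eq, rule *(3)[unfolded simp_tensor_def simplicial.simps])
        (use * in \<open>auto simp: A.degen_degen B.degen_degen intro!: homs\<close>)
  next
    fix i j n x assume *: "i < j" "j \<le> n" "x \<in> carrier (sgroup (A \<otimes>\<^sub>\<Delta> B) n)"
    obtain m where m: "n = Suc m" using * by (cases n) auto
    show "face (A \<otimes>\<^sub>\<Delta> B) (Suc n) i (degen (A \<otimes>\<^sub>\<Delta> B) n j x) =
        degen (A \<otimes>\<^sub>\<Delta> B) (n - 1) (j - 1) (face (A \<otimes>\<^sub>\<Delta> B) n i x)"
      unfolding simp_tensor_def simplicial.simps diff_Suc_1 m
      by (rule eq, rule *(3)[unfolded simp_tensor_def simplicial.simps m])
        (use * m in \<open>auto simp: A.face_degen_less B.face_degen_less intro!: homs\<close>)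
  next
    fix i j n x assume *: "i = j \<or> i = Suc j" "j \<le> n" "x \<in> carrier (sgroup (A \<otimes>\<^sub>\<Delta> B) n)"
    show "face (A \<otimes>\<^sub>\<Delta> B) (Suc n) i (degen (A \<otimes>\<^sub>\<Delta> B) n j x) = x"
      unfolding simp_tensor_def simplicial.simps diff_Suc_1
      by (rule eq_id, rule *(3)[unfolded simp_tensor_def simplicial.simps])
        (use * in \<open>auto simp: A.face_degen_eq B.face_degen_eq intro!: homs\<close>)
  next
    fix i j n x assume *: "Suc j < i" "i \<le> Suc n" "x \<in> carrier (sgroup (A \<otimes>\<^sub>\<Delta> B) n)"
    obtain m where m: "n = Suc m" using * by (cases n) auto
    show "face (A \<otimes>\<^sub>\<Delta> B) (Suc n) i (degen (A \<otimes>\<^sub>\<Delta> B) n j x) =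
        degen (A \<otimes>\<^sub>\<Delta> B) (n - 1) j (face (A \<otimes>\<^sub>\<Delta> B) n (i - 1) x)"
      unfolding simp_tensor_def simplicial.simps diff_Suc_1 m
      by (rule eq, rule *(3)[unfolded simp_tensor_def simplicial.simps m])
        (use * m in \<open>auto simp: A.face_degen_greater B.face_degen_greater intro!: homs\<close>)
  qed
qed

text \<open>
  Morphisms of simplicial groups and of complexes are families of maps indexed by the degree,
  composed degreewise.
\<close>

definition graded_comp ::
  "(nat \<Rightarrow> 'b \<Rightarrow> 'c) \<Rightarrow> (nat \<Rightarrow> 'a \<Rightarrow> 'b) \<Rightarrow> nat \<Rightarrow> 'a \<Rightarrow> 'c" (infixl "\<circ>\<^sub>g" 55) where
  "(f \<circ>\<^sub>g g) n = f n \<circ> g n"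

definition simp_middle_swap where
  "simp_middle_swap X Y Z W n =
     tensor_middle_swap (sgroup X n) (sgroup Y n) (sgroup Z n) (sgroup W n)"


section \<open>Chain complexes\<close>

text \<open>Non-negative homological degrees; \<open>cdiff K n\<close> is the differential \<open>K\<^bsub>n+1\<^esub> \<rightarrow> K\<^sub>n\<close>.\<close>

record 'a chain_complex =
  cgroup :: "nat \<Rightarrow> 'a monoid"
  cdiff :: "nat \<Rightarrow> 'a \<Rightarrow> 'a"

subsection \<open>Tensor products of complexes\<close>

definition degree_pairs :: "nat \<Rightarrow> (nat \<times> nat) set" where
  "degree_pairs n = {(p, q). p + q = n}"

definition cx_tensor_group where
  "cx_tensor_group A B n =
     sum_group (degree_pairs n) (\<lambda>(p, q). tensor_group (cgroup A p) (cgroup B q))"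

text \<open>The homogeneous tensor \<open>a \<otimes> b\<close> with \<open>|a| = p\<close> and \<open>|b| = q\<close>, in total degree \<open>p + q\<close>.\<close>

definition cx_tensor_elt where
  "cx_tensor_elt A B p q a b =
     (\<lambda>(r, s)\<in>degree_pairs (p + q).
        if (r, s) = (p, q) then tensor_elt (cgroup A p) (cgroup B q) a b
        else \<one>\<^bsub>tensor_group (cgroup A r) (cgroup B s)\<^esub>)"

text \<open>
  The homomorphism from degree \<open>n\<close> of a tensor product of complexes to \<open>K\<close> which sends \<open>a \<otimes> b\<close>
  to \<open>f p q a b\<close> if \<open>|a| = p\<close> and \<open>|b| = q\<close>.
\<close>

definition cx_tensor_lift ::
  "('c, 'k) monoid_scheme \<Rightarrow> (nat \<Rightarrow> nat \<Rightarrow> 'a \<Rightarrow> 'b \<Rightarrow> 'c) \<Rightarrow> nat \<Rightarrow>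
   (nat \<times> nat \<Rightarrow> ('a \<times> 'b \<Rightarrow>\<^sub>0 int) set) \<Rightarrow> 'c" where
  "cx_tensor_lift K f n u =
     (\<Otimes>\<^bsub>K\<^esub>w\<in>degree_pairs n. tensor_lift K (f (fst w) (snd w)) (u w))"

definition cx_tensor ::
  "'a chain_complex \<Rightarrow> 'b chain_complex \<Rightarrow>
   (nat \<times> nat \<Rightarrow> ('a \<times> 'b \<Rightarrow>\<^sub>0 int) set) chain_complex"
  (infixl "\<otimes>\<^sub>C" 70) where
  "A \<otimes>\<^sub>C B =
     \<lparr>cgroup = cx_tensor_group A B,
      cdiff = (\<lambda>n. cx_tensor_lift (cx_tensor_group A B n)
        (\<lambda>p q a b.
           (if p = 0 then \<one>\<^bsub>cx_tensor_group A B n\<^esub>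
            else cx_tensor_elt A B (p - 1) q (cdiff A (p - 1) a) b) \<otimes>\<^bsub>cx_tensor_group A B n\<^esub>
           (if q = 0 then \<one>\<^bsub>cx_tensor_group A B n\<^esub>
            else cx_tensor_elt A B p (q - 1) a (cdiff B (q - 1) b)
                   [^]\<^bsub>cx_tensor_group A B n\<^esub> ((- 1) ^ p :: int)))
        (Suc n))\<rparr>"

definition cx_tensor_map where
  "cx_tensor_map A' B' f g n =
     cx_tensor_lift (cgroup (A' \<otimes>\<^sub>C B') n) (\<lambda>p q a b. cx_tensor_elt A' B' p q (f p a) (g q b)) n"

definition cx_swap where
  "cx_swap A B n =
     cx_tensor_lift (cgroup (B \<otimes>\<^sub>C A) n)
       (\<lambda>p q a b. cx_tensor_elt B A q p b a [^]\<^bsub>cgroup (B \<otimes>\<^sub>C A) n\<^esub> ((- 1) ^ (p * q) :: int)) n"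

definition cx_assoc where
  "cx_assoc A B D n =
     cx_tensor_lift (cgroup (A \<otimes>\<^sub>C (B \<otimes>\<^sub>C D)) n)
       (\<lambda>m r u d. cx_tensor_lift (cgroup (A \<otimes>\<^sub>C (B \<otimes>\<^sub>C D)) n)
          (\<lambda>p q a b. cx_tensor_elt A (B \<otimes>\<^sub>C D) p (q + r) a (cx_tensor_elt B D q r b d)) m u) n"

definition cx_assoc_inv where
  "cx_assoc_inv A B D n =
     cx_tensor_lift (cgroup ((A \<otimes>\<^sub>C B) \<otimes>\<^sub>C D) n)
       (\<lambda>p m a. cx_tensor_lift (cgroup ((A \<otimes>\<^sub>C B) \<otimes>\<^sub>C D) n)
          (\<lambda>q r b d. cx_tensor_elt (A \<otimes>\<^sub>C B) D (p + q) r (cx_tensor_elt A B p q a b) d) m) n"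

abbreviation graded_id :: "nat \<Rightarrow> 'a \<Rightarrow> 'a" where
  "graded_id \<equiv> \<lambda>n. id"

text \<open>\<open>id \<otimes> \<sigma> \<otimes> id\<close>, bracketed in the same way as \<^const>\<open>tensor_middle_swap\<close>.\<close>

definition cx_middle_swap where
  "cx_middle_swap A B D E =
     cx_assoc_inv A D (B \<otimes>\<^sub>C E) \<circ>\<^sub>g
     cx_tensor_map A (D \<otimes>\<^sub>C (B \<otimes>\<^sub>C E)) graded_id (cx_assoc D B E) \<circ>\<^sub>g
     cx_tensor_map A ((D \<otimes>\<^sub>C B) \<otimes>\<^sub>C E) graded_id
       (cx_tensor_map (D \<otimes>\<^sub>C B) E (cx_swap B D) graded_id) \<circ>\<^sub>g
     cx_tensor_map A ((B \<otimes>\<^sub>C D) \<otimes>\<^sub>C E) graded_id (cx_assoc_inv B D E) \<circ>\<^sub>g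
     cx_assoc A B (D \<otimes>\<^sub>C E)"

subsection \<open>Quotient complexes\<close>

text \<open>
  The map on quotients induced by \<open>f\<close>, where \<open>p\<close> is the projection from the set \<open>S\<close> onto its
  quotient and \<open>p'\<close> that of the target of \<open>f\<close>. If \<open>f\<close> does not descend, then \<^const>\<open>the_elem\<close> is
  applied to a set which is not a singleton.
\<close>

definition induced_map ::
  "'a set \<Rightarrow> ('a \<Rightarrow> 'c) \<Rightarrow> ('b \<Rightarrow> 'd) \<Rightarrow> ('a \<Rightarrow> 'b) \<Rightarrow> 'c \<Rightarrow> 'd" where
  "induced_map S p p' f t = the_elem ((\<lambda>x. p' (f x)) ` {x \<in> S. p x = t})"

text \<open>The subcomplex generated by a graded subset \<open>S\<close> is spanned by \<open>S\<close> and its boundaries.\<close>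

definition generated_subcomplex ::
  "'a chain_complex \<Rightarrow> (nat \<Rightarrow> 'a set) \<Rightarrow> nat \<Rightarrow> 'a set" where
  "generated_subcomplex K S n = generate (cgroup K n) (S n \<union> cdiff K n ` S (Suc n))"

definition quotient_proj ::
  "'a chain_complex \<Rightarrow> (nat \<Rightarrow> 'a set) \<Rightarrow> nat \<Rightarrow> 'a \<Rightarrow> 'a set" where
  "quotient_proj K D n x = D n #>\<^bsub>cgroup K n\<^esub> x"

definition quotient_complex ::
  "'a chain_complex \<Rightarrow> (nat \<Rightarrow> 'a set) \<Rightarrow> 'a set chain_complex" where
  "quotient_complex K D =
     \<lparr>cgroup = (\<lambda>n. cgroup K n Mod D n),
      cdiff = (\<lambda>n. induced_map (carrier (cgroup K (Suc n)))
                     (quotient_proj K D (Suc n)) (quotient_proj K D n) (cdiff K n))\<rparr>"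


section \<open>The functor \<open>C\<close> with its Alexander--Whitney and shuffle maps\<close>

definition C :: "'a simplicial \<Rightarrow> 'a chain_complex" where
  "C A =
     \<lparr>cgroup = sgroup A,
      cdiff = (\<lambda>n x. \<Otimes>\<^bsub>sgroup A n\<^esub>i\<in>{..Suc n}. face A (Suc n) i x [^]\<^bsub>sgroup A n\<^esub> ((- 1) ^ i :: int))\<rparr>"

definition C_map :: "(nat \<Rightarrow> 'a \<Rightarrow> 'b) \<Rightarrow> nat \<Rightarrow> 'a \<Rightarrow> 'b" where
  "C_map f = f"

text \<open>Iterated first and last faces of an \<open>n\<close>-simplex.\<close>

fun first_faces :: "'a simplicial \<Rightarrow> nat \<Rightarrow> nat \<Rightarrow> 'a \<Rightarrow> 'a" where
  "first_faces A n 0 x = x"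
| "first_faces A n (Suc j) x = first_faces A (n - 1) j (face A n 0 x)"

fun last_faces :: "'a simplicial \<Rightarrow> nat \<Rightarrow> nat \<Rightarrow> 'a \<Rightarrow> 'a" where
  "last_faces A n 0 x = x"
| "last_faces A n (Suc i) x = last_faces A (n - 1) i (face A n n x)"

definition AW where
  "AW A B n =
     tensor_lift (cgroup (C A \<otimes>\<^sub>C C B) n)
       (\<lambda>a b. \<Otimes>\<^bsub>cgroup (C A \<otimes>\<^sub>C C B) n\<^esub>w\<in>degree_pairs n.
          (case w of (i, j) \<Rightarrow>
             cx_tensor_elt (C A) (C B) (n - i) (n - j) (last_faces A n i a) (first_faces B n j b)))"

definition shuffles :: "nat \<Rightarrow> nat \<Rightarrow> (nat set \<times> nat set) set" where
  "shuffles k l =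
     {(\<alpha>, \<beta>). \<alpha> \<subseteq> {..<k + l} \<and> \<beta> \<subseteq> {..<k + l} \<and> \<alpha> \<inter> \<beta> = {} \<and> card \<alpha> = k \<and> card \<beta> = l}"

definition shuffle_perm :: "nat set \<Rightarrow> nat set \<Rightarrow> nat \<Rightarrow> nat" where
  "shuffle_perm \<alpha> \<beta> i =
     (let xs = sorted_list_of_set \<alpha> @ sorted_list_of_set \<beta> in if i < length xs then xs ! i else i)"

text \<open>
  \<open>degens A n [i\<^sub>1, \<dots>, i\<^sub>r]\<close> is \<open>s\<close> with index \<open>i\<^sub>r\<close> after \<open>\<dots>\<close> after \<open>s\<close> with index \<open>i\<^sub>1\<close> on
  \<open>n\<close>-simplices, so that \<open>S\<^sub>\<alpha>\<close> applies the smallest index first.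
\<close>

fun degens :: "'a simplicial \<Rightarrow> nat \<Rightarrow> nat list \<Rightarrow> 'a \<Rightarrow> 'a" where
  "degens A n [] x = x"
| "degens A n (i # is) x = degens A (Suc n) is (degen A n i x)"

definition degen_set :: "'a simplicial \<Rightarrow> nat \<Rightarrow> nat set \<Rightarrow> 'a \<Rightarrow> 'a" where
  "degen_set A n \<alpha> = degens A n (sorted_list_of_set \<alpha>)"

definition shuffle_map where
  "shuffle_map A B n =
     cx_tensor_lift (cgroup (C (A \<otimes>\<^sub>\<Delta> B)) n)
       (\<lambda>k l a b. \<Otimes>\<^bsub>cgroup (C (A \<otimes>\<^sub>\<Delta> B)) n\<^esub>w\<in>shuffles k l.
          (case w of (\<alpha>, \<beta>) \<Rightarrow>
             tensor_elt (sgroup A n) (sgroup B n) (degen_set A k \<beta> a) (degen_set B l \<alpha> b)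
               [^]\<^bsub>cgroup (C (A \<otimes>\<^sub>\<Delta> B)) n\<^esub> sign (shuffle_perm \<alpha> \<beta>))) n"


section \<open>The normalized functor \<open>N\<close>\<close>

fun degenerate :: "'a simplicial \<Rightarrow> nat \<Rightarrow> 'a set" where
  "degenerate A 0 = {}"
| "degenerate A (Suc n) = (\<Union>i\<le>n. degen A n i ` carrier (sgroup A n))"

definition N :: "'a simplicial \<Rightarrow> 'a set chain_complex" where
  "N A = quotient_complex (C A) (generated_subcomplex (C A) (degenerate A))"

definition N_proj :: "'a simplicial \<Rightarrow> nat \<Rightarrow> 'a \<Rightarrow> 'a set" where
  "N_proj A = quotient_proj (C A) (generated_subcomplex (C A) (degenerate A))"

definition N_map where
  "N_map A B f n = induced_map (carrier (cgroup (C A) n)) (N_proj A n) (N_proj B n) (C_map f n)"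

definition N_tensor_proj where
  "N_tensor_proj A B = cx_tensor_map (N A) (N B) (N_proj A) (N_proj B)"

definition AW_N where
  "AW_N A B n =
     induced_map (carrier (cgroup (C (A \<otimes>\<^sub>\<Delta> B)) n))
       (N_proj (A \<otimes>\<^sub>\<Delta> B) n) (N_tensor_proj A B n) (AW A B n)"

definition shuffle_map_N where
  "shuffle_map_N A B n =
     induced_map (carrier (cgroup (C A \<otimes>\<^sub>C C B) n))
       (N_tensor_proj A B n) (N_proj (A \<otimes>\<^sub>\<Delta> B) n) (shuffle_map A B n)"

end

theory Submission
  imports Defs
begin

text \<open>
  Both composites are homomorphisms, so they are compared on \<open>(x \<otimes> y) \<otimes> (z \<otimes> w)\<close> with
  \<open>|x| = |y| = k\<close> and \<open>|z| = |w| = l\<close>. The first composite is a sum over a \<open>(k, l)\<close>-shuffle and a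
  cut \<open>p + q = k + l\<close>. Cutting the shuffle at \<open>p\<close> gives a \<open>(k\<^sub>1, l\<^sub>1)\<close>-shuffle and a \<open>(k\<^sub>2, l\<^sub>2)\<close>-shuffle with
  \<open>k\<^sub>1 + l\<^sub>1 = p\<close> and \<open>k\<^sub>2 + l\<^sub>2 = q\<close>, which is exactly the data indexing the second composite. The front
  \<open>p\<close>-face of \<open>S\<^sub>\<beta> x\<close> only sees the part of \<open>\<beta>\<close> below \<open>p\<close>, its back \<open>q\<close>-face only the rest, and the
  signs agree because the inversions of the shuffle across the cut number \<open>k\<^sub>2 l\<^sub>1\<close>, the exponent of the
  Koszul sign of the swap.

  For the normalized complexes both structure maps commute with the projections from \<open>C\<close> to \<open>N\<close>, and the
  projections \<open>C A \<otimes> C B \<rightarrow> N A \<otimes> N B\<close> are onto, so the identity descends.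
\<close>

section \<open>Biadditive maps and tensor products of complexes\<close>

text \<open>The Koszul sign comes from two ways of reading the same indices. The joined shuffle
  lists all its \<alpha>-indices before its \<beta>-indices, in blocks \<open>\<alpha>1\<close>,
  \<open>\<alpha>2\<close>, \<open>\<beta>1\<close>, \<open>\<beta>2\<close>; its two pieces list
  \<open>\<alpha>1\<close>, \<open>\<beta>1\<close>, \<open>\<alpha>2\<close>,
  \<open>\<beta>2\<close>. The two words differ by moving \<open>\<alpha>2\<close> past
  \<open>\<beta>1\<close>, which costs \<open>k2 * l1\<close> transpositions. In the second
  composite the interchanged factors are a back face of \<open>y\<close>, of degree
  \<open>k2\<close>, and a front face of \<open>z\<close>, of degree \<open>l1\<close>. So the
  identity holds summand by summand.

  What shapes the proof is that every map out of a tensor product is a lift, whose values are known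
  only on elementary tensors and only once the lifted function is biadditive. Hence each map comes
  with two facts: it is a homomorphism, and it has a known value on elementary tensors. The
  associativity isomorphisms are lifts of lifts, so their inner lift must be shown additive in the
  outer variable as well. On \<open>N\<close> the maps are defined through \<open>the_elem\<close>
  and have the intended values only after descent is proved: for \<open>AW\<close> from degenerate
  simplices of \<open>A \<otimes>\<^sub>\<Delta> B\<close>, for the shuffle map from degenerate
  simplices in either factor.\<close>

lemma hom_in_carrier: "f \<in> hom G H \<Longrightarrow> x \<in> carrier G \<Longrightarrow> f x \<in> carrier H"
  by (auto simp: hom_def)

lemma hom_finprod_eq:
  assumes "f \<in> hom G H" "comm_group G" "comm_group H" "\<And>i. i \<in> I \<Longrightarrow> g i \<in> carrier G"
  shows "f (finprod G g I) = finprod H (\<lambda>i. f (g i)) I"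
proof -
  interpret G: comm_group G by fact
  interpret H: comm_group H by fact
  interpret f: group_hom G H f using assms(1) by unfold_locales
  show ?thesis using assms(4)
  proof (induction I rule: infinite_finite_induct)
    case (insert x F)
    then have "finprod G g (insert x F) = g x \<otimes>\<^bsub>G\<^esub> finprod G g F"
      by (intro G.finprod_insert) auto
    moreover have "finprod H (\<lambda>i. f (g i)) (insert x F) = f (g x) \<otimes>\<^bsub>H\<^esub> finprod H (\<lambda>i. f (g i)) F"
      using insert by (intro H.finprod_insert) auto
    moreover have "finprod G g F \<in> carrier G" using insert by (intro G.finprod_closed) auto
    ultimately show ?case using insert by simp
  qed (auto simp: f.hom_one)
qed

lemma hom_finprodI:
  assumes "group G" "comm_group H" "\<And>i. i \<in> I \<Longrightarrow> f i \<in> hom G H"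
  shows "(\<lambda>x. finprod H (\<lambda>i. f i x) I) \<in> hom G H"
proof -
  interpret G: group G by fact
  interpret H: comm_group H by fact
  have c: "f i x \<in> carrier H" if "i \<in> I" "x \<in> carrier G" for i x
    using assms(3) that by (auto simp: hom_def)
  show ?thesis
  proof (rule homI)
    fix x y assume xy: "x \<in> carrier G" "y \<in> carrier G"
    have "finprod H (\<lambda>i. f i (x \<otimes>\<^bsub>G\<^esub> y)) I = finprod H (\<lambda>i. f i x \<otimes>\<^bsub>H\<^esub> f i y) I"
      using xy c assms(3) by (intro H.finprod_cong') (auto simp: hom_def)
    also have "\<dots> = finprod H (\<lambda>i. f i x) I \<otimes>\<^bsub>H\<^esub> finprod H (\<lambda>i. f i y) I"
      using xy c by (intro H.finprod_multf) auto
    finally show "finprod H (\<lambda>i. f i (x \<otimes>\<^bsub>G\<^esub> y)) I =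
      finprod H (\<lambda>i. f i x) I \<otimes>\<^bsub>H\<^esub> finprod H (\<lambda>i. f i y) I" .
  qed (use c in \<open>auto intro!: H.finprod_closed\<close>)
qed

lemma hom_int_powI:
  assumes "comm_group H" "f \<in> hom G H"
  shows "(\<lambda>x. f x [^]\<^bsub>H\<^esub> (k::int)) \<in> hom G H"
proof -
  interpret H: comm_group H by fact
  show ?thesis using assms(2) by (auto simp: hom_def Pi_iff H.int_pow_distrib)
qed

lemma group_of_comm: "comm_group G \<Longrightarrow> group G"
  by (rule comm_group.axioms(2))

lemma hom_oneI: "group G \<Longrightarrow> comm_group H \<Longrightarrow> (\<lambda>x. \<one>\<^bsub>H\<^esub>) \<in> hom G H"
  by (auto simp: hom_def group.is_monoid[OF group_of_comm] monoid.l_one)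

lemma hom_o: "f \<in> hom G H \<Longrightarrow> g \<in> hom H K \<Longrightarrow> (\<lambda>x. g (f x)) \<in> hom G K"
  using hom_compose[of f G H g K] by (simp add: comp_def)

lemma biadditiveI:
  assumes "\<And>g. g \<in> carrier G \<Longrightarrow> f g \<in> hom H K"
    and "\<And>h. h \<in> carrier H \<Longrightarrow> (\<lambda>g. f g h) \<in> hom G K"
  shows "biadditive G H K f"
  using assms by (auto simp: biadditive_def)

lemma biadditiveD1: "biadditive G H K f \<Longrightarrow> g \<in> carrier G \<Longrightarrow> f g \<in> hom H K"
  by (simp add: biadditive_def)

lemma biadditiveD2: "biadditive G H K f \<Longrightarrow> h \<in> carrier H \<Longrightarrow> (\<lambda>g. f g h) \<in> hom G K"
  by (simp add: biadditive_def)

lemma biadditive_closed: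
  "biadditive G H K f \<Longrightarrow> g \<in> carrier G \<Longrightarrow> h \<in> carrier H \<Longrightarrow> f g h \<in> carrier K"
  by (auto simp: biadditive_def hom_def)

lemma biadditive_finprod:
  assumes "group G" "group H" "comm_group K" "\<And>i. i \<in> I \<Longrightarrow> biadditive G H K (f i)"
  shows "biadditive G H K (\<lambda>g h. finprod K (\<lambda>i. f i g h) I)"
  by (rule biadditiveI; rule hom_finprodI) (use assms in \<open>auto simp: biadditive_def\<close>)

lemma biadditive_int_pow:
  assumes "comm_group K" "biadditive G H K f"
  shows "biadditive G H K (\<lambda>g h. f g h [^]\<^bsub>K\<^esub> (k::int))"
  by (rule biadditiveI; rule hom_int_powI) (use assms in \<open>auto simp: biadditive_def\<close>)

lemma biadditive_pre:
  assumes "biadditive G' H' K F" "f \<in> hom G G'" "g \<in> hom H H'"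
  shows "biadditive G H K (\<lambda>a b. F (f a) (g b))"
proof (rule biadditiveI)
  fix a assume "a \<in> carrier G"
  then have "F (f a) \<in> hom H' K"
    by (rule biadditiveD1[OF assms(1) hom_in_carrier[OF assms(2)]])
  then show "(\<lambda>b. F (f a) (g b)) \<in> hom H K" by (rule hom_o[OF assms(3)])
next
  fix b assume "b \<in> carrier H"
  then have "(\<lambda>a. F a (g b)) \<in> hom G' K"
    by (rule biadditiveD2[OF assms(1) hom_in_carrier[OF assms(3)]])
  then show "(\<lambda>a. F (f a) (g b)) \<in> hom G K" by (rule hom_o[OF assms(2)])
qed

lemma biadditive_post:
  assumes "biadditive G H K F" "\<phi> \<in> hom K L"
  shows "biadditive G H L (\<lambda>a b. \<phi> (F a b))"
  by (rule biadditiveI; rule hom_o[OF _ assms(2)]) (use assms in \<open>auto simp: biadditive_def\<close>)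

lemma biadditive_flip: "biadditive G H K F \<Longrightarrow> biadditive H G K (\<lambda>h g. F g h)"
  by (auto simp: biadditive_def)

text \<open>Records the graded abelian group underlying a complex; the two composites are compared
  degree by degree.\<close>

definition graded_group :: "'a chain_complex \<Rightarrow> bool" where
  "graded_group A \<longleftrightarrow> (\<forall>n. comm_group (cgroup A n))"

lemma graded_groupD: "graded_group A \<Longrightarrow> comm_group (cgroup A n)"
  by (simp add: graded_group_def)

lemma graded_groupD': "graded_group A \<Longrightarrow> group (cgroup A n)"
  by (simp add: graded_group_def group_of_comm)

lemma finite_degree_pairs [simp]: "finite (degree_pairs n)"
  by (rule finite_subset[of _ "{..n} \<times> {..n}"]) (auto simp: degree_pairs_def)

lemma mem_degree_pairs [simp]: "(p, q) \<in> degree_pairs n \<longleftrightarrow> p + q = n"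
  by (simp add: degree_pairs_def)

lemma cgroup_cx_tensor [simp]: "cgroup (A \<otimes>\<^sub>C B) = cx_tensor_group A B"
  by (simp add: cx_tensor_def)

text \<open>Inclusion of the summand indexed by \<open>w\<close> into the direct sum in degree
  \<open>n\<close>. Composed with \<open>tensor_elt\<close> it gives \<open>cx_tensor_elt\<close>,
  so biadditivity and the decomposition of elements follow from its being a homomorphism.\<close>

definition cx_tensor_inj where
  "cx_tensor_inj A B n w t = (\<lambda>v\<in>degree_pairs n. if v = w then t
     else \<one>\<^bsub>(case v of (p, q) \<Rightarrow> tensor_group (cgroup A p) (cgroup B q))\<^esub>)"

section \<open>Tensor product of two graded groups: decomposition and universal property\<close>

context
  fixes A :: "'a chain_complex" and B :: "'b chain_complex"
  assumes A: "graded_group A" and B: "graded_group B"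
begin

private abbreviation (input) T :: "nat \<times> nat \<Rightarrow> ('a \<times> 'b \<Rightarrow>\<^sub>0 int) set monoid" where
  "T \<equiv> \<lambda>(p, q). tensor_group (cgroup A p) (cgroup B q)"

private lemma comm_T: "comm_group (T w)"
  using A B by (auto simp: graded_groupD' comm_group_tensor_group split: prod.split)

private lemma grp_T: "group (T w)"
  using comm_T by (rule group_of_comm)

text \<open>Finiteness of \<open>degree_pairs n\<close> makes the finite support condition of
  \<open>sum_group\<close> automatic, so the direct sum is the full product.\<close>

lemma carrier_cx_tensor_group:
  "carrier (cx_tensor_group A B n) = (\<Pi>\<^sub>E w\<in>degree_pairs n. carrier (T w))"
  unfolding cx_tensor_group_def by (subst carrier_sum_group[of _ T, OF grp_T]) simp

lemma comm_group_cx_tensor_group: "comm_group (cx_tensor_group A B n)"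
proof -
  have "group (cx_tensor_group A B n)"
    unfolding cx_tensor_group_def by (rule sum_group) (rule grp_T)
  then show ?thesis
  proof (rule group.group_comm_groupI)
    fix x y assume xy: "x \<in> carrier (cx_tensor_group A B n)" "y \<in> carrier (cx_tensor_group A B n)"
    have "x w \<otimes>\<^bsub>T w\<^esub> y w = y w \<otimes>\<^bsub>T w\<^esub> x w" if "w \<in> degree_pairs n" for w
      using xy that unfolding carrier_cx_tensor_group
      by (intro comm_monoid.m_comm[OF comm_group.axioms(1)[OF comm_T]]) (auto simp only: PiE_iff)
    then show "x \<otimes>\<^bsub>cx_tensor_group A B n\<^esub> y = y \<otimes>\<^bsub>cx_tensor_group A B n\<^esub> x"
      unfolding cx_tensor_group_def mult_sum_group by (rule restrict_ext)
  qed
qed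

lemma graded_group_cx_tensor: "graded_group (A \<otimes>\<^sub>C B)"
  by (simp add: graded_group_def comm_group_cx_tensor_group)

lemma cx_tensor_group_component_hom:
  "w \<in> degree_pairs n \<Longrightarrow> (\<lambda>u. u w) \<in> hom (cx_tensor_group A B n) (T w)"
  by (rule homI) (auto simp only: carrier_cx_tensor_group PiE_iff, auto simp: cx_tensor_group_def)

lemma cx_tensor_inj_hom:
  assumes "w \<in> degree_pairs n"
  shows "cx_tensor_inj A B n w \<in> hom (T w) (cx_tensor_group A B n)"
proof (rule homI)
  fix t assume "t \<in> carrier (T w)"
  then have "(if v = w then t else \<one>\<^bsub>T v\<^esub>) \<in> carrier (T v)" for v
    using monoid.one_closed[OF group.is_monoid[OF grp_T[of v]]] by (simp only: split: if_split) simp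
  then show "cx_tensor_inj A B n w t \<in> carrier (cx_tensor_group A B n)"
    unfolding carrier_cx_tensor_group cx_tensor_inj_def restrict_PiE_iff by blast
next
  fix s t assume "s \<in> carrier (T w)" "t \<in> carrier (T w)"
  have "(if v = w then s \<otimes>\<^bsub>T w\<^esub> t else \<one>\<^bsub>T v\<^esub>) =
    (if v = w then s else \<one>\<^bsub>T v\<^esub>) \<otimes>\<^bsub>T v\<^esub> (if v = w then t else \<one>\<^bsub>T v\<^esub>)" for v
    using monoid.l_one[OF group.is_monoid monoid.one_closed[OF group.is_monoid], OF grp_T grp_T, of v]
    by (simp only: split: if_split) simp
  then show "cx_tensor_inj A B n w (s \<otimes>\<^bsub>T w\<^esub> t) =
    cx_tensor_inj A B n w s \<otimes>\<^bsub>cx_tensor_group A B n\<^esub> cx_tensor_inj A B n w t"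
    unfolding cx_tensor_inj_def cx_tensor_group_def mult_sum_group
    by (intro restrict_ext) (simp only: restrict_apply' simp_thms)
qed

lemma cx_tensor_elt_eq_inj:
  "p + q = n \<Longrightarrow> cx_tensor_elt A B p q a b =
     cx_tensor_inj A B n (p, q) (tensor_elt (cgroup A p) (cgroup B q) a b)"
  by (auto simp: cx_tensor_elt_def cx_tensor_inj_def intro!: restrict_ext)

lemma cx_tensor_elt_biadditive:
  assumes "p + q = n"
  shows "biadditive (cgroup A p) (cgroup B q) (cx_tensor_group A B n) (cx_tensor_elt A B p q)"
proof -
  have "biadditive (cgroup A p) (cgroup B q) (cx_tensor_group A B n)
     (\<lambda>a b. cx_tensor_inj A B n (p, q) (tensor_elt (cgroup A p) (cgroup B q) a b))"
    using cx_tensor_inj_hom[of "(p, q)" n] assms A B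
    by (intro biadditive_post[OF tensor_elt_biadditive]) (auto simp: graded_groupD')
  moreover have "(\<lambda>a b. cx_tensor_inj A B n (p, q) (tensor_elt (cgroup A p) (cgroup B q) a b)) =
      cx_tensor_elt A B p q"
    by (intro ext) (simp add: cx_tensor_elt_eq_inj[OF assms])
  ultimately show ?thesis by simp
qed

lemma cx_tensor_elt_closed:
  "p + q = n \<Longrightarrow> a \<in> carrier (cgroup A p) \<Longrightarrow> b \<in> carrier (cgroup B q) \<Longrightarrow>
   cx_tensor_elt A B p q a b \<in> carrier (cx_tensor_group A B n)"
  by (rule biadditive_closed[OF cx_tensor_elt_biadditive])

text \<open>Each component map is a homomorphism, so the product can be evaluated one component
  \<open>v\<close> at a time, and there only the factor \<open>w = v\<close> contributes.\<close>

lemma cx_tensor_group_decompose: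
  assumes u: "u \<in> carrier (cx_tensor_group A B n)"
  shows "u = finprod (cx_tensor_group A B n) (\<lambda>w. cx_tensor_inj A B n w (u w)) (degree_pairs n)"
    (is "u = ?P")
proof -
  have uw: "u w \<in> carrier (T w)" if "w \<in> degree_pairs n" for w
    using u that by (auto simp: carrier_cx_tensor_group PiE_iff)
  have c: "cx_tensor_inj A B n w (u w) \<in> carrier (cx_tensor_group A B n)" if "w \<in> degree_pairs n" for w
    using cx_tensor_inj_hom[OF that] uw[OF that] by (auto simp: hom_def)
  have P: "?P \<in> carrier (cx_tensor_group A B n)"
    using c by (intro comm_monoid.finprod_closed comm_group.axioms(1) comm_group_cx_tensor_group) auto
  have "?P v = u v" if v: "v \<in> degree_pairs n" for v
  proof -
    interpret V: comm_group "T v" by (rule comm_T)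
    have "?P v = finprod (T v) (\<lambda>w. cx_tensor_inj A B n w (u w) v) (degree_pairs n)"
      by (rule hom_finprod_eq[OF cx_tensor_group_component_hom[OF v] comm_group_cx_tensor_group comm_T c])
    also have "\<dots> = finprod (T v) (\<lambda>w. if v = w then u v else \<one>\<^bsub>T v\<^esub>) (degree_pairs n)"
      using v uw[OF v] by (intro V.finprod_cong') (auto simp: cx_tensor_inj_def)
    also have "\<dots> = u v"
      using v uw[OF v] by (intro V.finprod_singleton) auto
    finally show ?thesis .
  qed
  then show ?thesis
    using u P unfolding carrier_cx_tensor_group by (intro PiE_ext[of u _ _ ?P]) auto
qed

text \<open>The extensionality principle for maps out of a tensor product of complexes: the
  decomposition into summands reduces it to \<open>tensor_hom_eqI\<close> on each summand.\<close>

lemma cx_tensor_hom_eqI: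
  assumes K: "comm_group K"
    and \<phi>: "\<phi> \<in> hom (cx_tensor_group A B n) K" and \<psi>: "\<psi> \<in> hom (cx_tensor_group A B n) K"
    and eq: "\<And>p q a b. \<lbrakk>p + q = n; a \<in> carrier (cgroup A p); b \<in> carrier (cgroup B q)\<rbrakk> \<Longrightarrow>
      \<phi> (cx_tensor_elt A B p q a b) = \<psi> (cx_tensor_elt A B p q a b)"
    and u: "u \<in> carrier (cx_tensor_group A B n)"
  shows "\<phi> u = \<psi> u"
proof -
  interpret K: comm_group K by fact
  have uw: "u w \<in> carrier (T w)" if "w \<in> degree_pairs n" for w
    using u that by (auto simp: carrier_cx_tensor_group PiE_iff)
  have c: "cx_tensor_inj A B n w (u w) \<in> carrier (cx_tensor_group A B n)" if "w \<in> degree_pairs n" for w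
    using cx_tensor_inj_hom[OF that] uw[OF that] by (auto simp: hom_def)
  have *: "\<phi> (cx_tensor_inj A B n w (u w)) = \<psi> (cx_tensor_inj A B n w (u w))" if w: "w \<in> degree_pairs n" for w
  proof -
    obtain p q where pq: "w = (p, q)" "p + q = n" using w by (cases w) auto
    show ?thesis
    proof (rule tensor_hom_eqI[of "cgroup A p" "cgroup B q" K "\<lambda>t. \<phi> (cx_tensor_inj A B n w t)" "\<lambda>t. \<psi> (cx_tensor_inj A B n w t)"])
      show "(\<lambda>t. \<phi> (cx_tensor_inj A B n w t)) \<in> hom (tensor_group (cgroup A p) (cgroup B q)) K"
        using hom_o[OF cx_tensor_inj_hom[OF w] \<phi>] pq by simp
      show "(\<lambda>t. \<psi> (cx_tensor_inj A B n w t)) \<in> hom (tensor_group (cgroup A p) (cgroup B q)) K"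
        using hom_o[OF cx_tensor_inj_hom[OF w] \<psi>] pq by simp
    qed (use A B pq(1) uw[OF w] eq[OF pq(2), unfolded cx_tensor_elt_eq_inj[OF pq(2)]] K.is_group
        in \<open>auto simp: graded_groupD'\<close>)
  qed
  have "\<phi> u = finprod K (\<lambda>w. \<phi> (cx_tensor_inj A B n w (u w))) (degree_pairs n)"
    by (rule trans[OF arg_cong[where f = \<phi>, OF cx_tensor_group_decompose[OF u]]
      hom_finprod_eq[OF \<phi> comm_group_cx_tensor_group K c]])
  also have "\<dots> = finprod K (\<lambda>w. \<psi> (cx_tensor_inj A B n w (u w))) (degree_pairs n)"
    using * \<psi> c by (intro K.finprod_cong') (auto simp: hom_def)
  also have "\<dots> = \<psi> u"
    by (rule sym[OF trans[OF arg_cong[where f = \<psi>, OF cx_tensor_group_decompose[OF u]]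
      hom_finprod_eq[OF \<psi> comm_group_cx_tensor_group K c]]])
  finally show ?thesis .
qed

lemma cx_tensor_lift_hom:
  assumes K: "comm_group K"
    and f: "\<And>p q. p + q = n \<Longrightarrow> biadditive (cgroup A p) (cgroup B q) K (f p q)"
  shows "cx_tensor_lift K f n \<in> hom (cx_tensor_group A B n) K"
  unfolding cx_tensor_lift_def[abs_def]
proof (rule hom_finprodI[OF group_of_comm[OF comm_group_cx_tensor_group] K])
  fix w assume w: "w \<in> degree_pairs n"
  obtain p q where pq: "w = (p, q)" "p + q = n" using w by (cases w) auto
  show "(\<lambda>u. tensor_lift K (f (fst w) (snd w)) (u w)) \<in> hom (cx_tensor_group A B n) K"
    by (rule hom_o[OF cx_tensor_group_component_hom[OF w]])
      (use pq f A B K in \<open>auto intro!: tensor_lift_hom simp: graded_groupD'\<close>)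
qed

lemma cx_tensor_lift_elt:
  assumes K: "comm_group K"
    and f: "\<And>p q. p + q = n \<Longrightarrow> biadditive (cgroup A p) (cgroup B q) K (f p q)"
    and pq: "p + q = n" and ab: "a \<in> carrier (cgroup A p)" "b \<in> carrier (cgroup B q)"
  shows "cx_tensor_lift K f n (cx_tensor_elt A B p q a b) = f p q a b"
proof -
  interpret K: comm_group K by fact
  have fab: "f p q a b \<in> carrier K"
    using biadditive_closed[OF f[OF pq]] ab by auto
  have "cx_tensor_lift K f n (cx_tensor_elt A B p q a b) =
    finprod K (\<lambda>w. if (p, q) = w then f p q a b else \<one>\<^bsub>K\<^esub>) (degree_pairs n)"
    unfolding cx_tensor_lift_def
  proof (rule K.finprod_cong')
    fix w assume w: "w \<in> degree_pairs n"
    then obtain r s where rs: "w = (r, s)" "r + s = n" by (cases w) auto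
    show "tensor_lift K (f (fst w) (snd w)) (cx_tensor_elt A B p q a b w) =
      (if (p, q) = w then f p q a b else \<one>\<^bsub>K\<^esub>)"
    proof (cases "(p, q) = w")
      case True
      then show ?thesis
        using A B K f[OF pq] ab pq
        by (auto simp: cx_tensor_elt_def tensor_lift_elt graded_groupD')
    next
      case False
      \<comment> \<open>Away from \<open>(p, q)\<close> the elementary tensor has component
        \<open>\<one>\<close>, which the lift, being a homomorphism, sends to
        \<open>\<one>\<close>.\<close>
      have "tensor_lift K (f r s) \<in> hom (T w) K"
        using A B K f[OF rs(2)] rs by (auto intro!: tensor_lift_hom simp: graded_groupD')
      then have "tensor_lift K (f r s) \<one>\<^bsub>T w\<^esub> = \<one>\<^bsub>K\<^esub>"
        by (intro hom_one) (auto simp: grp_T)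
      then show ?thesis
        using False rs pq by (auto simp: cx_tensor_elt_def)
    qed
  qed (use fab in auto)
  also have "\<dots> = f p q a b"
    using pq fab by (intro K.finprod_singleton) auto
  finally show ?thesis .
qed

end

section \<open>The middle swap\<close>

text \<open>Maps of graded groups: the identity to be proved is a degreewise equality, so this is
  the setting in which the composites are formed.\<close>

definition graded_hom :: "'a chain_complex \<Rightarrow> 'b chain_complex \<Rightarrow> (nat \<Rightarrow> 'a \<Rightarrow> 'b) \<Rightarrow> bool" where
  "graded_hom A B f \<longleftrightarrow> (\<forall>n. f n \<in> hom (cgroup A n) (cgroup B n))"

lemma graded_homD: "graded_hom A B f \<Longrightarrow> f n \<in> hom (cgroup A n) (cgroup B n)"
  by (simp add: graded_hom_def)

lemma graded_hom_closed:
  "graded_hom A B f \<Longrightarrow> a \<in> carrier (cgroup A n) \<Longrightarrow> f n a \<in> carrier (cgroup B n)"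
  by (auto simp: graded_hom_def hom_def)

lemma graded_hom_id: "graded_hom A A graded_id"
  by (simp add: graded_hom_def hom_def)

lemma graded_hom_comp: "graded_hom A B f \<Longrightarrow> graded_hom B D g \<Longrightarrow> graded_hom A D (g \<circ>\<^sub>g f)"
  using hom_compose unfolding graded_hom_def graded_comp_def by blast

lemma hom_mult_pointwise:
  assumes "comm_group K" "f \<in> hom G K" "g \<in> hom G K"
  shows "(\<lambda>x. f x \<otimes>\<^bsub>K\<^esub> g x) \<in> hom G K"
proof -
  interpret K: comm_group K by fact
  show ?thesis
    using assms(2,3) by (auto simp: hom_def Pi_iff K.m_ac)
qed

text \<open>Needed for the associativity isomorphisms, which are lifts of lifts. Additivity of the
  lift in the parameter \<open>d\<close> is an equality of two homomorphisms in \<open>u\<close>,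
  hence can be checked on elementary tensors, where it is \<open>F2\<close>.\<close>

lemma biadditive_tensor_lift:
  assumes G: "group G" "group H" and K: "comm_group K"
    and F1: "\<And>d. d \<in> carrier L \<Longrightarrow> biadditive G H K (\<lambda>a b. F a b d)"
    and F2: "\<And>a b. a \<in> carrier G \<Longrightarrow> b \<in> carrier H \<Longrightarrow> (\<lambda>d. F a b d) \<in> hom L K"
    and L: "group L"
  shows "biadditive (tensor_group G H) L K (\<lambda>u d. tensor_lift K (\<lambda>a b. F a b d) u)"
proof (rule biadditiveI)
  note h = tensor_lift_hom[OF G K F1]
  fix d assume "d \<in> carrier L"
  then show "tensor_lift K (\<lambda>a b. F a b d) \<in> hom (tensor_group G H) K" by (rule h)
next
  note h = tensor_lift_hom[OF G K F1]
  fix u assume u: "u \<in> carrier (tensor_group G H)"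
  show "(\<lambda>d. tensor_lift K (\<lambda>a b. F a b d) u) \<in> hom L K"
  proof (rule homI)
    fix d assume d: "d \<in> carrier L"
    show "tensor_lift K (\<lambda>a b. F a b d) u \<in> carrier K" by (rule hom_in_carrier[OF h[OF d] u])
    fix d' assume d': "d' \<in> carrier L"
    have dd: "d \<otimes>\<^bsub>L\<^esub> d' \<in> carrier L" using d d' L by (simp add: group.is_monoid monoid.m_closed)
    show "tensor_lift K (\<lambda>a b. F a b (d \<otimes>\<^bsub>L\<^esub> d')) u =
      tensor_lift K (\<lambda>a b. F a b d) u \<otimes>\<^bsub>K\<^esub> tensor_lift K (\<lambda>a b. F a b d') u"
    proof (rule tensor_hom_eqI[OF G group_of_comm[OF K] h[OF dd] hom_mult_pointwise[OF K h[OF d] h[OF d']] _ u])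
      fix a b assume ab: "a \<in> carrier G" "b \<in> carrier H"
      show "tensor_lift K (\<lambda>a b. F a b (d \<otimes>\<^bsub>L\<^esub> d')) (tensor_elt G H a b) =
        tensor_lift K (\<lambda>a b. F a b d) (tensor_elt G H a b) \<otimes>\<^bsub>K\<^esub>
        tensor_lift K (\<lambda>a b. F a b d') (tensor_elt G H a b)"
        using tensor_lift_elt[OF G K F1 ab, OF dd] tensor_lift_elt[OF G K F1 ab, OF d]
          tensor_lift_elt[OF G K F1 ab, OF d'] F2[OF ab] d d'
        by (simp add: hom_def)
    qed
  qed
qed

text \<open>The counterpart for complexes, for \<open>cx_assoc\<close> and
  \<open>cx_assoc_inv\<close>, by the same reduction to elementary tensors.\<close>

lemma biadditive_cx_tensor_lift:
  assumes A: "graded_group A" and B: "graded_group B" and K: "comm_group K"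
    and F1: "\<And>p q d. p + q = m \<Longrightarrow> d \<in> carrier L \<Longrightarrow>
      biadditive (cgroup A p) (cgroup B q) K (\<lambda>a b. F p q a b d)"
    and F2: "\<And>p q a b. p + q = m \<Longrightarrow> a \<in> carrier (cgroup A p) \<Longrightarrow> b \<in> carrier (cgroup B q) \<Longrightarrow>
      (\<lambda>d. F p q a b d) \<in> hom L K"
    and L: "group L"
  shows "biadditive (cx_tensor_group A B m) L K (\<lambda>u d. cx_tensor_lift K (\<lambda>p q a b. F p q a b d) m u)"
proof (rule biadditiveI)
  note h = cx_tensor_lift_hom[OF A B K F1]
  fix d assume d: "d \<in> carrier L"
  show "cx_tensor_lift K (\<lambda>p q a b. F p q a b d) m \<in> hom (cx_tensor_group A B m) K"
    by (rule h[OF _ d])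
next
  note h = cx_tensor_lift_hom[OF A B K F1]
  fix u assume u: "u \<in> carrier (cx_tensor_group A B m)"
  show "(\<lambda>d. cx_tensor_lift K (\<lambda>p q a b. F p q a b d) m u) \<in> hom L K"
  proof (rule homI)
    fix d assume d: "d \<in> carrier L"
    show "cx_tensor_lift K (\<lambda>p q a b. F p q a b d) m u \<in> carrier K"
      by (rule hom_in_carrier[OF h[OF _ d] u])
    fix d' assume d': "d' \<in> carrier L"
    have dd: "d \<otimes>\<^bsub>L\<^esub> d' \<in> carrier L" using d d' L by (simp add: group.is_monoid monoid.m_closed)
    show "cx_tensor_lift K (\<lambda>p q a b. F p q a b (d \<otimes>\<^bsub>L\<^esub> d')) m u =
      cx_tensor_lift K (\<lambda>p q a b. F p q a b d) m u \<otimes>\<^bsub>K\<^esub> cx_tensor_lift K (\<lambda>p q a b. F p q a b d') m u"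
    proof (rule cx_tensor_hom_eqI[OF A B K h[OF _ dd] hom_mult_pointwise[OF K h[OF _ d] h[OF _ d']] _ u])
      fix p q a b assume pq: "p + q = m" and ab: "a \<in> carrier (cgroup A p)" "b \<in> carrier (cgroup B q)"
      note e = cx_tensor_lift_elt[OF A B K F1 pq ab]
      show "cx_tensor_lift K (\<lambda>p q a b. F p q a b (d \<otimes>\<^bsub>L\<^esub> d')) m (cx_tensor_elt A B p q a b) =
        cx_tensor_lift K (\<lambda>p q a b. F p q a b d) m (cx_tensor_elt A B p q a b) \<otimes>\<^bsub>K\<^esub>
        cx_tensor_lift K (\<lambda>p q a b. F p q a b d') m (cx_tensor_elt A B p q a b)"
        using e[OF _ dd] e[OF _ d] e[OF _ d'] F2[OF pq ab] d d'
        by (simp add: hom_def)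
    qed
  qed
qed

lemma cx_tensor_elt_hom1:
  assumes "graded_group A" "graded_group B" "p + q = n" "b \<in> carrier (cgroup B q)"
    "f \<in> hom G (cgroup A p)"
  shows "(\<lambda>a. cx_tensor_elt A B p q (f a) b) \<in> hom G (cx_tensor_group A B n)"
  using hom_o[OF assms(5) biadditiveD2[OF cx_tensor_elt_biadditive[OF assms(1-3)] assms(4)]] .

lemma cx_tensor_elt_hom2:
  assumes "graded_group A" "graded_group B" "p + q = n" "a \<in> carrier (cgroup A p)"
    "f \<in> hom G (cgroup B q)"
  shows "(\<lambda>b. cx_tensor_elt A B p q a (f b)) \<in> hom G (cx_tensor_group A B n)"
  using hom_o[OF assms(5) biadditiveD1[OF cx_tensor_elt_biadditive[OF assms(1-3)] assms(4)]] .

lemma id_hom: "id \<in> hom G G"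
  by (simp add: hom_def)

lemma hom_ident: "(\<lambda>x. x) \<in> hom G G"
  by (simp add: hom_def)

lemmas cx_tensor_intros = graded_groupD graded_groupD' graded_group_cx_tensor comm_group_cx_tensor_group
  group_of_comm[OF comm_group_cx_tensor_group] cx_tensor_elt_closed cx_tensor_elt_hom1 cx_tensor_elt_hom2
  cx_tensor_elt_hom1[OF _ _ _ _ hom_ident] cx_tensor_elt_hom2[OF _ _ _ _ hom_ident] biadditiveI

section \<open>Associativity, swap and functoriality on elementary tensors of complexes\<close>

context
  fixes A :: "'a chain_complex" and B :: "'b chain_complex" and D :: "'d chain_complex"
  assumes A: "graded_group A" and B: "graded_group B" and D: "graded_group D"
begin

private lemma assoc_biadditive:
  "p + q = m \<Longrightarrow> m + r = n \<Longrightarrow> d \<in> carrier (cgroup D r) \<Longrightarrow>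
    biadditive (cgroup A p) (cgroup B q) (cgroup (A \<otimes>\<^sub>C (B \<otimes>\<^sub>C D)) n)
      (\<lambda>a b. cx_tensor_elt A (B \<otimes>\<^sub>C D) p (q + r) a (cx_tensor_elt B D q r b d))"
  using A B D by (auto intro!: cx_tensor_intros)

private lemma assoc_hom:
  "p + q = m \<Longrightarrow> m + r = n \<Longrightarrow> a \<in> carrier (cgroup A p) \<Longrightarrow> b \<in> carrier (cgroup B q) \<Longrightarrow>
    (\<lambda>d. cx_tensor_elt A (B \<otimes>\<^sub>C D) p (q + r) a (cx_tensor_elt B D q r b d))
      \<in> hom (cgroup D r) (cgroup (A \<otimes>\<^sub>C (B \<otimes>\<^sub>C D)) n)"
  using A B D by (auto intro!: cx_tensor_intros)

private lemma assoc_lift_biadditive: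
  "m + r = n \<Longrightarrow> biadditive (cgroup (A \<otimes>\<^sub>C B) m) (cgroup D r) (cgroup (A \<otimes>\<^sub>C (B \<otimes>\<^sub>C D)) n)
     (\<lambda>u d. cx_tensor_lift (cgroup (A \<otimes>\<^sub>C (B \<otimes>\<^sub>C D)) n)
          (\<lambda>p q a b. cx_tensor_elt A (B \<otimes>\<^sub>C D) p (q + r) a (cx_tensor_elt B D q r b d)) m u)"
  using A B D unfolding cgroup_cx_tensor[of A B]
  by (intro biadditive_cx_tensor_lift assoc_biadditive assoc_hom) (auto intro!: cx_tensor_intros)

lemma graded_hom_cx_assoc: "graded_hom ((A \<otimes>\<^sub>C B) \<otimes>\<^sub>C D) (A \<otimes>\<^sub>C (B \<otimes>\<^sub>C D)) (cx_assoc A B D)"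
  unfolding graded_hom_def cx_assoc_def cgroup_cx_tensor[of "A \<otimes>\<^sub>C B" D]
  using A B D by (intro allI cx_tensor_lift_hom assoc_lift_biadditive) (auto intro!: cx_tensor_intros)

lemma cx_assoc_elt:
  assumes "p + q + r = n" "a \<in> carrier (cgroup A p)" "b \<in> carrier (cgroup B q)" "d \<in> carrier (cgroup D r)"
  shows "cx_assoc A B D n (cx_tensor_elt (A \<otimes>\<^sub>C B) D (p + q) r (cx_tensor_elt A B p q a b) d) =
    cx_tensor_elt A (B \<otimes>\<^sub>C D) p (q + r) a (cx_tensor_elt B D q r b d)"
  using A B D assms unfolding cx_assoc_def
  by (subst cx_tensor_lift_elt[OF graded_group_cx_tensor _ _ assoc_lift_biadditive];
    (subst cx_tensor_lift_elt[OF _ _ _ assoc_biadditive])?) (auto intro!: cx_tensor_intros)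

private lemma assoc_inv_biadditive:
  "q + r = m \<Longrightarrow> p + m = n \<Longrightarrow> a \<in> carrier (cgroup A p) \<Longrightarrow>
    biadditive (cgroup B q) (cgroup D r) (cgroup ((A \<otimes>\<^sub>C B) \<otimes>\<^sub>C D) n)
      (\<lambda>b d. cx_tensor_elt (A \<otimes>\<^sub>C B) D (p + q) r (cx_tensor_elt A B p q a b) d)"
  using A B D by (auto intro!: cx_tensor_intros)

private lemma assoc_inv_hom:
  "q + r = m \<Longrightarrow> p + m = n \<Longrightarrow> b \<in> carrier (cgroup B q) \<Longrightarrow> d \<in> carrier (cgroup D r) \<Longrightarrow>
    (\<lambda>a. cx_tensor_elt (A \<otimes>\<^sub>C B) D (p + q) r (cx_tensor_elt A B p q a b) d)
      \<in> hom (cgroup A p) (cgroup ((A \<otimes>\<^sub>C B) \<otimes>\<^sub>C D) n)"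
  using A B D by (auto intro!: cx_tensor_intros)

text \<open>Here the inner lift is in the second variable and the parameter is the first, hence the
  flip.\<close>

private lemma assoc_inv_lift_biadditive:
  "p + m = n \<Longrightarrow> biadditive (cgroup A p) (cgroup (B \<otimes>\<^sub>C D) m) (cgroup ((A \<otimes>\<^sub>C B) \<otimes>\<^sub>C D) n)
     (\<lambda>a u. cx_tensor_lift (cgroup ((A \<otimes>\<^sub>C B) \<otimes>\<^sub>C D) n)
          (\<lambda>q r b d. cx_tensor_elt (A \<otimes>\<^sub>C B) D (p + q) r (cx_tensor_elt A B p q a b) d) m u)"
  using A B D unfolding cgroup_cx_tensor[of B D]
  by (intro biadditive_flip[OF biadditive_cx_tensor_lift] assoc_inv_biadditive assoc_inv_hom)
    (auto intro!: cx_tensor_intros)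

lemma graded_hom_cx_assoc_inv:
  "graded_hom (A \<otimes>\<^sub>C (B \<otimes>\<^sub>C D)) ((A \<otimes>\<^sub>C B) \<otimes>\<^sub>C D) (cx_assoc_inv A B D)"
  unfolding graded_hom_def cx_assoc_inv_def cgroup_cx_tensor[of A "B \<otimes>\<^sub>C D"]
  using A B D by (intro allI cx_tensor_lift_hom assoc_inv_lift_biadditive) (auto intro!: cx_tensor_intros)

lemma cx_assoc_inv_elt:
  assumes "p + (q + r) = n" "a \<in> carrier (cgroup A p)" "b \<in> carrier (cgroup B q)" "d \<in> carrier (cgroup D r)"
  shows "cx_assoc_inv A B D n (cx_tensor_elt A (B \<otimes>\<^sub>C D) p (q + r) a (cx_tensor_elt B D q r b d)) =
    cx_tensor_elt (A \<otimes>\<^sub>C B) D (p + q) r (cx_tensor_elt A B p q a b) d"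
  using A B D assms unfolding cx_assoc_inv_def
  by (subst cx_tensor_lift_elt[OF _ graded_group_cx_tensor _ assoc_inv_lift_biadditive];
    (subst cx_tensor_lift_elt[OF _ _ _ assoc_inv_biadditive])?) (auto intro!: cx_tensor_intros)

end

context
  fixes A :: "'a chain_complex" and B :: "'b chain_complex"
  assumes A: "graded_group A" and B: "graded_group B"
begin

private lemma swap_biadditive:
  "p + q = n \<Longrightarrow> biadditive (cgroup A p) (cgroup B q) (cgroup (B \<otimes>\<^sub>C A) n)
     (\<lambda>a b. cx_tensor_elt B A q p b a [^]\<^bsub>cgroup (B \<otimes>\<^sub>C A) n\<^esub> ((- 1) ^ (p * q) :: int))"
  unfolding cgroup_cx_tensor
  using A B by (intro biadditive_int_pow) (auto intro!: cx_tensor_intros)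

lemma graded_hom_cx_swap: "graded_hom (A \<otimes>\<^sub>C B) (B \<otimes>\<^sub>C A) (cx_swap A B)"
  unfolding graded_hom_def cx_swap_def cgroup_cx_tensor[of A B]
  using A B by (intro allI cx_tensor_lift_hom swap_biadditive) (auto intro!: cx_tensor_intros)

lemma cx_swap_elt:
  assumes "p + q = n" "a \<in> carrier (cgroup A p)" "b \<in> carrier (cgroup B q)"
  shows "cx_swap A B n (cx_tensor_elt A B p q a b) =
    cx_tensor_elt B A q p b a [^]\<^bsub>cx_tensor_group B A n\<^esub> ((- 1) ^ (p * q) :: int)"
  using A B assms unfolding cx_swap_def
  by (subst cx_tensor_lift_elt[OF _ _ _ swap_biadditive]) (auto intro!: cx_tensor_intros)

end

context
  fixes A :: "'a chain_complex" and B :: "'b chain_complex"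
    and A' :: "'c chain_complex" and B' :: "'d chain_complex" and f g
  assumes A: "graded_group A" and B: "graded_group B" and A': "graded_group A'" and B': "graded_group B'"
    and f: "graded_hom A A' f" and g: "graded_hom B B' g"
begin

private lemma map_biadditive:
  "p + q = n \<Longrightarrow> biadditive (cgroup A p) (cgroup B q) (cgroup (A' \<otimes>\<^sub>C B') n)
     (\<lambda>a b. cx_tensor_elt A' B' p q (f p a) (g q b))"
  using A' B' unfolding cgroup_cx_tensor
  by (intro biadditive_pre[OF cx_tensor_elt_biadditive] graded_homD[OF f] graded_homD[OF g])

lemma graded_hom_cx_tensor_map: "graded_hom (A \<otimes>\<^sub>C B) (A' \<otimes>\<^sub>C B') (cx_tensor_map A' B' f g)"
  unfolding graded_hom_def cx_tensor_map_def cgroup_cx_tensor[of A B]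
  using A B A' B' by (intro allI cx_tensor_lift_hom map_biadditive) (auto intro!: cx_tensor_intros)

lemma cx_tensor_map_elt:
  assumes "p + q = n" "a \<in> carrier (cgroup A p)" "b \<in> carrier (cgroup B q)"
  shows "cx_tensor_map A' B' f g n (cx_tensor_elt A B p q a b) = cx_tensor_elt A' B' p q (f p a) (g q b)"
  using A B A' B' assms unfolding cx_tensor_map_def
  by (subst cx_tensor_lift_elt[OF _ _ _ map_biadditive]) (auto intro!: cx_tensor_intros)

end

text \<open>Pulls a sign out of a tensor factor; the middle swap produces its sign two tensor
  factors deep.\<close>

lemma cx_tensor_elt_int_pow1:
  assumes "graded_group A" "graded_group B" "p + q = n" "a \<in> carrier (cgroup A p)" "b \<in> carrier (cgroup B q)"
  shows "cx_tensor_elt A B p q (a [^]\<^bsub>cgroup A p\<^esub> (k::int)) b =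
    cx_tensor_elt A B p q a b [^]\<^bsub>cx_tensor_group A B n\<^esub> k"
  using hom_int_pow[OF biadditiveD2[OF cx_tensor_elt_biadditive[OF assms(1-3)] assms(5)] assms(4)] assms
  by (simp add: cx_tensor_intros)

lemma cx_tensor_elt_int_pow2:
  assumes "graded_group A" "graded_group B" "p + q = n" "a \<in> carrier (cgroup A p)" "b \<in> carrier (cgroup B q)"
  shows "cx_tensor_elt A B p q a (b [^]\<^bsub>cgroup B q\<^esub> (k::int)) =
    cx_tensor_elt A B p q a b [^]\<^bsub>cx_tensor_group A B n\<^esub> k"
  using hom_int_pow[OF biadditiveD1[OF cx_tensor_elt_biadditive[OF assms(1-3)] assms(4)] assms(5)] assms
  by (simp add: cx_tensor_intros)

text \<open>Three reductions by \<open>cx_tensor_hom_eqI\<close>: to a pair \<open>x\<close>,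
  \<open>y\<close>, then in \<open>x\<close> with \<open>y\<close> held fixed, then in
  \<open>y\<close> with \<open>x\<close> already elementary. The last two use that
  \<open>cx_tensor_elt\<close> is additive in each variable.\<close>

lemma cx_tensor_hom_eqI2:
  assumes A: "graded_group A" and B: "graded_group B" and D: "graded_group D" and E: "graded_group E"
    and K: "comm_group K"
    and \<phi>: "\<phi> \<in> hom (cx_tensor_group (A \<otimes>\<^sub>C B) (D \<otimes>\<^sub>C E) n) K"
    and \<psi>: "\<psi> \<in> hom (cx_tensor_group (A \<otimes>\<^sub>C B) (D \<otimes>\<^sub>C E) n) K"
    and eq: "\<And>p q r s a b d e. \<lbrakk>p + q + (r + s) = n; a \<in> carrier (cgroup A p); b \<in> carrier (cgroup B q);
      d \<in> carrier (cgroup D r); e \<in> carrier (cgroup E s)\<rbrakk> \<Longrightarrow>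
      \<phi> (cx_tensor_elt (A \<otimes>\<^sub>C B) (D \<otimes>\<^sub>C E) (p + q) (r + s) (cx_tensor_elt A B p q a b) (cx_tensor_elt D E r s d e)) =
      \<psi> (cx_tensor_elt (A \<otimes>\<^sub>C B) (D \<otimes>\<^sub>C E) (p + q) (r + s) (cx_tensor_elt A B p q a b) (cx_tensor_elt D E r s d e))"
    and u: "u \<in> carrier (cx_tensor_group (A \<otimes>\<^sub>C B) (D \<otimes>\<^sub>C E) n)"
  shows "\<phi> u = \<psi> u"
proof -
  note AB = graded_group_cx_tensor[OF A B] and DE = graded_group_cx_tensor[OF D E]
  show ?thesis
  proof (rule cx_tensor_hom_eqI[OF AB DE K \<phi> \<psi> _ u])
    fix m l x y assume ml: "m + l = n" and x: "x \<in> carrier (cgroup (A \<otimes>\<^sub>C B) m)"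
      and y: "y \<in> carrier (cgroup (D \<otimes>\<^sub>C E) l)"
    note bi = cx_tensor_elt_biadditive[OF AB DE ml]
    show "\<phi> (cx_tensor_elt (A \<otimes>\<^sub>C B) (D \<otimes>\<^sub>C E) m l x y) = \<psi> (cx_tensor_elt (A \<otimes>\<^sub>C B) (D \<otimes>\<^sub>C E) m l x y)"
    proof (rule cx_tensor_hom_eqI[OF A B K, of "\<lambda>x. \<phi> (cx_tensor_elt (A \<otimes>\<^sub>C B) (D \<otimes>\<^sub>C E) m l x y)" m
          "\<lambda>x. \<psi> (cx_tensor_elt (A \<otimes>\<^sub>C B) (D \<otimes>\<^sub>C E) m l x y)" x])
      fix p q a b assume pq: "p + q = m" and ab: "a \<in> carrier (cgroup A p)" "b \<in> carrier (cgroup B q)"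
      have x: "cx_tensor_elt A B p q a b \<in> carrier (cgroup (A \<otimes>\<^sub>C B) m)"
        using A B pq ab by (simp add: cx_tensor_elt_closed)
      show "\<phi> (cx_tensor_elt (A \<otimes>\<^sub>C B) (D \<otimes>\<^sub>C E) m l (cx_tensor_elt A B p q a b) y) =
        \<psi> (cx_tensor_elt (A \<otimes>\<^sub>C B) (D \<otimes>\<^sub>C E) m l (cx_tensor_elt A B p q a b) y)"
        by (rule cx_tensor_hom_eqI[OF D E K hom_o[OF biadditiveD1[OF bi x, unfolded cgroup_cx_tensor] \<phi>]
          hom_o[OF biadditiveD1[OF bi x, unfolded cgroup_cx_tensor] \<psi>]])
          (use y eq ab pq ml in auto)
    qed (use x hom_o[OF biadditiveD2[OF bi y] \<phi>] hom_o[OF biadditiveD2[OF bi y] \<psi>] in auto)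
  qed
qed

section \<open>Middle swap of four complexes\<close>

context
  fixes A :: "'a chain_complex" and B :: "'b chain_complex"
    and D :: "'d chain_complex" and E :: "'e chain_complex"
  assumes A: "graded_group A" and B: "graded_group B" and D: "graded_group D" and E: "graded_group E"
begin

lemma graded_hom_cx_middle_swap:
  "graded_hom ((A \<otimes>\<^sub>C B) \<otimes>\<^sub>C (D \<otimes>\<^sub>C E)) ((A \<otimes>\<^sub>C D) \<otimes>\<^sub>C (B \<otimes>\<^sub>C E)) (cx_middle_swap A B D E)"
  unfolding cx_middle_swap_def
  by (rule graded_hom_comp graded_hom_cx_assoc graded_hom_cx_assoc_inv graded_hom_cx_swap
      graded_hom_cx_tensor_map graded_hom_id graded_group_cx_tensor A B D E)+

text \<open>Reassociation carries no sign, so the only sign is that of interchanging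
  \<open>b\<close> and \<open>d\<close>. The equations 1 to 5 evaluate the five factors of
  \<open>cx_middle_swap\<close>, innermost first.\<close>

lemma cx_middle_swap_elt:
  assumes n: "p + q + (r + s) = n" and a: "a \<in> carrier (cgroup A p)" and b: "b \<in> carrier (cgroup B q)"
    and d: "d \<in> carrier (cgroup D r)" and e: "e \<in> carrier (cgroup E s)"
  shows "cx_middle_swap A B D E n (cx_tensor_elt (A \<otimes>\<^sub>C B) (D \<otimes>\<^sub>C E) (p + q) (r + s)
      (cx_tensor_elt A B p q a b) (cx_tensor_elt D E r s d e)) =
    cx_tensor_elt (A \<otimes>\<^sub>C D) (B \<otimes>\<^sub>C E) (p + r) (q + s) (cx_tensor_elt A D p r a d) (cx_tensor_elt B E q s b e)
      [^]\<^bsub>cx_tensor_group (A \<otimes>\<^sub>C D) (B \<otimes>\<^sub>C E) n\<^esub> ((- 1) ^ (q * r) :: int)"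
proof -
  let ?de = "cx_tensor_elt D E r s d e"
  let ?be = "cx_tensor_elt B E q s b e"
  let ?bd = "cx_tensor_elt B D q r b d"
  let ?db = "cx_tensor_elt D B r q d b"
  let ?dbe = "cx_tensor_elt (D \<otimes>\<^sub>C B) E (q + r) s ?db e"
  let ?dbe' = "cx_tensor_elt D (B \<otimes>\<^sub>C E) r (q + s) d ?be"
  let ?bde = "cx_tensor_elt (B \<otimes>\<^sub>C D) E (q + r) s ?bd e"
  let ?bde' = "cx_tensor_elt B (D \<otimes>\<^sub>C E) q (r + s) b ?de"
  let ?adbe' = "cx_tensor_elt A (D \<otimes>\<^sub>C (B \<otimes>\<^sub>C E)) p (q + (r + s)) a ?dbe'"
  let ?adbe = "cx_tensor_elt A ((D \<otimes>\<^sub>C B) \<otimes>\<^sub>C E) p (q + (r + s)) a ?dbe"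
  note gg = A B D E graded_group_cx_tensor
  note gh = graded_hom_cx_assoc graded_hom_cx_assoc_inv graded_hom_cx_swap graded_hom_cx_tensor_map graded_hom_id
  let ?k = "(- 1) ^ (q * r) :: int"
  let ?x = "cx_tensor_elt (A \<otimes>\<^sub>C B) (D \<otimes>\<^sub>C E) (p + q) (r + s) (cx_tensor_elt A B p q a b) ?de"
  have cl [simp]: "?de \<in> carrier (cgroup (D \<otimes>\<^sub>C E) (r + s))"
    "?bd \<in> carrier (cgroup (B \<otimes>\<^sub>C D) (q + r))"
    "?db \<in> carrier (cgroup (D \<otimes>\<^sub>C B) (q + r))"
    "?be \<in> carrier (cgroup (B \<otimes>\<^sub>C E) (q + s))"
    using a b d e by (simp_all add: gg cx_tensor_elt_closed)
  have cl2: "?bde' \<in> carrier (cgroup (B \<otimes>\<^sub>C (D \<otimes>\<^sub>C E)) (q + (r + s)))"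
    "?bde \<in> carrier (cgroup ((B \<otimes>\<^sub>C D) \<otimes>\<^sub>C E) (q + (r + s)))"
    "?dbe \<in> carrier (cgroup ((D \<otimes>\<^sub>C B) \<otimes>\<^sub>C E) (q + (r + s)))"
    "?dbe' \<in> carrier (cgroup (D \<otimes>\<^sub>C (B \<otimes>\<^sub>C E)) (q + (r + s)))"
    using cl b d e unfolding cgroup_cx_tensor[of B "D \<otimes>\<^sub>C E"] cgroup_cx_tensor[of "B \<otimes>\<^sub>C D" E]
      cgroup_cx_tensor[of "D \<otimes>\<^sub>C B" E] cgroup_cx_tensor[of D "B \<otimes>\<^sub>C E"]
    by (auto simp del: cgroup_cx_tensor intro!: cx_tensor_elt_closed gg)
  have cl3: "?adbe \<in> carrier (cgroup (A \<otimes>\<^sub>C ((D \<otimes>\<^sub>C B) \<otimes>\<^sub>C E)) n)"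
    "?adbe' \<in> carrier (cgroup (A \<otimes>\<^sub>C (D \<otimes>\<^sub>C (B \<otimes>\<^sub>C E))) n)"
    using cl2 a n unfolding cgroup_cx_tensor[of A "_ \<otimes>\<^sub>C _"]
    by (auto simp del: cgroup_cx_tensor intro!: cx_tensor_elt_closed gg)
  have 1: "cx_assoc A B (D \<otimes>\<^sub>C E) n ?x =
    cx_tensor_elt A (B \<otimes>\<^sub>C (D \<otimes>\<^sub>C E)) p (q + (r + s)) a
      ?bde'"
    using n a b cl by (intro cx_assoc_elt gg)
  have 2: "cx_tensor_map A ((B \<otimes>\<^sub>C D) \<otimes>\<^sub>C E) graded_id (cx_assoc_inv B D E) n \<dots> =
    cx_tensor_elt A ((B \<otimes>\<^sub>C D) \<otimes>\<^sub>C E) p (q + (r + s)) a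
      ?bde"
    using n a b d e cl2
    by (subst cx_tensor_map_elt[where A = A and B = "B \<otimes>\<^sub>C (D \<otimes>\<^sub>C E)"]) (auto intro!: gg gh simp: cx_assoc_inv_elt gg simp del: cgroup_cx_tensor)
  \<comment> \<open>The only place where a sign arises. It appears on the factor from
    \<open>D \<otimes>\<^sub>C B\<close> and is moved out first past \<open>e\<close>, then past
    \<open>a\<close>.\<close>
  have 3: "cx_tensor_map A ((D \<otimes>\<^sub>C B) \<otimes>\<^sub>C E) graded_id
       (cx_tensor_map (D \<otimes>\<^sub>C B) E (cx_swap B D) graded_id) n \<dots> =
     ?adbe [^]\<^bsub>cgroup (A \<otimes>\<^sub>C ((D \<otimes>\<^sub>C B) \<otimes>\<^sub>C E)) n\<^esub> ?k"
  proof -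
    have "cx_tensor_map (D \<otimes>\<^sub>C B) E (cx_swap B D) graded_id (q + (r + s))
        ?bde =
      cx_tensor_elt (D \<otimes>\<^sub>C B) E (q + r) s (?db [^]\<^bsub>cgroup (D \<otimes>\<^sub>C B) (q + r)\<^esub> ?k) e"
      using b d e cl
      by (subst cx_tensor_map_elt[where A = "B \<otimes>\<^sub>C D" and B = E]) (auto intro!: gg gh simp: cx_swap_elt gg)
    also have "\<dots> = ?dbe
        [^]\<^bsub>cgroup ((D \<otimes>\<^sub>C B) \<otimes>\<^sub>C E) (q + (r + s))\<^esub> ?k"
      unfolding cgroup_cx_tensor[of "D \<otimes>\<^sub>C B" E]
      using e cl by (intro cx_tensor_elt_int_pow1 gg) auto
    finally show ?thesis
      using n a cl2
      by (subst cx_tensor_map_elt[where A = A and B = "(B \<otimes>\<^sub>C D) \<otimes>\<^sub>C E"])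
        (auto intro!: gg gh cx_tensor_elt_int_pow2 simp: cgroup_cx_tensor[of A "_ \<otimes>\<^sub>C _"] simp del: cgroup_cx_tensor)
  qed
  have 4: "cx_tensor_map A (D \<otimes>\<^sub>C (B \<otimes>\<^sub>C E)) graded_id (cx_assoc D B E) n
      ?adbe =
     ?adbe'"
    using n a b d e cl2 cx_assoc_elt[OF D B E _ d b e, of "q + (r + s)"]
    by (subst cx_tensor_map_elt[where A = A and B = "(D \<otimes>\<^sub>C B) \<otimes>\<^sub>C E"])
      (auto intro!: gg gh simp: gg add.commute[of r q] simp del: cgroup_cx_tensor)
  have 5: "cx_assoc_inv A D (B \<otimes>\<^sub>C E) n ?adbe' =
    cx_tensor_elt (A \<otimes>\<^sub>C D) (B \<otimes>\<^sub>C E) (p + r) (q + s) (cx_tensor_elt A D p r a d) ?be"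
    using cx_assoc_inv_elt[OF A D graded_group_cx_tensor[OF B E] _ a d cl(4), of n] n
    by (simp add: add.left_commute del: cgroup_cx_tensor)
  have h4: "cx_tensor_map A (D \<otimes>\<^sub>C (B \<otimes>\<^sub>C E)) graded_id (cx_assoc D B E) n
     \<in> hom (cgroup (A \<otimes>\<^sub>C ((D \<otimes>\<^sub>C B) \<otimes>\<^sub>C E)) n) (cgroup (A \<otimes>\<^sub>C (D \<otimes>\<^sub>C (B \<otimes>\<^sub>C E))) n)"
    by (intro graded_homD gh gg)
  have h5: "cx_assoc_inv A D (B \<otimes>\<^sub>C E) n
     \<in> hom (cgroup (A \<otimes>\<^sub>C (D \<otimes>\<^sub>C (B \<otimes>\<^sub>C E))) n) (cgroup ((A \<otimes>\<^sub>C D) \<otimes>\<^sub>C (B \<otimes>\<^sub>C E)) n)"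
    by (intro graded_homD gh gg)
  have g: "group (cgroup (A \<otimes>\<^sub>C ((D \<otimes>\<^sub>C B) \<otimes>\<^sub>C E)) n)" "group (cgroup (A \<otimes>\<^sub>C (D \<otimes>\<^sub>C (B \<otimes>\<^sub>C E))) n)"
    "group (cgroup ((A \<otimes>\<^sub>C D) \<otimes>\<^sub>C (B \<otimes>\<^sub>C E)) n)"
    by (rule graded_groupD'; intro gg)+
  \<comment> \<open>The sign is an exponent, so it passes through the two remaining maps because
    they are homomorphisms.\<close>
  show ?thesis
    unfolding cx_middle_swap_def graded_comp_def comp_def 1 2 3
      hom_int_pow[OF h4 cl3(1) g(1,2)] 4 hom_int_pow[OF h5 cl3(2) g(2,3)] 5 by simp
qed

end

text \<open>Used to move the projections from \<open>C\<close> to \<open>N\<close> past the middle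
  swap. On elementary tensors both sides carry the same sign because \<open>f\<close>,
  \<open>g\<close>, \<open>h\<close>, \<open>k\<close> preserve degrees.\<close>

lemma cx_middle_swap_natural:
  assumes A: "graded_group A" and B: "graded_group B" and D: "graded_group D" and E: "graded_group E"
    and A': "graded_group A'" and B': "graded_group B'" and D': "graded_group D'" and E': "graded_group E'"
    and f: "graded_hom A A' f" and g: "graded_hom B B' g" and h: "graded_hom D D' h" and k: "graded_hom E E' k"
    and u: "u \<in> carrier (cx_tensor_group (A \<otimes>\<^sub>C B) (D \<otimes>\<^sub>C E) n)"
  shows "cx_middle_swap A' B' D' E' n
      (cx_tensor_map (A' \<otimes>\<^sub>C B') (D' \<otimes>\<^sub>C E') (cx_tensor_map A' B' f g) (cx_tensor_map D' E' h k) n u) =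
    cx_tensor_map (A' \<otimes>\<^sub>C D') (B' \<otimes>\<^sub>C E') (cx_tensor_map A' D' f h) (cx_tensor_map B' E' g k) n
      (cx_middle_swap A B D E n u)"
proof -
  note gg = A B D E A' B' D' E' graded_group_cx_tensor
  let ?M = "cx_tensor_map (A' \<otimes>\<^sub>C B') (D' \<otimes>\<^sub>C E') (cx_tensor_map A' B' f g) (cx_tensor_map D' E' h k) n"
  let ?M' = "cx_tensor_map (A' \<otimes>\<^sub>C D') (B' \<otimes>\<^sub>C E') (cx_tensor_map A' D' f h) (cx_tensor_map B' E' g k) n"
  have gh: "graded_hom (A \<otimes>\<^sub>C B) (A' \<otimes>\<^sub>C B') (cx_tensor_map A' B' f g)"
    "graded_hom (D \<otimes>\<^sub>C E) (D' \<otimes>\<^sub>C E') (cx_tensor_map D' E' h k)"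
    "graded_hom (A \<otimes>\<^sub>C D) (A' \<otimes>\<^sub>C D') (cx_tensor_map A' D' f h)"
    "graded_hom (B \<otimes>\<^sub>C E) (B' \<otimes>\<^sub>C E') (cx_tensor_map B' E' g k)"
    by (intro graded_hom_cx_tensor_map gg f g h k)+
  have M: "?M \<in> hom (cx_tensor_group (A \<otimes>\<^sub>C B) (D \<otimes>\<^sub>C E) n) (cx_tensor_group (A' \<otimes>\<^sub>C B') (D' \<otimes>\<^sub>C E') n)"
    using graded_homD[OF graded_hom_cx_tensor_map[OF gg(9) gg(9) gg(9) gg(9) gh(1,2)], of n] gg by simp
  have M': "?M' \<in> hom (cx_tensor_group (A \<otimes>\<^sub>C D) (B \<otimes>\<^sub>C E) n) (cx_tensor_group (A' \<otimes>\<^sub>C D') (B' \<otimes>\<^sub>C E') n)"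
    using graded_homD[OF graded_hom_cx_tensor_map[OF gg(9) gg(9) gg(9) gg(9) gh(3,4)], of n] gg by simp
  have ms: "cx_middle_swap A B D E n \<in> hom (cx_tensor_group (A \<otimes>\<^sub>C B) (D \<otimes>\<^sub>C E) n) (cx_tensor_group (A \<otimes>\<^sub>C D) (B \<otimes>\<^sub>C E) n)"
    using graded_homD[OF graded_hom_cx_middle_swap[OF A B D E], of n] by simp
  have ms': "cx_middle_swap A' B' D' E' n \<in> hom (cx_tensor_group (A' \<otimes>\<^sub>C B') (D' \<otimes>\<^sub>C E') n) (cx_tensor_group (A' \<otimes>\<^sub>C D') (B' \<otimes>\<^sub>C E') n)"
    using graded_homD[OF graded_hom_cx_middle_swap[OF A' B' D' E'], of n] by simp
  show ?thesis
  proof (rule cx_tensor_hom_eqI2[OF A B D E _ hom_o[OF M ms'] hom_o[OF ms M'] _ u])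
    show "comm_group (cx_tensor_group (A' \<otimes>\<^sub>C D') (B' \<otimes>\<^sub>C E') n)"
      by (intro comm_group_cx_tensor_group gg)
    fix p q r s a b d e
    assume n: "p + q + (r + s) = n" and a: "a \<in> carrier (cgroup A p)" and b: "b \<in> carrier (cgroup B q)"
      and d: "d \<in> carrier (cgroup D r)" and e: "e \<in> carrier (cgroup E s)"
    let ?x = "cx_tensor_elt (A \<otimes>\<^sub>C B) (D \<otimes>\<^sub>C E) (p + q) (r + s) (cx_tensor_elt A B p q a b) (cx_tensor_elt D E r s d e)"
    let ?y = "cx_tensor_elt (A \<otimes>\<^sub>C D) (B \<otimes>\<^sub>C E) (p + r) (q + s) (cx_tensor_elt A D p r a d) (cx_tensor_elt B E q s b e)"
    note c' = graded_hom_closed[OF f a] graded_hom_closed[OF g b] graded_hom_closed[OF h d] graded_hom_closed[OF k e]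
    note cl = cx_tensor_elt_closed[OF A B refl a b] cx_tensor_elt_closed[OF D E refl d e]
      cx_tensor_elt_closed[OF A D refl a d] cx_tensor_elt_closed[OF B E refl b e]
    have n': "p + r + (q + s) = n" using n by simp
    have 1: "?M ?x
      = cx_tensor_elt (A' \<otimes>\<^sub>C B') (D' \<otimes>\<^sub>C E') (p + q) (r + s) (cx_tensor_elt A' B' p q (f p a) (g q b)) (cx_tensor_elt D' E' r s (h r d) (k s e))"
      using cl n by (subst cx_tensor_map_elt[OF _ _ _ _ gh(1,2)])
        (auto intro!: gg simp: cx_tensor_map_elt[OF A B A' B' f g refl a b] cx_tensor_map_elt[OF D E D' E' h k refl d e])
    have 2: "?M' ?y
      = cx_tensor_elt (A' \<otimes>\<^sub>C D') (B' \<otimes>\<^sub>C E') (p + r) (q + s) (cx_tensor_elt A' D' p r (f p a) (h r d)) (cx_tensor_elt B' E' q s (g q b) (k s e))"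
      using cl n' by (subst cx_tensor_map_elt[OF _ _ _ _ gh(3,4)])
        (auto intro!: gg simp: cx_tensor_map_elt[OF A D A' D' f h refl a d] cx_tensor_map_elt[OF B E B' E' g k refl b e])
    have cl2: "?y
      \<in> carrier (cx_tensor_group (A \<otimes>\<^sub>C D) (B \<otimes>\<^sub>C E) n)"
      using cl n' by (intro cx_tensor_elt_closed gg) auto
    have g: "group (cx_tensor_group (A \<otimes>\<^sub>C D) (B \<otimes>\<^sub>C E) n)" "group (cx_tensor_group (A' \<otimes>\<^sub>C D') (B' \<otimes>\<^sub>C E') n)"
      by (intro group_of_comm comm_group_cx_tensor_group gg)+
    show "cx_middle_swap A' B' D' E' n (?M ?x)
      = ?M' (cx_middle_swap A B D E n ?x)"
      unfolding 1 cx_middle_swap_elt[OF A B D E n a b d e] cx_middle_swap_elt[OF A' B' D' E' n c']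
        hom_int_pow[OF M' cl2 g] 2 ..
  qed
qed

section \<open>Middle swap of four abelian groups\<close>

lemma tensor_elt_hom1:
  assumes "group G" "group H" "h \<in> carrier H" "f \<in> hom L G"
  shows "(\<lambda>g. tensor_elt G H (f g) h) \<in> hom L (tensor_group G H)"
  using hom_o[OF assms(4) biadditiveD2[OF tensor_elt_biadditive[OF assms(1,2)] assms(3)]] .

lemma tensor_elt_hom2:
  assumes "group G" "group H" "g \<in> carrier G" "f \<in> hom L H"
  shows "(\<lambda>h. tensor_elt G H g (f h)) \<in> hom L (tensor_group G H)"
  using hom_o[OF assms(4) biadditiveD1[OF tensor_elt_biadditive[OF assms(1,2)] assms(3)]] .

lemmas tensor_intros = tensor_elt_hom1[OF _ _ _ hom_ident] tensor_elt_hom2[OF _ _ _ hom_ident]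
  tensor_elt_hom1 tensor_elt_hom2 comm_group_tensor_group group_of_comm[OF comm_group_tensor_group]
  tensor_elt_closed biadditiveI

lemma tensor_swap_hom:
  assumes "group G" "group H"
  shows "tensor_swap G H \<in> hom (tensor_group G H) (tensor_group H G)"
  unfolding tensor_swap_def using assms by (intro tensor_lift_hom tensor_intros)

lemma tensor_swap_elt:
  assumes "group G" "group H" "a \<in> carrier G" "b \<in> carrier H"
  shows "tensor_swap G H (tensor_elt G H a b) = tensor_elt H G b a"
  unfolding tensor_swap_def using assms
  by (subst tensor_lift_elt) (auto intro!: tensor_intros)

context
  fixes G :: "'a monoid" and H :: "'b monoid" and K :: "'c monoid"
  assumes G: "group G" and H: "group H" and K: "group K"
begin

private lemma tensor_assoc_biadditive:
  "biadditive (tensor_group G H) K (tensor_group G (tensor_group H K))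
    (\<lambda>t k. tensor_lift (tensor_group G (tensor_group H K))
          (\<lambda>g h. tensor_elt G (tensor_group H K) g (tensor_elt H K h k)) t)"
  using G H K by (intro biadditive_tensor_lift) (auto intro!: tensor_intros)

lemma tensor_assoc_hom:
  "tensor_assoc G H K \<in> hom (tensor_group (tensor_group G H) K) (tensor_group G (tensor_group H K))"
  unfolding tensor_assoc_def using G H K
  by (intro tensor_lift_hom tensor_assoc_biadditive tensor_intros)

lemma tensor_assoc_elt:
  assumes "a \<in> carrier G" "b \<in> carrier H" "c \<in> carrier K"
  shows "tensor_assoc G H K (tensor_elt (tensor_group G H) K (tensor_elt G H a b) c) =
    tensor_elt G (tensor_group H K) a (tensor_elt H K b c)"
  unfolding tensor_assoc_def using G H K assms
  by (subst tensor_lift_elt[OF _ _ _ tensor_assoc_biadditive]; (subst tensor_lift_elt)?)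
    (auto intro!: tensor_intros)

private lemma tensor_assoc_inv_biadditive:
  "biadditive G (tensor_group H K) (tensor_group (tensor_group G H) K)
    (\<lambda>g. tensor_lift (tensor_group (tensor_group G H) K)
          (\<lambda>h k. tensor_elt (tensor_group G H) K (tensor_elt G H g h) k))"
  using G H K by (intro biadditive_flip[OF biadditive_tensor_lift]) (auto intro!: tensor_intros)

lemma tensor_assoc_inv_hom:
  "tensor_assoc_inv G H K \<in> hom (tensor_group G (tensor_group H K)) (tensor_group (tensor_group G H) K)"
  unfolding tensor_assoc_inv_def using G H K
  by (intro tensor_lift_hom tensor_assoc_inv_biadditive tensor_intros)

lemma tensor_assoc_inv_elt:
  assumes "a \<in> carrier G" "b \<in> carrier H" "c \<in> carrier K"
  shows "tensor_assoc_inv G H K (tensor_elt G (tensor_group H K) a (tensor_elt H K b c)) =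
    tensor_elt (tensor_group G H) K (tensor_elt G H a b) c"
  unfolding tensor_assoc_inv_def using G H K assms
  by (subst tensor_lift_elt[OF _ _ _ tensor_assoc_inv_biadditive]; (subst tensor_lift_elt)?)
    (auto intro!: tensor_intros)

end

context
  fixes G :: "'a monoid" and H :: "'b monoid" and K :: "'c monoid" and L :: "'d monoid"
  assumes G: "group G" and H: "group H" and K: "group K" and L: "group L"
begin

lemma tensor_middle_swap_hom:
  "tensor_middle_swap G H K L \<in> hom (tensor_group (tensor_group G H) (tensor_group K L))
     (tensor_group (tensor_group G K) (tensor_group H L))"
  unfolding tensor_middle_swap_def using G H K L
  by (intro hom_compose[OF tensor_assoc_hom] hom_compose[OF tensor_map_hom] tensor_assoc_inv_hom
    tensor_assoc_hom tensor_map_hom tensor_swap_hom group_of_comm[OF comm_group_tensor_group])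
    (auto simp: hom_def)

text \<open>No sign here, in contrast to \<open>cx_middle_swap_elt\<close>; in the bialgebra
  identity the difference is made up by the signs of the shuffles.\<close>

lemma tensor_middle_swap_elt:
  assumes "a \<in> carrier G" "b \<in> carrier H" "c \<in> carrier K" "d \<in> carrier L"
  shows "tensor_middle_swap G H K L (tensor_elt (tensor_group G H) (tensor_group K L)
      (tensor_elt G H a b) (tensor_elt K L c d)) =
    tensor_elt (tensor_group G K) (tensor_group H L) (tensor_elt G K a c) (tensor_elt H L b d)"
proof -
  note g = G H K L group_of_comm[OF comm_group_tensor_group]
  note h = id_hom tensor_assoc_hom tensor_assoc_inv_hom tensor_map_hom tensor_swap_hom
  note cl = assms tensor_elt_closed
  have "tensor_map G (tensor_group (tensor_group H K) L) id (tensor_assoc_inv H K L)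
      (tensor_elt G (tensor_group H (tensor_group K L)) a
        (tensor_elt H (tensor_group K L) b (tensor_elt K L c d))) =
    tensor_elt G (tensor_group (tensor_group H K) L) (id a)
        (tensor_assoc_inv H K L (tensor_elt H (tensor_group K L) b (tensor_elt K L c d)))"
    by (rule tensor_map_elt; intro g h cl)
  moreover have "tensor_map (tensor_group K H) L (tensor_swap H K) id
        (tensor_elt (tensor_group H K) L (tensor_elt H K b c) d) =
     tensor_elt (tensor_group K H) L (tensor_swap H K (tensor_elt H K b c)) (id d)"
    by (rule tensor_map_elt; intro g h cl)
  moreover have "tensor_map G (tensor_group (tensor_group K H) L) id
      (tensor_map (tensor_group K H) L (tensor_swap H K) id)
      (tensor_elt G (tensor_group (tensor_group H K) L) a
        (tensor_elt (tensor_group H K) L (tensor_elt H K b c) d)) =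
    tensor_elt G (tensor_group (tensor_group K H) L) (id a)
      (tensor_map (tensor_group K H) L (tensor_swap H K) id
        (tensor_elt (tensor_group H K) L (tensor_elt H K b c) d))"
    by (rule tensor_map_elt; intro g h cl)
  moreover have "tensor_map G (tensor_group K (tensor_group H L)) id (tensor_assoc K H L)
      (tensor_elt G (tensor_group (tensor_group K H) L) a
        (tensor_elt (tensor_group K H) L (tensor_elt K H c b) d)) =
    tensor_elt G (tensor_group K (tensor_group H L)) (id a)
      (tensor_assoc K H L (tensor_elt (tensor_group K H) L (tensor_elt K H c b) d))"
    by (rule tensor_map_elt; intro g h cl)
  ultimately show ?thesis
    unfolding tensor_middle_swap_def comp_def
    by (simp add: tensor_assoc_elt tensor_assoc_inv_elt tensor_swap_elt g cl)
qed

end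

section \<open>Front and back faces of shuffles\<close>

lemma degens_append: "degens A n (xs @ ys) x = degens A (n + length xs) ys (degens A n xs x)"
  by (induction xs arbitrary: n x) auto

lemma sorted_list_of_set_insert_greater:
  fixes m :: nat
  assumes "finite B" "\<And>b. b \<in> B \<Longrightarrow> b < m"
  shows "sorted_list_of_set (insert m B) = sorted_list_of_set B @ [m]"
proof -
  have "sorted (sorted_list_of_set B @ [m])" "distinct (sorted_list_of_set B @ [m])"
    "set (sorted_list_of_set B @ [m]) = insert m B"
    using assms by (auto simp: sorted_append less_imp_le)
  then show ?thesis
    using sorted_list_of_set.idem_if_sorted_distinct by metis
qed

text \<open>The smallest index is applied first, so a new maximum is the outermost degeneracy. This
  is why the later inductions over index sets adjoin a maximum. The degree \<open>n + card B\<close>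
  counts the degeneracies already applied.\<close>

lemma degen_set_insert_greater:
  assumes "finite B" "\<And>b. b \<in> B \<Longrightarrow> b < m"
  shows "degen_set A n (insert m B) x = degen A (n + card B) m (degen_set A n B x)"
  using assms by (simp add: degen_set_def sorted_list_of_set_insert_greater degens_append
    del: sorted_list_of_set_insert_remove)

lemma degen_set_empty [simp]: "degen_set A n {} x = x"
  by (simp add: degen_set_def)

text \<open>The condition \<open>B \<subseteq> {..<n + card B}\<close> keeps every degeneracy of
  \<open>degen_set A n B\<close> in range. It bounds the largest index, the other indices lie
  strictly below that one, and so the condition survives removal of the maximum.\<close>

lemma subset_lessThan_of_insert:
  fixes m :: nat
  assumes "insert m B \<subseteq> {..<n + card (insert m B)}" "finite B" "\<And>b. b \<in> B \<Longrightarrow> b < m"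
  shows "B \<subseteq> {..<n + card B}" "m \<le> n + card B" "card (insert m B) = Suc (card B)"
proof -
  have "m \<notin> B" using assms(3) by blast
  then show c: "card (insert m B) = Suc (card B)" using assms(2) by simp
  show m: "m \<le> n + card B" using assms(1) c by auto
  show "B \<subseteq> {..<n + card B}" using m assms(3) by fastforce
qed

section \<open>Iterated faces of a single degeneracy\<close>

context simplicial_abelian_group
begin

lemma group_sgroup: "group (sgroup A n)"
  by (rule group_of_comm[OF comm_group])

lemma degen_closed:
  "j \<le> n \<Longrightarrow> x \<in> carrier (sgroup A n) \<Longrightarrow> degen A n j x \<in> carrier (sgroup A (Suc n))"
  by (rule hom_in_carrier[OF degen_hom])

lemma face_closed:
  "j \<le> Suc n \<Longrightarrow> x \<in> carrier (sgroup A (Suc n)) \<Longrightarrow> face A (Suc n) j x \<in> carrier (sgroup A n)"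
  by (rule hom_in_carrier[OF face_hom])

lemma degen_set_hom:
  assumes "finite B" "B \<subseteq> {..<n + card B}"
  shows "degen_set A n B \<in> hom (sgroup A n) (sgroup A (n + card B))"
  using assms
proof (induction B rule: finite_linorder_max_induct)
  case empty
  then show ?case by (simp add: degen_set_def hom_def)
next
  case (insert m B)
  note s = subset_lessThan_of_insert[OF insert.prems insert.hyps(1,2)[rule_format]]
  have "(\<lambda>x. degen A (n + card B) m (degen_set A n B x)) \<in> hom (sgroup A n) (sgroup A (Suc (n + card B)))"
    by (rule hom_o[OF insert.IH[OF s(1)] degen_hom[OF s(2)]])
  moreover have "degen_set A n (insert m B) = (\<lambda>x. degen A (n + card B) m (degen_set A n B x))"
    by (rule ext) (use insert.hyps in \<open>simp add: degen_set_insert_greater\<close>)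
  ultimately show ?case
    using s(3) by simp
qed

lemma last_faces_hom: "i \<le> n \<Longrightarrow> last_faces A n i \<in> hom (sgroup A n) (sgroup A (n - i))"
proof (induction i arbitrary: n)
  case 0
  then show ?case by (simp add: hom_def)
next
  case (Suc i)
  then obtain m where n: "n = Suc m" by (cases n) auto
  have "(\<lambda>x. last_faces A m i (face A (Suc m) (Suc m) x)) \<in> hom (sgroup A (Suc m)) (sgroup A (m - i))"
    using Suc n by (intro hom_o[OF face_hom]) auto
  moreover have "last_faces A (Suc m) (Suc i) = (\<lambda>x. last_faces A m i (face A (Suc m) (Suc m) x))"
    by (rule ext) simp
  ultimately show ?case using n by simp
qed

lemma first_faces_hom: "i \<le> n \<Longrightarrow> first_faces A n i \<in> hom (sgroup A n) (sgroup A (n - i))"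
proof (induction i arbitrary: n)
  case 0
  then show ?case by (simp add: hom_def)
next
  case (Suc i)
  then obtain m where n: "n = Suc m" by (cases n) auto
  have "(\<lambda>x. first_faces A m i (face A (Suc m) 0 x)) \<in> hom (sgroup A (Suc m)) (sgroup A (m - i))"
    using Suc n by (intro hom_o[OF face_hom]) auto
  moreover have "first_faces A (Suc m) (Suc i) = (\<lambda>x. first_faces A m i (face A (Suc m) 0 x))"
    by (rule ext) simp
  ultimately show ?case using n by simp
qed

text \<open>Every last face that is applied has index greater than \<open>j + 1\<close>, so it
  passes \<open>s_j\<close> without changing the index \<open>j\<close>.\<close>

lemma last_faces_degen_less:
  "\<lbrakk>p + q = Suc n; j < p; y \<in> carrier (sgroup A n)\<rbrakk> \<Longrightarrow>
    last_faces A (Suc n) q (degen A n j y) = degen A (p - 1) j (last_faces A n q y)"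
proof (induction q arbitrary: n y)
  case (Suc q)
  then obtain m where n: "n = Suc m" by (cases n) auto
  have "face A (Suc n) (Suc n) (degen A n j y) = degen A m j (face A n n y)"
    using Suc.prems n by (subst face_degen_greater) auto
  then show ?case
    using Suc.IH[of m "face A n n y"] Suc.prems n face_closed[of n m y] by simp
qed auto

text \<open>The last faces pass \<open>s_j\<close> while the degree drops, until the last face is
  \<open>d_(j+1)\<close>, which cancels \<open>s_j\<close>. This uses up one face, whence
  \<open>q - 1\<close>.\<close>

lemma last_faces_degen_ge:
  "\<lbrakk>p + q = Suc n; p \<le> j; j \<le> n; y \<in> carrier (sgroup A n)\<rbrakk> \<Longrightarrow>
    last_faces A (Suc n) q (degen A n j y) = last_faces A n (q - 1) y"
proof (induction q arbitrary: n y)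
  case (Suc q)
  show ?case
  proof (cases "j = n")
    case True
    then show ?thesis using Suc.prems by (simp add: face_degen_eq)
  next
    case False
    then obtain m where n: "n = Suc m" using Suc.prems by (cases n) auto
    obtain q' where q': "q = Suc q'" using Suc.prems False by (cases q) auto
    have "face A (Suc n) (Suc n) (degen A n j y) = degen A m j (face A n n y)"
      using Suc.prems n False by (subst face_degen_greater) auto
    then show ?thesis
      using Suc.IH[of m "face A n n y"] Suc.prems n q' False face_closed[of n m y] by simp
  qed
qed auto

text \<open>Each application of \<open>d_0\<close> passes the degeneracy and lowers its index by
  one.\<close>

lemma first_faces_degen_ge:
  "\<lbrakk>p \<le> j; j \<le> n; y \<in> carrier (sgroup A n)\<rbrakk> \<Longrightarrow>
    first_faces A (Suc n) p (degen A n j y) = degen A (n - p) (j - p) (first_faces A n p y)"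
proof (induction p arbitrary: n j y)
  case (Suc p)
  then obtain m where n: "n = Suc m" by (cases n) auto
  have "face A (Suc n) 0 (degen A n j y) = degen A m (j - 1) (face A n 0 y)"
    using Suc.prems n by (subst face_degen_less) auto
  then show ?case
    using Suc.IH[of "j - 1" m "face A n 0 y"] Suc.prems n face_closed[of 0 m y] by simp
qed auto

text \<open>After \<open>j\<close> applications of \<open>d_0\<close> the degeneracy has become
  \<open>s_0\<close>, which the next \<open>d_0\<close> cancels.\<close>

lemma first_faces_degen_less:
  "\<lbrakk>j < p; p \<le> Suc n; y \<in> carrier (sgroup A n)\<rbrakk> \<Longrightarrow>
    first_faces A (Suc n) p (degen A n j y) = first_faces A n (p - 1) y"
proof (induction p arbitrary: n j y)
  case (Suc p)
  show ?case
  proof (cases "j = 0")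
    case True
    then show ?thesis using Suc.prems by (simp add: face_degen_eq)
  next
    case False
    then obtain m where n: "n = Suc m" using Suc.prems by (cases n) auto
    obtain p' where p': "p = Suc p'" using Suc.prems False by (cases p) auto
    have "face A (Suc n) 0 (degen A n j y) = degen A m (j - 1) (face A n 0 y)"
      using Suc.prems n False by (subst face_degen_less) auto
    then show ?thesis
      using Suc.IH[of "j - 1" m "face A n 0 y"] Suc.prems n p' False face_closed[of 0 m y] by auto
  qed
qed auto

end

text \<open>Reassembles an index set from its part \<open>S\<close> below the cut \<open>p\<close>
  and its part \<open>T\<close> above it, where \<open>T\<close> is numbered from
  \<open>0\<close>.\<close>

definition shift_union :: "nat \<Rightarrow> nat set \<Rightarrow> nat set \<Rightarrow> nat set" where
  "shift_union p S T = S \<union> (+) p ` T"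

lemma shift_union_empty [simp]: "shift_union p S {} = S"
  by (simp add: shift_union_def)

lemma shift_union_insert: "shift_union p S (insert m T) = insert (p + m) (shift_union p S T)"
  by (auto simp: shift_union_def)

lemma finite_shift_union [simp]: "finite S \<Longrightarrow> finite T \<Longrightarrow> finite (shift_union p S T)"
  by (simp add: shift_union_def)

lemma card_shift_union:
  assumes "finite S" "finite T" "S \<subseteq> {..<p}"
  shows "card (shift_union p S T) = card S + card T"
proof -
  have "S \<inter> (+) p ` T = {}" using assms(3) by auto
  then show ?thesis
    unfolding shift_union_def using assms by (subst card_Un_disjoint) (auto simp: card_image)
qed

lemma shift_union_less: "S \<subseteq> {..<p} \<Longrightarrow> (\<And>t. t \<in> T \<Longrightarrow> t < m) \<Longrightarrow> b \<in> shift_union p S T \<Longrightarrow> b < p + m"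
  by (auto simp: shift_union_def)

lemma shift_union_subset: "S \<subseteq> {..<p} \<Longrightarrow> T \<subseteq> {..<q} \<Longrightarrow> shift_union p S T \<subseteq> {..<p + q}"
  by (auto simp: shift_union_def)

lemma shift_union_Un: "shift_union p S T \<union> shift_union p S' T' = shift_union p (S \<union> S') (T \<union> T')"
  unfolding shift_union_def image_Un by blast

lemma shift_union_lessThan: "shift_union p {..<p} {..<q} = {..<p + q}"
proof (rule equalityI)
  show "{..<p + q} \<subseteq> shift_union p {..<p} {..<q}"
  proof
    fix x assume x: "x \<in> {..<p + q}"
    show "x \<in> shift_union p {..<p} {..<q}"
    proof (cases "x < p")
      case False
      then have "x = p + (x - p)" "x - p \<in> {..<q}" using x by auto
      then show ?thesis unfolding shift_union_def by blast
    qed (simp add: shift_union_def)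
  qed
qed (rule shift_union_subset; simp)

lemma shift_union_disjoint:
  assumes "S \<subseteq> {..<p}" "S' \<subseteq> {..<p}" "S \<inter> S' = {}" "T \<inter> T' = {}"
  shows "shift_union p S T \<inter> shift_union p S' T' = {}"
proof -
  have lt: "x \<in> S \<Longrightarrow> x < p" "x \<in> S' \<Longrightarrow> x < p" for x using assms(1,2) by blast+
  have "False" if "x \<in> shift_union p S T" "x \<in> shift_union p S' T'" for x
  proof -
    have "x \<in> S \<or> (\<exists>t\<in>T. x = p + t)" "x \<in> S' \<or> (\<exists>t\<in>T'. x = p + t)"
      using that unfolding shift_union_def by blast+
    then show False
      using lt[of x] assms(3,4)[unfolded disjoint_iff] by (metis add_left_cancel not_add_less1)
  qed
  then show ?thesis unfolding disjoint_iff by blast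
qed

section \<open>Front and back faces of an iterated degeneracy cut at \<open>p\<close>\<close>

context simplicial_abelian_group
begin

lemma last_faces_degen_set_less:
  assumes "finite S" "S \<subseteq> {..<k1 + card S}" "x \<in> carrier (sgroup A (k1 + k2))"
  shows "last_faces A (k1 + card S + k2) k2 (degen_set A (k1 + k2) S x) =
    degen_set A k1 S (last_faces A (k1 + k2) k2 x)"
  using assms
proof (induction S rule: finite_linorder_max_induct)
  case (insert m S)
  note s = subset_lessThan_of_insert[OF insert.prems(1) insert.hyps(1,2)[rule_format]]
  have S: "S \<subseteq> {..<(k1 + k2) + card S}" using s(1) by auto
  note c = hom_in_carrier[OF degen_set_hom[OF insert.hyps(1) S] insert.prems(2)]
  have "last_faces A (Suc (k1 + k2 + card S)) k2 (degen A (k1 + k2 + card S) m (degen_set A (k1 + k2) S x)) =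
    degen A (k1 + card S) m (last_faces A (k1 + k2 + card S) k2 (degen_set A (k1 + k2) S x))"
    using s(2) last_faces_degen_less[OF _ _ c, of "Suc (k1 + card S)" k2 m] by simp
  also have "\<dots> = degen A (k1 + card S) m (degen_set A k1 S (last_faces A (k1 + k2) k2 x))"
    using insert.IH[OF s(1) insert.prems(2)] by (simp add: ac_simps)
  finally show ?case
    using insert.hyps s(3) by (simp add: degen_set_insert_greater ac_simps)
qed simp

text \<open>The cut is \<open>p = k1 + card S\<close>. The degeneracies above it are outermost, and
  each is cancelled by one last face. Of the \<open>k2 + card T\<close> faces \<open>k2\<close>
  remain, and these pass all of \<open>S\<close>.\<close>

lemma last_faces_degen_set:
  assumes "finite T" "T \<subseteq> {..<k2 + card T}" "finite S" "S \<subseteq> {..<k1 + card S}"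
    "x \<in> carrier (sgroup A (k1 + k2))"
  shows "last_faces A (k1 + card S + (k2 + card T)) (k2 + card T)
      (degen_set A (k1 + k2) (shift_union (k1 + card S) S T) x) =
    degen_set A k1 S (last_faces A (k1 + k2) k2 x)"
  using assms
proof (induction T rule: finite_linorder_max_induct)
  case empty
  then show ?case using last_faces_degen_set_less[of S k1 x k2] by (simp add: ac_simps)
next
  case (insert m T)
  let ?p = "k1 + card S"
  let ?U = "shift_union ?p S T"
  let ?n = "k1 + k2 + card S + card T"
  note s = subset_lessThan_of_insert[OF insert.prems(1) insert.hyps(1,2)[rule_format]]
  have cU: "card ?U = card S + card T" and fU: "finite ?U"
    using insert by (simp_all add: card_shift_union)
  have U: "?U \<subseteq> {..<(k1 + k2) + card ?U}"
    using shift_union_subset[OF insert.prems(3) s(1)] unfolding cU by (simp add: ac_simps)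
  note c = hom_in_carrier[OF degen_set_hom[OF fU U] insert.prems(4), unfolded cU, folded add.assoc]
  \<comment> \<open>The outermost index \<open>?p + m\<close> is at or above the cut, so it
    disappears together with one face.\<close>
  have "last_faces A (Suc ?n) (Suc (k2 + card T)) (degen A ?n (?p + m) (degen_set A (k1 + k2) ?U x)) =
    last_faces A ?n (k2 + card T) (degen_set A (k1 + k2) ?U x)"
    using s(2) last_faces_degen_ge[OF _ _ _ c, of ?p "Suc (k2 + card T)" "?p + m"] by simp
  also have "\<dots> = degen_set A k1 S (last_faces A (k1 + k2) k2 x)"
    using insert.IH[OF s(1) insert.prems(2-4)] by (simp add: ac_simps)
  moreover have "degen_set A (k1 + k2) (shift_union ?p S (insert m T)) x =
      degen A ?n (?p + m) (degen_set A (k1 + k2) ?U x)"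
    unfolding shift_union_insert
    using shift_union_less[OF insert.prems(3), of T m] insert.hyps(2)
    by (subst degen_set_insert_greater[OF fU]) (auto simp: cU ac_simps)
  ultimately show ?case
    using s(3) by (simp add: ac_simps)
qed

lemma first_faces_degen_set_less:
  assumes "finite S" "S \<subseteq> {..<k1 + card S}" "x \<in> carrier (sgroup A (k1 + k2))"
  shows "first_faces A (k1 + card S + k2) (k1 + card S) (degen_set A (k1 + k2) S x) =
    first_faces A (k1 + k2) k1 x"
  using assms
proof (induction S rule: finite_linorder_max_induct)
  case (insert m S)
  note s = subset_lessThan_of_insert[OF insert.prems(1) insert.hyps(1,2)[rule_format]]
  have S: "S \<subseteq> {..<(k1 + k2) + card S}" using s(1) by auto
  note c = hom_in_carrier[OF degen_set_hom[OF insert.hyps(1) S] insert.prems(2)]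
  have "first_faces A (Suc (k1 + k2 + card S)) (Suc (k1 + card S))
      (degen A (k1 + k2 + card S) m (degen_set A (k1 + k2) S x)) =
    first_faces A (k1 + k2 + card S) (k1 + card S) (degen_set A (k1 + k2) S x)"
    using s(2) first_faces_degen_less[OF _ _ c, of m "Suc (k1 + card S)"] by simp
  also have "\<dots> = first_faces A (k1 + k2) k1 x"
    using insert.IH[OF s(1) insert.prems(2)] by (simp add: ac_simps)
  finally show ?case
    using insert.hyps s(3) by (simp add: degen_set_insert_greater ac_simps)
qed simp

text \<open>Dual to \<open>last_faces_degen_set\<close>: the first \<open>p = k1 + card S\<close>
  faces pass the degeneracies above the cut, lowering their indices by \<open>p\<close>. Then
  \<open>card S\<close> faces cancel the degeneracies in \<open>S\<close>, and \<open>k1\<close>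
  faces reach \<open>x\<close>.\<close>

lemma first_faces_degen_set:
  assumes "finite T" "T \<subseteq> {..<k2 + card T}" "finite S" "S \<subseteq> {..<k1 + card S}"
    "x \<in> carrier (sgroup A (k1 + k2))"
  shows "first_faces A (k1 + card S + (k2 + card T)) (k1 + card S)
      (degen_set A (k1 + k2) (shift_union (k1 + card S) S T) x) =
    degen_set A k2 T (first_faces A (k1 + k2) k1 x)"
  using assms
proof (induction T rule: finite_linorder_max_induct)
  case empty
  then show ?case using first_faces_degen_set_less[of S k1 x k2] by (simp add: ac_simps)
next
  case (insert m T)
  let ?p = "k1 + card S"
  let ?U = "shift_union ?p S T"
  let ?n = "k1 + k2 + card S + card T"
  note s = subset_lessThan_of_insert[OF insert.prems(1) insert.hyps(1,2)[rule_format]]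
  have cU: "card ?U = card S + card T" and fU: "finite ?U"
    using insert by (simp_all add: card_shift_union)
  have U: "?U \<subseteq> {..<(k1 + k2) + card ?U}"
    using shift_union_subset[OF insert.prems(3) s(1)] unfolding cU by (simp add: ac_simps)
  note c = hom_in_carrier[OF degen_set_hom[OF fU U] insert.prems(4), unfolded cU, folded add.assoc]
  \<comment> \<open>All \<open>?p\<close> faces pass the outermost degeneracy, whose index drops
    from \<open>?p + m\<close> to \<open>m\<close>.\<close>
  have "first_faces A (Suc ?n) ?p (degen A ?n (?p + m) (degen_set A (k1 + k2) ?U x)) =
    degen A (k2 + card T) m (first_faces A ?n ?p (degen_set A (k1 + k2) ?U x))"
    using s(2) first_faces_degen_ge[OF _ _ c, of ?p "?p + m"] by simp
  also have "\<dots> = degen A (k2 + card T) m (degen_set A k2 T (first_faces A (k1 + k2) k1 x))"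
    using insert.IH[OF s(1) insert.prems(2-4)] by (simp add: ac_simps)
  moreover have "degen_set A (k1 + k2) (shift_union ?p S (insert m T)) x =
      degen A ?n (?p + m) (degen_set A (k1 + k2) ?U x)"
    unfolding shift_union_insert
    using shift_union_less[OF insert.prems(3), of T m] insert.hyps(2)
    by (subst degen_set_insert_greater[OF fU]) (auto simp: cU ac_simps)
  ultimately show ?case
    using s(3) insert.hyps by (simp add: ac_simps degen_set_insert_greater)
qed

end

section \<open>Signs of shuffles\<close>

definition list_perm :: "nat list \<Rightarrow> nat \<Rightarrow> nat" where
  "list_perm xs i = (if i < length xs then xs ! i else i)"

text \<open>Passing to arbitrary words makes room for moving one entry at a time; the intermediate
  words are in general not two increasing runs.\<close>

lemma shuffle_perm_eq_list_perm:
  "shuffle_perm \<alpha> \<beta> = list_perm (sorted_list_of_set \<alpha> @ sorted_list_of_set \<beta>)"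
  by (auto simp: shuffle_perm_def list_perm_def Let_def fun_eq_iff)

lemma list_perm_permutes:
  assumes "distinct xs" "set xs = {..<length xs}"
  shows "list_perm xs permutes {..<length xs}"
proof (rule bij_imp_permutes)
  have "bij_betw ((!) xs) {..<length xs} {..<length xs}"
    using assms by (intro bij_betw_nth) auto
  then show "bij_betw (list_perm xs) {..<length xs} {..<length xs}"
    by (subst bij_betw_cong[of _ _ "(!) xs"]) (auto simp: list_perm_def)
qed (auto simp: list_perm_def)

lemma sign_list_perm_swap:
  assumes "distinct (xs @ a # b # ys)" "set (xs @ a # b # ys) = {..<length (xs @ a # b # ys)}"
  shows "sign (list_perm (xs @ a # b # ys)) = - sign (list_perm (xs @ b # a # ys))"
proof -
  let ?t = "transpose (length xs) (Suc (length xs))"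
  \<comment> \<open>The permutation sends positions to entries, so exchanging two adjacent entries
    is a transposition of positions, composed on the right.\<close>
  have eq: "list_perm (xs @ a # b # ys) = list_perm (xs @ b # a # ys) \<circ> ?t"
  proof
    fix i
    consider "i < length xs" | "i = length xs" | "i = Suc (length xs)" | "i > Suc (length xs)"
      by linarith
    then show "list_perm (xs @ a # b # ys) i = (list_perm (xs @ b # a # ys) \<circ> ?t) i"
    proof cases
      case 4
      then obtain j where "i = length xs + Suc (Suc j)"
        using less_iff_Suc_add by (metis add_Suc_right add_Suc_shift)
      then show ?thesis
        by (simp add: list_perm_def transpose_def nth_append)
    qed (auto simp: list_perm_def transpose_def nth_append)
  qed
  have "permutation (list_perm (xs @ b # a # ys))"
    using assms by (intro permutes_imp_permutation[OF _ list_perm_permutes]) auto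
  then show ?thesis
    unfolding eq by (subst sign_compose) (auto simp: permutation_swap_id sign_swap_id)
qed

text \<open>Carrying \<open>a\<close> to the end takes one adjacent swap for each entry of
  \<open>ys\<close>.\<close>

lemma sign_list_perm_move:
  assumes "distinct (xs @ a # ys)" "set (xs @ a # ys) = {..<length (xs @ a # ys)}"
  shows "sign (list_perm (xs @ a # ys)) = (- 1) ^ length ys * sign (list_perm (xs @ ys @ [a]))"
  using assms
proof (induction ys arbitrary: xs)
  case (Cons b ys)
  have "sign (list_perm ((xs @ [b]) @ a # ys)) =
      (- 1) ^ length ys * sign (list_perm ((xs @ [b]) @ ys @ [a]))"
    using Cons.prems by (intro Cons.IH) auto
  then show ?case
    using sign_list_perm_swap[OF Cons.prems] by simp
qed simp

text \<open>\<open>list_perm\<close> is the identity beyond the end of the word, so appending an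
  entry equal to its own position adds only a fixed point.\<close>

lemma list_perm_append_length: "list_perm (xs @ [length xs]) = list_perm xs"
  by (auto simp: list_perm_def nth_append fun_eq_iff)

context
  fixes \<alpha> \<beta> :: "nat set" and n :: nat
  assumes ab: "\<alpha> \<inter> \<beta> = {}" "\<alpha> \<union> \<beta> = {..<n}"
begin

private lemma fin: "finite \<alpha>" "finite \<beta>"
  using ab(2) finite_subset[of _ "{..<n}"] by auto

private lemma lt: "a \<in> \<alpha> \<Longrightarrow> a < n" "b \<in> \<beta> \<Longrightarrow> b < n"
  using ab(2) by auto

private lemma cards: "card \<alpha> + card \<beta> = n"
  using card_Un_disjoint[OF fin ab(1)] ab(2) by simp

text \<open>The word of \<alpha> and \<beta> has length \<open>n\<close>, so the new maximum
  \<open>n\<close> becomes a fixed point at its end.\<close>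

lemma shuffle_perm_insert_right: "shuffle_perm \<alpha> (insert n \<beta>) = shuffle_perm \<alpha> \<beta>"
  using list_perm_append_length[of "sorted_list_of_set \<alpha> @ sorted_list_of_set \<beta>"] cards lt fin
  by (simp add: shuffle_perm_eq_list_perm sorted_list_of_set_insert_greater
    del: sorted_list_of_set_insert_remove)

text \<open>The new maximum stands at the end of the run of \<alpha>; carrying it past all of
  \<beta> turns it into a fixed point at the end.\<close>

lemma sign_shuffle_perm_insert_left:
  "sign (shuffle_perm (insert n \<alpha>) \<beta>) = (- 1) ^ card \<beta> * sign (shuffle_perm \<alpha> \<beta>)"
proof -
  have n: "n \<notin> \<alpha>" "n \<notin> \<beta>" using lt by auto
  have "sign (list_perm (sorted_list_of_set \<alpha> @ n # sorted_list_of_set \<beta>)) =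
    (- 1) ^ length (sorted_list_of_set \<beta>) * sign (list_perm (sorted_list_of_set \<alpha> @ sorted_list_of_set \<beta> @ [n]))"
    using ab fin n cards by (intro sign_list_perm_move) (auto simp: lessThan_Suc)
  then show ?thesis
    using list_perm_append_length[of "sorted_list_of_set \<alpha> @ sorted_list_of_set \<beta>"] cards lt fin
    by (simp add: shuffle_perm_eq_list_perm sorted_list_of_set_insert_greater
    del: sorted_list_of_set_insert_remove)
qed

end

text \<open>Induction on \<open>q\<close>, removing the largest index of the upper shuffle. In
  \<beta>' it is the last entry of both words and costs nothing. In \<alpha>' it is carried past
  \<beta> and \<beta>' in the joined word, but only past \<beta>' in the upper one; the surplus of
  \<open>card \<beta>\<close> swaps is the increment of the exponent.\<close>

lemma sign_shuffle_perm_shift_union: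
  assumes "\<alpha> \<inter> \<beta> = {}" "\<alpha> \<union> \<beta> = {..<p}"
  shows "\<lbrakk>\<alpha>' \<inter> \<beta>' = {}; \<alpha>' \<union> \<beta>' = {..<q}\<rbrakk> \<Longrightarrow>
    sign (shuffle_perm (shift_union p \<alpha> \<alpha>') (shift_union p \<beta> \<beta>')) =
    sign (shuffle_perm \<alpha> \<beta>) * sign (shuffle_perm \<alpha>' \<beta>') * (- 1) ^ (card \<beta> * card \<alpha>')"
proof (induction q arbitrary: \<alpha>' \<beta>')
  case 0
  then have "\<alpha>' = {}" "\<beta>' = {}" by auto
  moreover have "shuffle_perm {} {} = id" by (auto simp: shuffle_perm_def)
  ultimately show ?case by simp
next
  case (Suc q)
  have sub: "\<alpha> \<subseteq> {..<p}" "\<beta> \<subseteq> {..<p}"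
    using assms(2) by blast+
  note fin = finite_subset[OF sub(1) finite_lessThan] finite_subset[OF sub(2) finite_lessThan] sub
  define \<alpha>0 \<beta>0 where "\<alpha>0 = \<alpha>' - {q}" and "\<beta>0 = \<beta>' - {q}"
  have 0: "\<alpha>0 \<inter> \<beta>0 = {}" "\<alpha>0 \<union> \<beta>0 = {..<q}"
    using Suc.prems unfolding \<alpha>0_def \<beta>0_def lessThan_Suc by blast+
  have "\<alpha>0 \<subseteq> {..<q}" "\<beta>0 \<subseteq> {..<q}"
    using 0(2) by blast+
  note fin0 = this[THEN finite_subset, OF finite_lessThan]
  have q_notin: "q \<notin> \<alpha>0" "q \<notin> \<beta>0"
    by (simp_all add: \<alpha>0_def \<beta>0_def)
  have u: "shift_union p \<alpha> \<alpha>0 \<inter> shift_union p \<beta> \<beta>0 = {}"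
      "shift_union p \<alpha> \<alpha>0 \<union> shift_union p \<beta> \<beta>0 = {..<p + q}"
  proof -
    show "shift_union p \<alpha> \<alpha>0 \<inter> shift_union p \<beta> \<beta>0 = {}"
      using assms(1) fin(3,4) 0(1) by (intro shift_union_disjoint)
    show "shift_union p \<alpha> \<alpha>0 \<union> shift_union p \<beta> \<beta>0 = {..<p + q}"
      unfolding shift_union_Un assms(2) 0(2) by (rule shift_union_lessThan)
  qed
  have "q \<in> \<alpha>' \<or> q \<in> \<beta>'" using Suc.prems(2) by auto
  then show ?case
  proof
    assume q: "q \<in> \<alpha>'"
    then have e: "\<alpha>' = insert q \<alpha>0" "\<beta>' = \<beta>0"
      using Suc.prems(1) by (auto simp: \<alpha>0_def \<beta>0_def)
    have "sign (shuffle_perm (shift_union p \<alpha> \<alpha>') (shift_union p \<beta> \<beta>')) =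
      (- 1) ^ (card \<beta> + card \<beta>0) * (sign (shuffle_perm \<alpha> \<beta>) * sign (shuffle_perm \<alpha>0 \<beta>0) * (- 1) ^ (card \<beta> * card \<alpha>0))"
      using fin fin0 q_notin by (simp add: e shift_union_insert sign_shuffle_perm_insert_left[OF u] Suc.IH[OF 0] card_shift_union)
    \<comment> \<open>The factor \<open>(- 1) ^ card \<beta>\<close> raises the exponent to
      \<open>card \<beta> * Suc (card \<alpha>0)\<close>; the factor
      \<open>(- 1) ^ card \<beta>0\<close> belongs to the upper shuffle.\<close>
    also have "\<dots> = sign (shuffle_perm \<alpha> \<beta>) * ((- 1) ^ card \<beta>0 * sign (shuffle_perm \<alpha>0 \<beta>0)) * (- 1) ^ (card \<beta> * Suc (card \<alpha>0))"
      by (simp only: power_add mult_Suc_right mult.assoc mult.commute mult.left_commute)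
    finally show ?thesis
      using fin0 q_notin by (simp add: e sign_shuffle_perm_insert_left[OF 0])
  next
    assume q: "q \<in> \<beta>'"
    then have e: "\<alpha>' = \<alpha>0" "\<beta>' = insert q \<beta>0"
      using Suc.prems(1) by (auto simp: \<alpha>0_def \<beta>0_def)
    show ?thesis
      by (simp add: e shift_union_insert shuffle_perm_insert_right[OF u] shuffle_perm_insert_right[OF 0] Suc.IH[OF 0])
  qed
qed

section \<open>Cutting and joining shuffles\<close>

lemma shufflesD:
  assumes "(\<alpha>, \<beta>) \<in> shuffles k l"
  shows "finite \<alpha>" "finite \<beta>" "\<alpha> \<subseteq> {..<k + l}" "\<beta> \<subseteq> {..<k + l}" "\<alpha> \<inter> \<beta> = {}" "card \<alpha> = k" "card \<beta> = l"
    "\<alpha> \<union> \<beta> = {..<k + l}"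
proof -
  show a: "\<alpha> \<subseteq> {..<k + l}" "\<beta> \<subseteq> {..<k + l}" "\<alpha> \<inter> \<beta> = {}" "card \<alpha> = k" "card \<beta> = l"
    using assms by (auto simp: shuffles_def)
  show f: "finite \<alpha>" "finite \<beta>" using a finite_subset[of _ "{..<k + l}"] by auto
  have "card (\<alpha> \<union> \<beta>) = card {..<k + l}" using f a by (simp add: card_Un_disjoint)
  then show "\<alpha> \<union> \<beta> = {..<k + l}" using a by (intro card_subset_eq) auto
qed

lemma finite_shuffles [simp]: "finite (shuffles k l)"
  by (rule finite_subset[of _ "Pow {..<k + l} \<times> Pow {..<k + l}"]) (auto simp: shuffles_def)

text \<open>Indexes the summands of the second composite: the degree pairs come from the two
  Alexander--Whitney maps, the two shuffles from the two shuffle maps that follow.\<close>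

definition shuffle_splittings where
  "shuffle_splittings k l = (SIGMA ((k1, k2), (l1, l2)) : degree_pairs k \<times> degree_pairs l.
     shuffles k1 l1 \<times> shuffles k2 l2)"

text \<open>The value indexes a summand of the first composite: the joined shuffle, together with
  the cut at which it was joined.\<close>

fun shuffle_join :: "((nat \<times> nat) \<times> (nat \<times> nat)) \<times> (nat set \<times> nat set) \<times> (nat set \<times> nat set) \<Rightarrow>
    (nat set \<times> nat set) \<times> (nat \<times> nat)" where
  "shuffle_join (((k1, k2), (l1, l2)), ((\<alpha>, \<beta>), (\<alpha>', \<beta>'))) =
     ((shift_union (k1 + l1) \<alpha> \<alpha>', shift_union (k1 + l1) \<beta> \<beta>'), (k1 + l1, k2 + l2))"

lemma shift_union_inject:
  assumes "S \<subseteq> {..<p}" "S' \<subseteq> {..<p}" "shift_union p S T = shift_union p S' T'"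
  shows "S = S' \<and> T = T'"
proof -
  have "S = shift_union p S T \<inter> {..<p}" if "S \<subseteq> {..<p}" for S T
    using that by (auto simp: shift_union_def)
  moreover have "(+) p ` T = shift_union p S T \<inter> {p..}" if "S \<subseteq> {..<p}" for S T
    using that by (auto simp: shift_union_def)
  ultimately have "S = S'" "(+) p ` T = (+) p ` T'"
    using assms by metis+
  then show ?thesis by (simp add: inj_image_eq_iff)
qed

lemma shift_union_split:
  assumes "S \<subseteq> {..<p + q}"
  obtains S1 S2 where "S1 \<subseteq> {..<p}" "S2 \<subseteq> {..<q}" "S = shift_union p S1 S2"
proof
  show "S \<inter> {..<p} \<subseteq> {..<p}" by simp
  show "(\<lambda>i. i - p) ` (S \<inter> {p..}) \<subseteq> {..<q}" using assms by auto
  have "(+) p ` (\<lambda>i. i - p) ` (S \<inter> {p..}) = S \<inter> {p..}"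
    unfolding image_image by (auto simp: image_iff)
  then show "S = shift_union p (S \<inter> {..<p}) ((\<lambda>i. i - p) ` (S \<inter> {p..}))"
    unfolding shift_union_def by auto
qed

text \<open>The position \<open>k1 + l1\<close> of the cut is part of the value, and once it is
  known the pieces of the joined sets can be read off.\<close>

lemma inj_on_shuffle_join: "inj_on shuffle_join (shuffle_splittings k l)"
proof (rule inj_onI)
  fix u v assume u: "u \<in> shuffle_splittings k l" and v: "v \<in> shuffle_splittings k l"
    and eq: "shuffle_join u = shuffle_join v"
  obtain k1 k2 l1 l2 \<alpha> \<beta> \<alpha>' \<beta>' where u': "u = (((k1, k2), (l1, l2)), ((\<alpha>, \<beta>), (\<alpha>', \<beta>')))"
    using prod.collapse by metis
  obtain k1' k2' l1' l2' \<gamma> \<delta> \<gamma>' \<delta>' where v': "v = (((k1', k2'), (l1', l2')), ((\<gamma>, \<delta>), (\<gamma>', \<delta>')))"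
    using prod.collapse by metis
  have su: "(\<alpha>, \<beta>) \<in> shuffles k1 l1" "(\<alpha>', \<beta>') \<in> shuffles k2 l2"
    using u by (auto simp: u' shuffle_splittings_def)
  have sv: "(\<gamma>, \<delta>) \<in> shuffles k1' l1'" "(\<gamma>', \<delta>') \<in> shuffles k2' l2'"
    using v by (auto simp: v' shuffle_splittings_def)
  have p: "k1 + l1 = k1' + l1'" using eq by (simp add: u' v')
  have "\<alpha> = \<gamma> \<and> \<alpha>' = \<gamma>'" "\<beta> = \<delta> \<and> \<beta>' = \<delta>'"
    using eq shufflesD(3,4)[OF su(1)] shufflesD(3,4)[OF sv(1)]
    by (simp_all only: u' v' p shuffle_join.simps prod.inject)
      (metis shift_union_inject)+
  \<comment> \<open>The degrees are the cardinalities of the four sets, so they agree as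
    well.\<close>
  then show "u = v"
    using shufflesD(6,7)[OF su(1)] shufflesD(6,7)[OF sv(1)] shufflesD(6,7)[OF su(2)] shufflesD(6,7)[OF sv(2)]
    by (simp add: u' v')
qed

text \<open>For surjectivity both sets are cut at \<open>p\<close>, and the degrees are taken to be
  the cardinalities of the pieces.\<close>

lemma shuffle_join_image: "shuffle_join ` shuffle_splittings k l = shuffles k l \<times> degree_pairs (k + l)"
proof (intro equalityI subsetI)
  fix v assume "v \<in> shuffle_join ` shuffle_splittings k l"
  then obtain k1 k2 l1 l2 \<alpha> \<beta> \<alpha>' \<beta>' where v: "v = shuffle_join (((k1, k2), (l1, l2)), ((\<alpha>, \<beta>), (\<alpha>', \<beta>')))"
    and kl: "k1 + k2 = k" "l1 + l2 = l" and s: "(\<alpha>, \<beta>) \<in> shuffles k1 l1" "(\<alpha>', \<beta>') \<in> shuffles k2 l2"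
    by (auto simp: shuffle_splittings_def)
  note d = shufflesD[OF s(1)] and d' = shufflesD[OF s(2)]
  let ?p = "k1 + l1"
  have "shift_union ?p \<alpha> \<alpha>' \<subseteq> {..<k + l}" "shift_union ?p \<beta> \<beta>' \<subseteq> {..<k + l}"
    using shift_union_subset[OF d(3) d'(3)] shift_union_subset[OF d(4) d'(4)]
    by (simp_all add: kl[symmetric] ac_simps)
  moreover have "shift_union ?p \<alpha> \<alpha>' \<inter> shift_union ?p \<beta> \<beta>' = {}"
    using d(3-5) d'(5) by (intro shift_union_disjoint)
  ultimately show "v \<in> shuffles k l \<times> degree_pairs (k + l)"
    using kl d d' by (simp add: v shuffles_def card_shift_union)
next
  fix v assume v: "v \<in> shuffles k l \<times> degree_pairs (k + l)"
  then obtain \<alpha> \<beta> p q where v': "v = ((\<alpha>, \<beta>), (p, q))" and s: "(\<alpha>, \<beta>) \<in> shuffles k l" and pq: "p + q = k + l"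
    by auto
  note d = shufflesD[OF s, folded pq]
  obtain \<alpha>1 \<alpha>2 where a: "\<alpha>1 \<subseteq> {..<p}" "\<alpha>2 \<subseteq> {..<q}" "\<alpha> = shift_union p \<alpha>1 \<alpha>2"
    using shift_union_split[OF d(3)] by blast
  obtain \<beta>1 \<beta>2 where b: "\<beta>1 \<subseteq> {..<p}" "\<beta>2 \<subseteq> {..<q}" "\<beta> = shift_union p \<beta>1 \<beta>2"
    using shift_union_split[OF d(4)] by blast
  have fin: "finite \<alpha>1" "finite \<alpha>2" "finite \<beta>1" "finite \<beta>2"
    using a(1,2) b(1,2) by (auto intro: finite_subset)
  have disj: "\<alpha>1 \<inter> \<beta>1 = {}" "\<alpha>2 \<inter> \<beta>2 = {}"
    using d(5) a(3) b(3) by (auto simp: shift_union_def)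
  have "card \<alpha>1 + card \<alpha>2 = k" "card \<beta>1 + card \<beta>2 = l"
    using d(6,7) a b fin by (simp_all add: card_shift_union)
  \<comment> \<open>Disjointness gives only inequalities. The two left-hand sides add up to
    \<open>k + l = p + q\<close>, so both must be equalities.\<close>
  moreover have "card \<alpha>1 + card \<beta>1 \<le> p" "card \<alpha>2 + card \<beta>2 \<le> q"
    using card_mono[of "{..<p}" "\<alpha>1 \<union> \<beta>1"] card_mono[of "{..<q}" "\<alpha>2 \<union> \<beta>2"] a(1,2) b(1,2) fin disj
    by (simp_all add: card_Un_disjoint)
  ultimately have c: "card \<alpha>1 + card \<alpha>2 = k" "card \<beta>1 + card \<beta>2 = l"
      "card \<alpha>1 + card \<beta>1 = p" "card \<alpha>2 + card \<beta>2 = q"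
    using pq by auto
  let ?u = "(((card \<alpha>1, card \<alpha>2), (card \<beta>1, card \<beta>2)), ((\<alpha>1, \<beta>1), (\<alpha>2, \<beta>2)))"
  have "?u \<in> shuffle_splittings k l"
    using a b c disj by (auto simp: shuffle_splittings_def shuffles_def)
  moreover have "v = shuffle_join ?u" using a b c by (simp add: v')
  ultimately show "v \<in> shuffle_join ` shuffle_splittings k l" by (rule rev_image_eqI)
qed

section \<open>The Alexander--Whitney and shuffle maps on elementary tensors\<close>

lemma cgroup_C [simp]: "cgroup (C A) = sgroup A"
  by (simp add: C_def)

lemma sgroup_simp_tensor [simp]: "sgroup (A \<otimes>\<^sub>\<Delta> B) n = tensor_group (sgroup A n) (sgroup B n)"
  by (simp add: simp_tensor_def)

lemma graded_group_C: "simplicial_abelian_group A \<Longrightarrow> graded_group (C A)"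
  by (simp add: graded_group_def simplicial_abelian_group.comm_group)

lemma finprod_Sigma:
  assumes "comm_group G" "finite I" "\<And>i. i \<in> I \<Longrightarrow> finite (J i)"
    "\<And>i j. i \<in> I \<Longrightarrow> j \<in> J i \<Longrightarrow> f i j \<in> carrier G"
  shows "finprod G (\<lambda>i. finprod G (f i) (J i)) I = finprod G (\<lambda>(i, j). f i j) (Sigma I J)"
proof -
  interpret G: comm_group G by fact
  have "finprod G (\<lambda>(i, j). f i j) (\<Union>i\<in>I. Pair i ` J i) =
      finprod G (\<lambda>i. finprod G (\<lambda>(i, j). f i j) (Pair i ` J i)) I"
    using assms by (intro G.finprod_UN_disjoint) (auto simp: pairwise_def disjnt_def)
  also have "\<dots> = finprod G (\<lambda>i. finprod G (f i) (J i)) I"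
  proof (rule G.finprod_cong')
    fix i assume "i \<in> I"
    then show "finprod G (\<lambda>(i, j). f i j) (Pair i ` J i) = finprod G (f i) (J i)"
      using assms by (subst G.finprod_reindex) (auto simp: inj_on_def)
  qed (use assms in \<open>auto intro!: G.finprod_closed\<close>)
  also have "(\<Union>i\<in>I. Pair i ` J i) = Sigma I J" by auto
  finally show ?thesis by simp
qed

lemma finprod_int_pow:
  assumes "comm_group G" "\<And>i. i \<in> I \<Longrightarrow> f i \<in> carrier G"
  shows "finprod G f I [^]\<^bsub>G\<^esub> (k::int) = finprod G (\<lambda>i. f i [^]\<^bsub>G\<^esub> k) I"
  using hom_finprod_eq[OF hom_int_powI[OF assms(1) hom_ident] assms(1,1), of I f k] assms(2) by simp

lemma biadditive_finprod_finprod: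
  assumes f: "biadditive G H K f" and G: "comm_group G" "comm_group H" "comm_group K"
    and fin: "finite I" "finite J" and g: "\<And>i. i \<in> I \<Longrightarrow> g i \<in> carrier G" and h: "\<And>j. j \<in> J \<Longrightarrow> h j \<in> carrier H"
  shows "f (finprod G g I) (finprod H h J) = finprod K (\<lambda>(i, j). f (g i) (h j)) (I \<times> J)"
proof -
  interpret G: comm_group G by fact
  interpret H: comm_group H by fact
  interpret K: comm_group K by fact
  have c: "f (g i) (h j) \<in> carrier K" if "i \<in> I" "j \<in> J" for i j
    using biadditive_closed[OF f g h] that .
  have "f (finprod G g I) (finprod H h J) = finprod K (\<lambda>i. f (g i) (finprod H h J)) I"
    using hom_finprod_eq[OF biadditiveD2[OF f] G(1,3) g, of "finprod H h J"] h by (simp add: H.finprod_closed)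
  also have "\<dots> = finprod K (\<lambda>i. finprod K (\<lambda>j. f (g i) (h j)) J) I"
    using hom_finprod_eq[OF biadditiveD1[OF f g] G(2,3) h] c
    by (intro K.finprod_cong') (auto intro!: K.finprod_closed)
  also have "\<dots> = finprod K (\<lambda>(i, j). f (g i) (h j)) (I \<times> J)"
    using c fin by (intro finprod_Sigma G)
  finally show ?thesis .
qed

lemma biadditive_int_pow_int_pow:
  assumes f: "biadditive G H K f" and G: "group G" "group H" "group K"
    and g: "g \<in> carrier G" and h: "h \<in> carrier H"
  shows "f (g [^]\<^bsub>G\<^esub> (k::int)) (h [^]\<^bsub>H\<^esub> (l::int)) = f g h [^]\<^bsub>K\<^esub> (k * l)"
proof -
  have hl: "h [^]\<^bsub>H\<^esub> l \<in> carrier H" using h G(2) by (rule group.int_pow_closed[rotated])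
  show ?thesis
    using hom_int_pow[OF biadditiveD2[OF f hl] g G(1,3), of k] hom_int_pow[OF biadditiveD1[OF f g] h G(2,3), of l]
      biadditive_closed[OF f g h] group.int_pow_pow[OF G(3)] by (simp add: mult.commute)
qed

context
  fixes A :: "'a simplicial" and B :: "'b simplicial"
  assumes A: "simplicial_abelian_group A" and B: "simplicial_abelian_group B"
begin

interpretation A: simplicial_abelian_group A by (rule A)
interpretation B: simplicial_abelian_group B by (rule B)

lemma face_simp_tensor_elt:
  assumes "i \<le> Suc n" "a \<in> carrier (sgroup A (Suc n))" "b \<in> carrier (sgroup B (Suc n))"
  shows "face (A \<otimes>\<^sub>\<Delta> B) (Suc n) i (tensor_elt (sgroup A (Suc n)) (sgroup B (Suc n)) a b) =
    tensor_elt (sgroup A n) (sgroup B n) (face A (Suc n) i a) (face B (Suc n) i b)"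
  using assms by (simp add: simp_tensor_def tensor_map_elt A.group_sgroup B.group_sgroup A.face_hom B.face_hom)

lemma degen_simp_tensor_elt:
  assumes "i \<le> n" "a \<in> carrier (sgroup A n)" "b \<in> carrier (sgroup B n)"
  shows "degen (A \<otimes>\<^sub>\<Delta> B) n i (tensor_elt (sgroup A n) (sgroup B n) a b) =
    tensor_elt (sgroup A (Suc n)) (sgroup B (Suc n)) (degen A n i a) (degen B n i b)"
  using assms by (simp add: simp_tensor_def tensor_map_elt A.group_sgroup B.group_sgroup A.degen_hom B.degen_hom)

lemma last_faces_simp_tensor_elt:
  "\<lbrakk>i \<le> n; a \<in> carrier (sgroup A n); b \<in> carrier (sgroup B n)\<rbrakk> \<Longrightarrow>
    last_faces (A \<otimes>\<^sub>\<Delta> B) n i (tensor_elt (sgroup A n) (sgroup B n) a b) =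
    tensor_elt (sgroup A (n - i)) (sgroup B (n - i)) (last_faces A n i a) (last_faces B n i b)"
proof (induction i arbitrary: n a b)
  case (Suc i)
  then obtain m where n: "n = Suc m" by (cases n) auto
  show ?case using Suc.prems Suc.IH[of m "face A n n a" "face B n n b"]
    by (simp add: n face_simp_tensor_elt A.face_closed B.face_closed)
qed simp

lemma first_faces_simp_tensor_elt:
  "\<lbrakk>i \<le> n; a \<in> carrier (sgroup A n); b \<in> carrier (sgroup B n)\<rbrakk> \<Longrightarrow>
    first_faces (A \<otimes>\<^sub>\<Delta> B) n i (tensor_elt (sgroup A n) (sgroup B n) a b) =
    tensor_elt (sgroup A (n - i)) (sgroup B (n - i)) (first_faces A n i a) (first_faces B n i b)"
proof (induction i arbitrary: n a b)
  case (Suc i)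
  then obtain m where n: "n = Suc m" by (cases n) auto
  show ?case using Suc.prems Suc.IH[of m "face A n 0 a" "face B n 0 b"]
    by (simp add: n face_simp_tensor_elt A.face_closed B.face_closed)
qed simp

lemma degen_set_simp_tensor_elt:
  assumes "finite S" "S \<subseteq> {..<n + card S}" "a \<in> carrier (sgroup A n)" "b \<in> carrier (sgroup B n)"
  shows "degen_set (A \<otimes>\<^sub>\<Delta> B) n S (tensor_elt (sgroup A n) (sgroup B n) a b) =
    tensor_elt (sgroup A (n + card S)) (sgroup B (n + card S)) (degen_set A n S a) (degen_set B n S b)"
  using assms
proof (induction S rule: finite_linorder_max_induct)
  case (insert m S)
  note s = subset_lessThan_of_insert[OF insert.prems(1) insert.hyps(1,2)[rule_format]]
  have "degen_set A n S a \<in> carrier (sgroup A (n + card S))" "degen_set B n S b \<in> carrier (sgroup B (n + card S))"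
    using A.degen_set_hom[OF insert.hyps(1) s(1)] B.degen_set_hom[OF insert.hyps(1) s(1)] insert.prems
    by (auto intro: hom_in_carrier)
  then show ?case
    using insert.hyps(1,2) insert.IH[OF s(1) insert.prems(2,3)] s(2,3)
    by (simp add: degen_set_insert_greater degen_simp_tensor_elt)
qed simp

private lemma gA: "graded_group (C A)" and gB: "graded_group (C B)"
  using A B by (auto intro: graded_group_C)

lemma last_faces_closed: "p + q = n \<Longrightarrow> a \<in> carrier (sgroup A n) \<Longrightarrow> last_faces A n q a \<in> carrier (sgroup A p)"
  using hom_in_carrier[OF A.last_faces_hom[of q n]] by auto

lemma first_faces_closed: "p + q = n \<Longrightarrow> b \<in> carrier (sgroup B n) \<Longrightarrow> first_faces B n p b \<in> carrier (sgroup B q)"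
  using hom_in_carrier[OF B.first_faces_hom[of p n]] by auto

private lemma AW_biadditive:
  "biadditive (sgroup A n) (sgroup B n) (cgroup (C A \<otimes>\<^sub>C C B) n)
    (\<lambda>a b. \<Otimes>\<^bsub>cgroup (C A \<otimes>\<^sub>C C B) n\<^esub>w\<in>degree_pairs n.
      (case w of (i, j) \<Rightarrow>
        cx_tensor_elt (C A) (C B) (n - i) (n - j) (last_faces A n i a) (first_faces B n j b)))"
proof (rule biadditive_finprod)
  fix w assume "w \<in> degree_pairs n"
  then obtain i j where w: "w = (i, j)" "i + j = n" by (cases w) auto
  then show "biadditive (sgroup A n) (sgroup B n) (cgroup (C A \<otimes>\<^sub>C C B) n)
    (\<lambda>a b. case w of (i, j) \<Rightarrow>
        cx_tensor_elt (C A) (C B) (n - i) (n - j) (last_faces A n i a) (first_faces B n j b))"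
    unfolding w(1) prod.case cgroup_cx_tensor
    by (intro biadditive_pre[OF cx_tensor_elt_biadditive[OF gA gB]])
      (simp_all add: A.last_faces_hom B.first_faces_hom)
qed (simp_all add: A.group_sgroup B.group_sgroup comm_group_cx_tensor_group gA gB)

lemma graded_hom_AW: "graded_hom (C (A \<otimes>\<^sub>\<Delta> B)) (C A \<otimes>\<^sub>C C B) (AW A B)"
  unfolding graded_hom_def AW_def cgroup_C sgroup_simp_tensor
  by (intro allI tensor_lift_hom AW_biadditive A.group_sgroup B.group_sgroup)
    (simp add: comm_group_cx_tensor_group gA gB)

text \<open>\<open>AW\<close> is indexed by numbers of faces. Here the index is the pair of
  resulting degrees: \<open>q\<close> last faces leave degree \<open>p\<close>, and \<open>p\<close>
  first faces leave degree \<open>q\<close>; hence the reindexing by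
  \<open>prod.swap\<close>.\<close>

lemma AW_elt:
  assumes a: "a \<in> carrier (sgroup A n)" and b: "b \<in> carrier (sgroup B n)"
  shows "AW A B n (tensor_elt (sgroup A n) (sgroup B n) a b) =
    finprod (cx_tensor_group (C A) (C B) n)
      (\<lambda>(p, q). cx_tensor_elt (C A) (C B) p q (last_faces A n q a) (first_faces B n p b)) (degree_pairs n)"
proof -
  interpret K: comm_group "cx_tensor_group (C A) (C B) n"
    by (rule comm_group_cx_tensor_group[OF gA gB])
  have swap: "prod.swap ` degree_pairs n = degree_pairs n"
    by (simp add: set_eq_iff add.commute)
  have "AW A B n (tensor_elt (sgroup A n) (sgroup B n) a b) =
    finprod (cx_tensor_group (C A) (C B) n) (\<lambda>(i, j). cx_tensor_elt (C A) (C B) (n - i) (n - j)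
      (last_faces A n i a) (first_faces B n j b)) (degree_pairs n)"
    unfolding AW_def using a b
    by (subst tensor_lift_elt[OF _ _ _ AW_biadditive])
      (auto simp: A.group_sgroup B.group_sgroup comm_group_cx_tensor_group gA gB)
  also have "\<dots> = finprod (cx_tensor_group (C A) (C B) n) (\<lambda>(i, j). cx_tensor_elt (C A) (C B) j i
      (last_faces A n i a) (first_faces B n j b)) (degree_pairs n)"
    using a b by (intro K.finprod_cong')
      (auto intro!: cx_tensor_elt_closed gA gB last_faces_closed first_faces_closed)
  also have "\<dots> = finprod (cx_tensor_group (C A) (C B) n)
      (\<lambda>(p, q). cx_tensor_elt (C A) (C B) p q (last_faces A n q a) (first_faces B n p b)) (degree_pairs n)"
    using a b by (subst (1) swap[symmetric], subst K.finprod_reindex)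
      (auto intro!: cx_tensor_elt_closed gA gB last_faces_closed first_faces_closed
        simp: case_prod_unfold add.commute)
  finally show ?thesis .
qed

text \<open>As \<open>card \<beta> = l\<close> and \<open>card \<alpha> = k\<close>, the bound in
  the definition of a shuffle is the range condition of \<open>degen_set_hom\<close> for both
  sets.\<close>

lemma degen_set_shuffle_hom:
  assumes "(\<alpha>, \<beta>) \<in> shuffles k l"
  shows "degen_set A k \<beta> \<in> hom (sgroup A k) (sgroup A (k + l))"
    "degen_set B l \<alpha> \<in> hom (sgroup B l) (sgroup B (k + l))"
  using shufflesD[OF assms] A.degen_set_hom[of \<beta> k] B.degen_set_hom[of \<alpha> l] by (auto simp: add.commute)

private lemma shuffle_map_biadditive:
  assumes "k + l = n"
  shows "biadditive (cgroup (C A) k) (cgroup (C B) l) (cgroup (C (A \<otimes>\<^sub>\<Delta> B)) n)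
    (\<lambda>a b. \<Otimes>\<^bsub>cgroup (C (A \<otimes>\<^sub>\<Delta> B)) n\<^esub>w\<in>shuffles k l.
          (case w of (\<alpha>, \<beta>) \<Rightarrow>
             tensor_elt (sgroup A n) (sgroup B n) (degen_set A k \<beta> a) (degen_set B l \<alpha> b)
               [^]\<^bsub>cgroup (C (A \<otimes>\<^sub>\<Delta> B)) n\<^esub> sign (shuffle_perm \<alpha> \<beta>)))"
proof (rule biadditive_finprod)
  show K: "comm_group (cgroup (C (A \<otimes>\<^sub>\<Delta> B)) n)"
    by (simp add: comm_group_tensor_group A.group_sgroup B.group_sgroup)
  fix w assume "w \<in> shuffles k l"
  then obtain \<alpha> \<beta> where w: "w = (\<alpha>, \<beta>)" and s: "(\<alpha>, \<beta>) \<in> shuffles k l" by (cases w) auto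
  show "biadditive (cgroup (C A) k) (cgroup (C B) l) (cgroup (C (A \<otimes>\<^sub>\<Delta> B)) n)
     (\<lambda>a b. case w of (\<alpha>, \<beta>) \<Rightarrow>
             tensor_elt (sgroup A n) (sgroup B n) (degen_set A k \<beta> a) (degen_set B l \<alpha> b)
               [^]\<^bsub>cgroup (C (A \<otimes>\<^sub>\<Delta> B)) n\<^esub> sign (shuffle_perm \<alpha> \<beta>))"
    using degen_set_shuffle_hom[OF s] unfolding w prod.case assms cgroup_C sgroup_simp_tensor
    by (intro biadditive_int_pow biadditive_pre[OF tensor_elt_biadditive] comm_group_tensor_group
      A.group_sgroup B.group_sgroup)
qed (simp_all add: A.group_sgroup B.group_sgroup)

lemma graded_hom_shuffle_map: "graded_hom (C A \<otimes>\<^sub>C C B) (C (A \<otimes>\<^sub>\<Delta> B)) (shuffle_map A B)"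
  unfolding graded_hom_def shuffle_map_def cgroup_cx_tensor
  by (intro allI cx_tensor_lift_hom gA gB shuffle_map_biadditive)
    (simp_all add: comm_group_tensor_group A.group_sgroup B.group_sgroup)

lemma shuffle_map_elt:
  assumes n: "k + l = n" and a: "a \<in> carrier (sgroup A k)" and b: "b \<in> carrier (sgroup B l)"
  shows "shuffle_map A B n (cx_tensor_elt (C A) (C B) k l a b) =
    finprod (tensor_group (sgroup A n) (sgroup B n)) (\<lambda>(\<alpha>, \<beta>).
      tensor_elt (sgroup A n) (sgroup B n) (degen_set A k \<beta> a) (degen_set B l \<alpha> b)
        [^]\<^bsub>tensor_group (sgroup A n) (sgroup B n)\<^esub> sign (shuffle_perm \<alpha> \<beta>)) (shuffles k l)"
  unfolding shuffle_map_def using a b n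
  by (subst cx_tensor_lift_elt[OF gA gB _ shuffle_map_biadditive])
    (simp_all add: comm_group_tensor_group A.group_sgroup B.group_sgroup)

end

section \<open>Comparison on elementary tensors\<close>

context
  fixes X :: "'x simplicial" and Y :: "'y simplicial"
    and Z :: "'z simplicial" and W :: "'w simplicial"
  assumes X: "simplicial_abelian_group X" and Y: "simplicial_abelian_group Y"
    and Z: "simplicial_abelian_group Z" and W: "simplicial_abelian_group W"
begin

interpretation X: simplicial_abelian_group X by (rule X)
interpretation Y: simplicial_abelian_group Y by (rule Y)
interpretation Z: simplicial_abelian_group Z by (rule Z)
interpretation W: simplicial_abelian_group W by (rule W)

private lemma XZ: "simplicial_abelian_group (X \<otimes>\<^sub>\<Delta> Z)" and YW: "simplicial_abelian_group (Y \<otimes>\<^sub>\<Delta> W)"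
  and XY: "simplicial_abelian_group (X \<otimes>\<^sub>\<Delta> Y)" and ZW: "simplicial_abelian_group (Z \<otimes>\<^sub>\<Delta> W)"
  using X Y Z W by (simp_all add: simplicial_abelian_group_tensor)

private lemmas ggC = X[THEN graded_group_C] Y[THEN graded_group_C] Z[THEN graded_group_C] W[THEN graded_group_C]
  XZ[THEN graded_group_C] YW[THEN graded_group_C] XY[THEN graded_group_C] ZW[THEN graded_group_C]

private lemmas grp = X.group_sgroup Y.group_sgroup Z.group_sgroup W.group_sgroup

private abbreviation (input) K :: "nat \<Rightarrow> _" where
  "K n \<equiv> cx_tensor_group (C (X \<otimes>\<^sub>\<Delta> Z)) (C (Y \<otimes>\<^sub>\<Delta> W)) n"

private abbreviation (input) elt :: "nat \<Rightarrow> nat \<Rightarrow> _" where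
  "elt \<equiv> cx_tensor_elt (C (X \<otimes>\<^sub>\<Delta> Z)) (C (Y \<otimes>\<^sub>\<Delta> W))"

private abbreviation (input) via_shuffle :: "nat \<Rightarrow> _" where
  "via_shuffle \<equiv> AW (X \<otimes>\<^sub>\<Delta> Z) (Y \<otimes>\<^sub>\<Delta> W) \<circ>\<^sub>g C_map (simp_middle_swap X Y Z W) \<circ>\<^sub>g shuffle_map (X \<otimes>\<^sub>\<Delta> Y) (Z \<otimes>\<^sub>\<Delta> W)"

private abbreviation (input) via_AW :: "nat \<Rightarrow> _" where
  "via_AW \<equiv> cx_tensor_map (C (X \<otimes>\<^sub>\<Delta> Z)) (C (Y \<otimes>\<^sub>\<Delta> W)) (shuffle_map X Z) (shuffle_map Y W) \<circ>\<^sub>g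
     cx_middle_swap (C X) (C Y) (C Z) (C W) \<circ>\<^sub>g
     cx_tensor_map (C X \<otimes>\<^sub>C C Y) (C Z \<otimes>\<^sub>C C W) (AW X Y) (AW Z W)"

private lemma comm_K: "comm_group (K n)"
  by (intro comm_group_cx_tensor_group ggC)

lemma graded_hom_simp_middle_swap:
  "graded_hom (C ((X \<otimes>\<^sub>\<Delta> Y) \<otimes>\<^sub>\<Delta> (Z \<otimes>\<^sub>\<Delta> W))) (C ((X \<otimes>\<^sub>\<Delta> Z) \<otimes>\<^sub>\<Delta> (Y \<otimes>\<^sub>\<Delta> W)))
    (C_map (simp_middle_swap X Y Z W))"
  by (simp add: graded_hom_def C_map_def simp_middle_swap_def tensor_middle_swap_hom grp)

lemma graded_hom_bialgebra_left:
  "graded_hom (C (X \<otimes>\<^sub>\<Delta> Y) \<otimes>\<^sub>C C (Z \<otimes>\<^sub>\<Delta> W)) (C (X \<otimes>\<^sub>\<Delta> Z) \<otimes>\<^sub>C C (Y \<otimes>\<^sub>\<Delta> W))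
    via_shuffle"
  by (rule graded_hom_comp[OF graded_hom_shuffle_map[OF XY ZW]
      graded_hom_comp[OF graded_hom_simp_middle_swap graded_hom_AW[OF XZ YW]]])

lemma graded_hom_bialgebra_right:
  "graded_hom (C (X \<otimes>\<^sub>\<Delta> Y) \<otimes>\<^sub>C C (Z \<otimes>\<^sub>\<Delta> W)) (C (X \<otimes>\<^sub>\<Delta> Z) \<otimes>\<^sub>C C (Y \<otimes>\<^sub>\<Delta> W))
    via_AW"
  by (rule graded_hom_comp graded_hom_cx_tensor_map graded_hom_cx_middle_swap graded_hom_AW graded_hom_shuffle_map
      graded_group_cx_tensor ggC X Y Z W)+

section \<open>Expansion of both composites and matching of their summands\<close>

context
  fixes k l n :: nat and x y z w
  assumes n: "k + l = n"
    and x: "x \<in> carrier (sgroup X k)" and y: "y \<in> carrier (sgroup Y k)"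
    and z: "z \<in> carrier (sgroup Z l)" and w: "w \<in> carrier (sgroup W l)"
begin

private abbreviation (input) "xyzw \<equiv> cx_tensor_elt (C (X \<otimes>\<^sub>\<Delta> Y)) (C (Z \<otimes>\<^sub>\<Delta> W)) k l
       (tensor_elt (sgroup X k) (sgroup Y k) x y) (tensor_elt (sgroup Z l) (sgroup W l) z w)"

private abbreviation (input) "face_elt \<alpha> \<beta> p q \<equiv> elt p q
  (tensor_elt (sgroup X p) (sgroup Z p) (last_faces X n q (degen_set X k \<beta> x)) (last_faces Z n q (degen_set Z l \<alpha> z)))
  (tensor_elt (sgroup Y q) (sgroup W q) (first_faces Y n p (degen_set Y k \<beta> y)) (first_faces W n p (degen_set W l \<alpha> w)))"

private definition left_term where
  "left_term \<alpha> \<beta> p q =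
     face_elt \<alpha> \<beta> p q
       [^]\<^bsub>K n\<^esub> sign (shuffle_perm \<alpha> \<beta>)"

text \<open>The exponent collects the two shuffle signs and the Koszul sign for interchanging the
  back face of \<open>y\<close> with the front face of \<open>z\<close>.\<close>

private definition right_term where
  "right_term k1 k2 l1 l2 \<alpha>1 \<beta>1 \<alpha>2 \<beta>2 =
     elt (k1 + l1) (k2 + l2)
       (tensor_elt (sgroup X (k1 + l1)) (sgroup Z (k1 + l1))
         (degen_set X k1 \<beta>1 (last_faces X k k2 x)) (degen_set Z l1 \<alpha>1 (last_faces Z l l2 z)))
       (tensor_elt (sgroup Y (k2 + l2)) (sgroup W (k2 + l2))
         (degen_set Y k2 \<beta>2 (first_faces Y k k1 y)) (degen_set W l2 \<alpha>2 (first_faces W l l1 w)))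
       [^]\<^bsub>K n\<^esub> (sign (shuffle_perm \<alpha>1 \<beta>1) * sign (shuffle_perm \<alpha>2 \<beta>2) * (- 1) ^ (k2 * l1))"

private lemma degen_closed:
  assumes "(\<alpha>, \<beta>) \<in> shuffles k l"
  shows "degen_set X k \<beta> x \<in> carrier (sgroup X n)" "degen_set Y k \<beta> y \<in> carrier (sgroup Y n)"
    "degen_set Z l \<alpha> z \<in> carrier (sgroup Z n)" "degen_set W l \<alpha> w \<in> carrier (sgroup W n)"
  using degen_set_shuffle_hom[OF X Z assms] degen_set_shuffle_hom[OF Y W assms] x y z w n
  by (auto intro: hom_in_carrier)

private lemma left_elt_closed:
  assumes "(\<alpha>, \<beta>) \<in> shuffles k l" "p + q = n"
  shows "face_elt \<alpha> \<beta> p q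
     \<in> carrier (K n)"
  using degen_closed[OF assms(1)] assms(2)
  by (intro cx_tensor_elt_closed ggC)
    (simp_all add: tensor_elt_closed last_faces_closed[OF X X] last_faces_closed[OF Z Z]
      first_faces_closed[OF Y Y] first_faces_closed[OF W W])

private lemma left_term_closed:
  "(\<alpha>, \<beta>) \<in> shuffles k l \<Longrightarrow> p + q = n \<Longrightarrow> left_term \<alpha> \<beta> p q \<in> carrier (K n)"
  unfolding left_term_def by (intro group.int_pow_closed group_of_comm[OF comm_K] left_elt_closed)

text \<open>The heart of the identity, as an equality of single summands. The sign lemma matches the
  exponents; the face lemmas match the entries, with last faces on \<open>x\<close>,
  \<open>z\<close> and first faces on \<open>y\<close>, \<open>w\<close>.\<close>

private lemma left_term_join:
  assumes s: "(((k1, k2), (l1, l2)), ((\<alpha>1, \<beta>1), (\<alpha>2, \<beta>2))) \<in> shuffle_splittings k l"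
  shows "left_term (shift_union (k1 + l1) \<alpha>1 \<alpha>2) (shift_union (k1 + l1) \<beta>1 \<beta>2) (k1 + l1) (k2 + l2) =
    right_term k1 k2 l1 l2 \<alpha>1 \<beta>1 \<alpha>2 \<beta>2"
proof -
  have kl: "k = k1 + k2" "l = l1 + l2" and s1: "(\<alpha>1, \<beta>1) \<in> shuffles k1 l1" and s2: "(\<alpha>2, \<beta>2) \<in> shuffles k2 l2"
    using s by (auto simp: shuffle_splittings_def)
  note d1 = shufflesD[OF s1] and d2 = shufflesD[OF s2]
  \<comment> \<open>The face lemmas write the cut as a degree plus a number of degeneracies:
    \<open>k1 + card \<beta>1\<close> for \<open>x\<close> and \<open>y\<close>, but
    \<open>l1 + card \<alpha>1\<close> for \<open>z\<close> and \<open>w\<close>.\<close>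
  have n1: "n = k1 + l1 + (k2 + l2)" and n2: "n = l1 + k1 + (l2 + k2)" using n kl by simp_all
  have "sign (shuffle_perm (shift_union (k1 + l1) \<alpha>1 \<alpha>2) (shift_union (k1 + l1) \<beta>1 \<beta>2)) =
      sign (shuffle_perm \<alpha>1 \<beta>1) * sign (shuffle_perm \<alpha>2 \<beta>2) * (- 1) ^ (k2 * l1)"
    using sign_shuffle_perm_shift_union[OF d1(5,8) d2(5,8)] d1(7) d2(6) by (simp add: mult.commute)
  moreover have "last_faces X n (k2 + l2) (degen_set X k (shift_union (k1 + l1) \<beta>1 \<beta>2) x) =
      degen_set X k1 \<beta>1 (last_faces X k k2 x)"
    using X.last_faces_degen_set[of \<beta>2 k2 \<beta>1 k1 x] d1 d2 x by (simp add: kl n1)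
  moreover have "last_faces Z n (k2 + l2) (degen_set Z l (shift_union (k1 + l1) \<alpha>1 \<alpha>2) z) =
      degen_set Z l1 \<alpha>1 (last_faces Z l l2 z)"
    using Z.last_faces_degen_set[of \<alpha>2 l2 \<alpha>1 l1 z] d1 d2 z by (simp add: kl n2 add.commute)
  moreover have "first_faces Y n (k1 + l1) (degen_set Y k (shift_union (k1 + l1) \<beta>1 \<beta>2) y) =
      degen_set Y k2 \<beta>2 (first_faces Y k k1 y)"
    using Y.first_faces_degen_set[of \<beta>2 k2 \<beta>1 k1 y] d1 d2 y by (simp add: kl n1)
  moreover have "first_faces W n (k1 + l1) (degen_set W l (shift_union (k1 + l1) \<alpha>1 \<alpha>2) w) =
      degen_set W l2 \<alpha>2 (first_faces W l l1 w)"
    using W.first_faces_degen_set[of \<alpha>2 l2 \<alpha>1 l1 w] d1 d2 w by (simp add: kl n2 add.commute)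
  ultimately show ?thesis
    unfolding left_term_def right_term_def by simp
qed

private lemma bialgebra_left_elt:
  "via_shuffle n xyzw =
   finprod (K n) (\<lambda>((\<alpha>, \<beta>), (p, q)). left_term \<alpha> \<beta> p q) (shuffles k l \<times> degree_pairs n)"
proof -
  let ?XY = "tensor_group (sgroup X n) (sgroup Y n)" and ?ZW = "tensor_group (sgroup Z n) (sgroup W n)"
  let ?T = "tensor_group ?XY ?ZW"
  let ?f = "\<lambda>t. AW (X \<otimes>\<^sub>\<Delta> Z) (Y \<otimes>\<^sub>\<Delta> W) n (simp_middle_swap X Y Z W n t)"
  let ?t = "\<lambda>\<alpha> \<beta>. tensor_elt ?XY ?ZW
    (tensor_elt (sgroup X n) (sgroup Y n) (degen_set X k \<beta> x) (degen_set Y k \<beta> y))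
    (tensor_elt (sgroup Z n) (sgroup W n) (degen_set Z l \<alpha> z) (degen_set W l \<alpha> w))"
  interpret K: comm_group "K n" by (rule comm_K)
  have T: "comm_group ?T" by (intro comm_group_tensor_group grp group_of_comm[OF comm_group_tensor_group])
  have f: "?f \<in> hom ?T (K n)"
    using hom_o[OF graded_homD[OF graded_hom_simp_middle_swap] graded_homD[OF graded_hom_AW[OF XZ YW]], of n]
    by (simp add: C_map_def)
  have t: "?t \<alpha> \<beta> \<in> carrier ?T" if "(\<alpha>, \<beta>) \<in> shuffles k l" for \<alpha> \<beta>
    using degen_closed[OF that] by (simp add: tensor_elt_closed)
  have tp: "?t \<alpha> \<beta> [^]\<^bsub>?T\<^esub> (m::int) \<in> carrier ?T" if "(\<alpha>, \<beta>) \<in> shuffles k l" for \<alpha> \<beta> m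
    by (rule group.int_pow_closed[OF group_of_comm[OF T] t[OF that]])
  \<comment> \<open>Degeneracies of a levelwise tensor act on both factors, so \<open>x\<close> and
    \<open>y\<close> receive the same \<open>\<beta>\<close>, and \<open>z\<close> and
    \<open>w\<close> the same \<open>\<alpha>\<close>.\<close>
  have sh: "shuffle_map (X \<otimes>\<^sub>\<Delta> Y) (Z \<otimes>\<^sub>\<Delta> W) n xyzw =
    finprod ?T (\<lambda>(\<alpha>, \<beta>). ?t \<alpha> \<beta> [^]\<^bsub>?T\<^esub> sign (shuffle_perm \<alpha> \<beta>)) (shuffles k l)"
  proof -
    have "shuffle_map (X \<otimes>\<^sub>\<Delta> Y) (Z \<otimes>\<^sub>\<Delta> W) n xyzw =
      finprod ?T (\<lambda>(\<alpha>, \<beta>). tensor_elt ?XY ?ZW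
        (degen_set (X \<otimes>\<^sub>\<Delta> Y) k \<beta> (tensor_elt (sgroup X k) (sgroup Y k) x y))
        (degen_set (Z \<otimes>\<^sub>\<Delta> W) l \<alpha> (tensor_elt (sgroup Z l) (sgroup W l) z w))
          [^]\<^bsub>?T\<^esub> sign (shuffle_perm \<alpha> \<beta>)) (shuffles k l)"
      using x y z w by (subst shuffle_map_elt[OF XY ZW n]) (simp_all add: tensor_elt_closed)
    also have "\<dots> = finprod ?T (\<lambda>(\<alpha>, \<beta>). ?t \<alpha> \<beta> [^]\<^bsub>?T\<^esub> sign (shuffle_perm \<alpha> \<beta>)) (shuffles k l)"
    proof (rule comm_monoid.finprod_cong'[OF comm_group.axioms(1)[OF T] refl])
      fix u assume "u \<in> shuffles k l"
      then obtain \<alpha> \<beta> where u: "u = (\<alpha>, \<beta>)" and s: "(\<alpha>, \<beta>) \<in> shuffles k l" by (cases u) auto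
      note d = shufflesD[OF s]
      show "(case u of (\<alpha>, \<beta>) \<Rightarrow> tensor_elt ?XY ?ZW
        (degen_set (X \<otimes>\<^sub>\<Delta> Y) k \<beta> (tensor_elt (sgroup X k) (sgroup Y k) x y))
        (degen_set (Z \<otimes>\<^sub>\<Delta> W) l \<alpha> (tensor_elt (sgroup Z l) (sgroup W l) z w))
          [^]\<^bsub>?T\<^esub> sign (shuffle_perm \<alpha> \<beta>)) = (case u of (\<alpha>, \<beta>) \<Rightarrow> ?t \<alpha> \<beta> [^]\<^bsub>?T\<^esub> sign (shuffle_perm \<alpha> \<beta>))"
        using degen_set_simp_tensor_elt[OF X Y d(2) _ x y] degen_set_simp_tensor_elt[OF Z W d(1) _ z w] d n
        by (simp add: u add.commute)
    qed (use tp in auto)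
    finally show ?thesis .
  qed
  \<comment> \<open>After regrouping, \<open>AW\<close> takes front faces of the pair
    \<open>x\<close>, \<open>z\<close> and back faces of the pair \<open>y\<close>,
    \<open>w\<close>. The shuffle sign is an exponent and passes through the homomorphism
    \<open>?f\<close>.\<close>
  have ft: "?f (?t \<alpha> \<beta> [^]\<^bsub>?T\<^esub> sign (shuffle_perm \<alpha> \<beta>)) = finprod (K n) (\<lambda>(p, q). left_term \<alpha> \<beta> p q) (degree_pairs n)"
    if s: "(\<alpha>, \<beta>) \<in> shuffles k l" for \<alpha> \<beta>
  proof -
    let ?XZ = "tensor_elt (sgroup X n) (sgroup Z n) (degen_set X k \<beta> x) (degen_set Z l \<alpha> z)" and ?YW = "tensor_elt (sgroup Y n) (sgroup W n) (degen_set Y k \<beta> y) (degen_set W l \<alpha> w)"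
    note cl = degen_closed[OF s]
    have "?f (?t \<alpha> \<beta>) = AW (X \<otimes>\<^sub>\<Delta> Z) (Y \<otimes>\<^sub>\<Delta> W) n (tensor_elt (sgroup (X \<otimes>\<^sub>\<Delta> Z) n) (sgroup (Y \<otimes>\<^sub>\<Delta> W) n)
      ?XZ
      ?YW)"
      using cl by (simp add: simp_middle_swap_def tensor_middle_swap_elt grp)
    also have "\<dots> = finprod (K n) (\<lambda>(p, q). elt p q
       (last_faces (X \<otimes>\<^sub>\<Delta> Z) n q ?XZ) (first_faces (Y \<otimes>\<^sub>\<Delta> W) n p ?YW))
      (degree_pairs n)"
      using cl by (intro AW_elt[OF XZ YW]) (simp_all add: tensor_elt_closed)
    also have "\<dots> = finprod (K n) (\<lambda>(p, q). face_elt \<alpha> \<beta> p q)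
      (degree_pairs n)"
    proof (rule K.finprod_cong'[OF refl])
      fix u assume "u \<in> degree_pairs n"
      then obtain p q where u: "u = (p, q)" and pq: "p + q = n" by (cases u) auto
      then have "q \<le> n" "p \<le> n" "n - q = p" "n - p = q" by auto
      then show "(case u of (p, q) \<Rightarrow> elt p q
       (last_faces (X \<otimes>\<^sub>\<Delta> Z) n q ?XZ) (first_faces (Y \<otimes>\<^sub>\<Delta> W) n p ?YW)) =
        (case u of (p, q) \<Rightarrow> face_elt \<alpha> \<beta> p q)"
        using last_faces_simp_tensor_elt[OF X Z _ cl(1,3), of q] first_faces_simp_tensor_elt[OF Y W _ cl(2,4), of p]
        by (simp add: u)
    qed (use left_elt_closed[OF s] in auto)
    finally have *: "?f (?t \<alpha> \<beta>) = \<dots>" .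
    have "?f (?t \<alpha> \<beta> [^]\<^bsub>?T\<^esub> sign (shuffle_perm \<alpha> \<beta>)) = ?f (?t \<alpha> \<beta>) [^]\<^bsub>K n\<^esub> sign (shuffle_perm \<alpha> \<beta>)"
      by (rule hom_int_pow[OF f t[OF s] group_of_comm[OF T] group_of_comm[OF comm_K]])
    also have "\<dots> = finprod (K n) (\<lambda>(p, q). left_term \<alpha> \<beta> p q) (degree_pairs n)"
      unfolding * using left_elt_closed[OF s]
      by (subst finprod_int_pow[OF comm_K]) (auto simp: left_term_def case_prod_unfold)
    finally show ?thesis .
  qed
  have "via_shuffle n xyzw =
    ?f (finprod ?T (\<lambda>(\<alpha>, \<beta>). ?t \<alpha> \<beta> [^]\<^bsub>?T\<^esub> sign (shuffle_perm \<alpha> \<beta>)) (shuffles k l))"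
    by (simp add: graded_comp_def C_map_def sh)
  also have "\<dots> = finprod (K n) (\<lambda>u. ?f (case u of (\<alpha>, \<beta>) \<Rightarrow> ?t \<alpha> \<beta> [^]\<^bsub>?T\<^esub> sign (shuffle_perm \<alpha> \<beta>))) (shuffles k l)"
    using tp by (intro hom_finprod_eq[OF f T comm_K]) auto
  also have "\<dots> = finprod (K n) (\<lambda>u. finprod (K n) (\<lambda>v. case (u, v) of ((\<alpha>, \<beta>), (p, q)) \<Rightarrow> left_term \<alpha> \<beta> p q) (degree_pairs n)) (shuffles k l)"
    using ft left_term_closed by (intro K.finprod_cong') (auto intro!: K.finprod_closed)
  also have "\<dots> = finprod (K n) (\<lambda>((\<alpha>, \<beta>), (p, q)). left_term \<alpha> \<beta> p q) (shuffles k l \<times> degree_pairs n)"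
    using left_term_closed
    by (subst finprod_Sigma[OF comm_K]) (auto simp: case_prod_unfold)
  finally show ?thesis .
qed

private lemma bialgebra_right_elt:
  "via_AW n xyzw =
   finprod (K n) (\<lambda>(((k1, k2), (l1, l2)), ((\<alpha>1, \<beta>1), (\<alpha>2, \<beta>2))). right_term k1 k2 l1 l2 \<alpha>1 \<beta>1 \<alpha>2 \<beta>2)
     (shuffle_splittings k l)"
proof -
  let ?L = "cx_tensor_group (C X \<otimes>\<^sub>C C Y) (C Z \<otimes>\<^sub>C C W) n"
  let ?f = "\<lambda>t. cx_tensor_map (C (X \<otimes>\<^sub>\<Delta> Z)) (C (Y \<otimes>\<^sub>\<Delta> W)) (shuffle_map X Z) (shuffle_map Y W) n
     (cx_middle_swap (C X) (C Y) (C Z) (C W) n t)"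
  let ?u = "\<lambda>k1 k2. cx_tensor_elt (C X) (C Y) k1 k2 (last_faces X k k2 x) (first_faces Y k k1 y)"
  let ?v = "\<lambda>l1 l2. cx_tensor_elt (C Z) (C W) l1 l2 (last_faces Z l l2 z) (first_faces W l l1 w)"
  let ?e = "\<lambda>k1 k2 l1 l2. cx_tensor_elt (C X \<otimes>\<^sub>C C Y) (C Z \<otimes>\<^sub>C C W) k l (?u k1 k2) (?v l1 l2)"
  interpret K: comm_group "K n" by (rule comm_K)
  note gg = ggC graded_group_cx_tensor
  have L: "comm_group ?L" by (intro comm_group_cx_tensor_group gg)
  have f1: "cx_tensor_map (C (X \<otimes>\<^sub>\<Delta> Z)) (C (Y \<otimes>\<^sub>\<Delta> W)) (shuffle_map X Z) (shuffle_map Y W) n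
      \<in> hom (cx_tensor_group (C X \<otimes>\<^sub>C C Z) (C Y \<otimes>\<^sub>C C W) n) (K n)"
    using graded_homD[OF graded_hom_cx_tensor_map[OF graded_group_cx_tensor graded_group_cx_tensor _ _
      graded_hom_shuffle_map[OF X Z] graded_hom_shuffle_map[OF Y W]], of n] ggC by simp
  have f: "?f \<in> hom ?L (K n)"
    using hom_o[OF graded_homD[OF graded_hom_cx_middle_swap[OF ggC(1-4)], of n, unfolded cgroup_cx_tensor] f1] .
  have fc: "last_faces X k k2 x \<in> carrier (sgroup X k1)" "first_faces Y k k1 y \<in> carrier (sgroup Y k2)" if "k1 + k2 = k" for k1 k2
    using last_faces_closed[OF X X that x] first_faces_closed[OF Y Y that y] .
  have fc': "last_faces Z l l2 z \<in> carrier (sgroup Z l1)" "first_faces W l l1 w \<in> carrier (sgroup W l2)" if "l1 + l2 = l" for l1 l2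
    using last_faces_closed[OF Z Z that z] first_faces_closed[OF W W that w] .
  have u: "?u k1 k2 \<in> carrier (cx_tensor_group (C X) (C Y) k)" if "k1 + k2 = k" for k1 k2
    using fc[OF that] that by (intro cx_tensor_elt_closed ggC) auto
  have v: "?v l1 l2 \<in> carrier (cx_tensor_group (C Z) (C W) l)" if "l1 + l2 = l" for l1 l2
    using fc'[OF that] that by (intro cx_tensor_elt_closed ggC) auto
  have e: "?e k1 k2 l1 l2 \<in> carrier ?L" if "k1 + k2 = k" "l1 + l2 = l" for k1 k2 l1 l2
    using u v that n by (intro cx_tensor_elt_closed gg) auto
  have 1: "cx_tensor_map (C X \<otimes>\<^sub>C C Y) (C Z \<otimes>\<^sub>C C W) (AW X Y) (AW Z W) n
     xyzw =
    finprod ?L (\<lambda>((k1, k2), (l1, l2)). ?e k1 k2 l1 l2) (degree_pairs k \<times> degree_pairs l)"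
  proof -
    have "cx_tensor_map (C X \<otimes>\<^sub>C C Y) (C Z \<otimes>\<^sub>C C W) (AW X Y) (AW Z W) n
     xyzw =
      cx_tensor_elt (C X \<otimes>\<^sub>C C Y) (C Z \<otimes>\<^sub>C C W) k l
        (finprod (cx_tensor_group (C X) (C Y) k) (\<lambda>(k1, k2). ?u k1 k2) (degree_pairs k))
        (finprod (cx_tensor_group (C Z) (C W) l) (\<lambda>(l1, l2). ?v l1 l2) (degree_pairs l))"
      using x y z w n
      by (subst cx_tensor_map_elt[OF ggC(7,8) _ _ graded_hom_AW[OF X Y] graded_hom_AW[OF Z W] n])
        (simp_all add: gg tensor_elt_closed AW_elt[OF X Y] AW_elt[OF Z W])
    also have "\<dots> = finprod ?L (\<lambda>(i, j). cx_tensor_elt (C X \<otimes>\<^sub>C C Y) (C Z \<otimes>\<^sub>C C W) k l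
        (case i of (k1, k2) \<Rightarrow> ?u k1 k2) (case j of (l1, l2) \<Rightarrow> ?v l1 l2)) (degree_pairs k \<times> degree_pairs l)"
      using u v
      by (intro biadditive_finprod_finprod[OF cx_tensor_elt_biadditive[OF gg(9) gg(9) n, unfolded cgroup_cx_tensor]]
        comm_group_cx_tensor_group gg) auto
    finally show ?thesis by (simp add: case_prod_unfold)
  qed
  have fe: "?f (?e k1 k2 l1 l2) = finprod (K n) (\<lambda>((\<alpha>1, \<beta>1), (\<alpha>2, \<beta>2)). right_term k1 k2 l1 l2 \<alpha>1 \<beta>1 \<alpha>2 \<beta>2)
      (shuffles k1 l1 \<times> shuffles k2 l2)"
    "\<And>\<alpha>1 \<beta>1 \<alpha>2 \<beta>2. (\<alpha>1, \<beta>1) \<in> shuffles k1 l1 \<Longrightarrow> (\<alpha>2, \<beta>2) \<in> shuffles k2 l2 \<Longrightarrow>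
      right_term k1 k2 l1 l2 \<alpha>1 \<beta>1 \<alpha>2 \<beta>2 \<in> carrier (K n)"
    if kl: "k1 + k2 = k" "l1 + l2 = l" for k1 k2 l1 l2
  proof -
    let ?XZ = "tensor_group (sgroup X (k1 + l1)) (sgroup Z (k1 + l1))"
    let ?YW = "tensor_group (sgroup Y (k2 + l2)) (sgroup W (k2 + l2))"
    let ?s = "\<lambda>\<alpha>1 \<beta>1. tensor_elt (sgroup X (k1 + l1)) (sgroup Z (k1 + l1))
         (degen_set X k1 \<beta>1 (last_faces X k k2 x)) (degen_set Z l1 \<alpha>1 (last_faces Z l l2 z))"
    let ?t = "\<lambda>\<alpha>2 \<beta>2. tensor_elt (sgroup Y (k2 + l2)) (sgroup W (k2 + l2))
         (degen_set Y k2 \<beta>2 (first_faces Y k k1 y)) (degen_set W l2 \<alpha>2 (first_faces W l l1 w))"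
    let ?m = "cx_tensor_elt (C X \<otimes>\<^sub>C C Z) (C Y \<otimes>\<^sub>C C W) (k1 + l1) (k2 + l2)
      (cx_tensor_elt (C X) (C Z) k1 l1 (last_faces X k k2 x) (last_faces Z l l2 z))
      (cx_tensor_elt (C Y) (C W) k2 l2 (first_faces Y k k1 y) (first_faces W l l1 w))"
    let ?E = "elt (k1 + l1) (k2 + l2)"
    note c = fc[OF kl(1)] fc'[OF kl(2)]
    have n': "k1 + l1 + (k2 + l2) = n" using n kl by simp
    have XZ_comm: "comm_group ?XZ" and YW_comm: "comm_group ?YW"
      by (intro comm_group_tensor_group grp)+
    have s: "?s \<alpha>1 \<beta>1 \<in> carrier ?XZ" if "(\<alpha>1, \<beta>1) \<in> shuffles k1 l1" for \<alpha>1 \<beta>1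
      using degen_set_shuffle_hom[OF X Z that, THEN hom_in_carrier] c by (simp add: tensor_elt_closed)
    have t: "?t \<alpha>2 \<beta>2 \<in> carrier ?YW" if "(\<alpha>2, \<beta>2) \<in> shuffles k2 l2" for \<alpha>2 \<beta>2
      using degen_set_shuffle_hom[OF Y W that, THEN hom_in_carrier] c by (simp add: tensor_elt_closed)
    have sp: "?s \<alpha>1 \<beta>1 [^]\<^bsub>?XZ\<^esub> (i::int) \<in> carrier ?XZ" if "(\<alpha>1, \<beta>1) \<in> shuffles k1 l1" for \<alpha>1 \<beta>1 i
      by (rule group.int_pow_closed[OF group_of_comm[OF XZ_comm] s[OF that]])
    have tp: "?t \<alpha>2 \<beta>2 [^]\<^bsub>?YW\<^esub> (i::int) \<in> carrier ?YW" if "(\<alpha>2, \<beta>2) \<in> shuffles k2 l2" for \<alpha>2 \<beta>2 i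
      by (rule group.int_pow_closed[OF group_of_comm[OF YW_comm] t[OF that]])
    have bi: "biadditive ?XZ ?YW (K n) ?E"
      using cx_tensor_elt_biadditive[OF ggC(5,6) n'] by simp
    have E: "?E (?s \<alpha>1 \<beta>1) (?t \<alpha>2 \<beta>2) \<in> carrier (K n)"
      if "(\<alpha>1, \<beta>1) \<in> shuffles k1 l1" "(\<alpha>2, \<beta>2) \<in> shuffles k2 l2" for \<alpha>1 \<beta>1 \<alpha>2 \<beta>2
      by (rule biadditive_closed[OF bi s[OF that(1)] t[OF that(2)]])
    show r: "right_term k1 k2 l1 l2 \<alpha>1 \<beta>1 \<alpha>2 \<beta>2 \<in> carrier (K n)"
      if "(\<alpha>1, \<beta>1) \<in> shuffles k1 l1" "(\<alpha>2, \<beta>2) \<in> shuffles k2 l2" for \<alpha>1 \<beta>1 \<alpha>2 \<beta>2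
      unfolding right_term_def by (rule K.int_pow_closed[OF E[OF that]])
    have m1: "cx_tensor_elt (C X) (C Z) k1 l1 (last_faces X k k2 x) (last_faces Z l l2 z)
        \<in> carrier (cx_tensor_group (C X) (C Z) (k1 + l1))"
      and m2: "cx_tensor_elt (C Y) (C W) k2 l2 (first_faces Y k k1 y) (first_faces W l l1 w)
        \<in> carrier (cx_tensor_group (C Y) (C W) (k2 + l2))"
      using c by (auto intro!: cx_tensor_elt_closed ggC)
    have m: "?m \<in> carrier (cx_tensor_group (C X \<otimes>\<^sub>C C Z) (C Y \<otimes>\<^sub>C C W) n)"
      using m1 m2 n' by (intro cx_tensor_elt_closed gg) auto
    \<comment> \<open>The interchanged middle factors are the back face of \<open>y\<close>, of
      degree \<open>k2\<close>, and the front face of \<open>z\<close>, of degree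
      \<open>l1\<close>.\<close>
    have ms: "cx_middle_swap (C X) (C Y) (C Z) (C W) n (?e k1 k2 l1 l2) =
        ?m [^]\<^bsub>cx_tensor_group (C X \<otimes>\<^sub>C C Z) (C Y \<otimes>\<^sub>C C W) n\<^esub> ((- 1) ^ (k2 * l1) :: int)"
      using cx_middle_swap_elt[OF ggC(1-4), of k1 k2 l1 l2 n, unfolded cgroup_C, OF _ c(1,2,3,4)] n kl by simp
    have "?f (?e k1 k2 l1 l2) = cx_tensor_map (C (X \<otimes>\<^sub>\<Delta> Z)) (C (Y \<otimes>\<^sub>\<Delta> W)) (shuffle_map X Z) (shuffle_map Y W) n ?m
        [^]\<^bsub>K n\<^esub> ((- 1) ^ (k2 * l1) :: int)"
      unfolding ms by (rule hom_int_pow[OF f1 m]) (intro group_of_comm comm_group_cx_tensor_group gg)+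
    also have "cx_tensor_map (C (X \<otimes>\<^sub>\<Delta> Z)) (C (Y \<otimes>\<^sub>\<Delta> W)) (shuffle_map X Z) (shuffle_map Y W) n ?m =
        ?E (finprod ?XZ (\<lambda>(\<alpha>, \<beta>). ?s \<alpha> \<beta> [^]\<^bsub>?XZ\<^esub> sign (shuffle_perm \<alpha> \<beta>)) (shuffles k1 l1))
           (finprod ?YW (\<lambda>(\<alpha>, \<beta>). ?t \<alpha> \<beta> [^]\<^bsub>?YW\<^esub> sign (shuffle_perm \<alpha> \<beta>)) (shuffles k2 l2))"
      using m1 m2 c
      by (subst cx_tensor_map_elt[OF _ _ ggC(5,6) graded_hom_shuffle_map[OF X Z] graded_hom_shuffle_map[OF Y W] n'])
        (simp_all add: gg shuffle_map_elt[OF X Z] shuffle_map_elt[OF Y W])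
    also have "\<dots> = finprod (K n) (\<lambda>(i, j). ?E (case i of (\<alpha>, \<beta>) \<Rightarrow> ?s \<alpha> \<beta> [^]\<^bsub>?XZ\<^esub> sign (shuffle_perm \<alpha> \<beta>))
        (case j of (\<alpha>, \<beta>) \<Rightarrow> ?t \<alpha> \<beta> [^]\<^bsub>?YW\<^esub> sign (shuffle_perm \<alpha> \<beta>))) (shuffles k1 l1 \<times> shuffles k2 l2)"
      using sp tp by (intro biadditive_finprod_finprod[OF bi XZ_comm YW_comm comm_K]) auto
    also have "\<dots> = finprod (K n) (\<lambda>((\<alpha>1, \<beta>1), (\<alpha>2, \<beta>2)). ?E (?s \<alpha>1 \<beta>1) (?t \<alpha>2 \<beta>2)
        [^]\<^bsub>K n\<^esub> (sign (shuffle_perm \<alpha>1 \<beta>1) * sign (shuffle_perm \<alpha>2 \<beta>2))) (shuffles k1 l1 \<times> shuffles k2 l2)"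
      using E biadditive_int_pow_int_pow[OF bi group_of_comm[OF XZ_comm] group_of_comm[OF YW_comm] group_of_comm[OF comm_K] s t]
      by (intro K.finprod_cong') (auto intro!: K.int_pow_closed)
    also have "\<dots> [^]\<^bsub>K n\<^esub> ((- 1) ^ (k2 * l1) :: int) =
      finprod (K n) (\<lambda>u. (\<lambda>((\<alpha>1, \<beta>1), (\<alpha>2, \<beta>2)). ?E (?s \<alpha>1 \<beta>1) (?t \<alpha>2 \<beta>2)
        [^]\<^bsub>K n\<^esub> (sign (shuffle_perm \<alpha>1 \<beta>1) * sign (shuffle_perm \<alpha>2 \<beta>2))) u [^]\<^bsub>K n\<^esub> ((- 1) ^ (k2 * l1) :: int)) (shuffles k1 l1 \<times> shuffles k2 l2)"
      using E by (intro finprod_int_pow[OF comm_K]) (auto intro!: K.int_pow_closed)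
    also have "\<dots> = finprod (K n) (\<lambda>((\<alpha>1, \<beta>1), (\<alpha>2, \<beta>2)). right_term k1 k2 l1 l2 \<alpha>1 \<beta>1 \<alpha>2 \<beta>2) (shuffles k1 l1 \<times> shuffles k2 l2)"
      using E r by (intro K.finprod_cong') (auto simp: right_term_def K.int_pow_pow)
    finally show "?f (?e k1 k2 l1 l2) = finprod (K n) (\<lambda>((\<alpha>1, \<beta>1), (\<alpha>2, \<beta>2)). right_term k1 k2 l1 l2 \<alpha>1 \<beta>1 \<alpha>2 \<beta>2)
      (shuffles k1 l1 \<times> shuffles k2 l2)" .
  qed
  have "?f (finprod ?L (\<lambda>((k1, k2), (l1, l2)). ?e k1 k2 l1 l2) (degree_pairs k \<times> degree_pairs l)) =
    finprod (K n) (\<lambda>i. ?f ((\<lambda>((k1, k2), (l1, l2)). ?e k1 k2 l1 l2) i)) (degree_pairs k \<times> degree_pairs l)"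
    using e by (intro hom_finprod_eq[OF f L comm_K]) auto
  also have "\<dots> = finprod (K n) (\<lambda>i. finprod (K n)
      (\<lambda>j. (\<lambda>(((k1, k2), (l1, l2)), ((\<alpha>1, \<beta>1), (\<alpha>2, \<beta>2))). right_term k1 k2 l1 l2 \<alpha>1 \<beta>1 \<alpha>2 \<beta>2) (i, j))
      (case i of ((k1, k2), (l1, l2)) \<Rightarrow> shuffles k1 l1 \<times> shuffles k2 l2)) (degree_pairs k \<times> degree_pairs l)"
    using fe by (intro K.finprod_cong') (auto intro!: K.finprod_closed)
  also have "\<dots> = finprod (K n) (\<lambda>(((k1, k2), (l1, l2)), ((\<alpha>1, \<beta>1), (\<alpha>2, \<beta>2))). right_term k1 k2 l1 l2 \<alpha>1 \<beta>1 \<alpha>2 \<beta>2)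
     (shuffle_splittings k l)"
    unfolding shuffle_splittings_def using fe(2)
    by (subst finprod_Sigma[OF comm_K]) (auto simp: case_prod_unfold)
  finally show ?thesis
    by (simp add: graded_comp_def 1)
qed

text \<open>The first sum is reindexed along the bijection \<open>shuffle_join\<close>, after which
  \<open>left_term_join\<close> identifies the summands.\<close>

lemma bialgebra_elt:
  "via_shuffle n xyzw =
   via_AW n xyzw"
proof -
  interpret K: comm_group "K n" by (rule comm_K)
  have "finprod (K n) (\<lambda>((\<alpha>, \<beta>), (p, q)). left_term \<alpha> \<beta> p q) (shuffles k l \<times> degree_pairs n) =
    finprod (K n) (\<lambda>u. (\<lambda>((\<alpha>, \<beta>), (p, q)). left_term \<alpha> \<beta> p q) (shuffle_join u)) (shuffle_splittings k l)"
    unfolding n[symmetric] shuffle_join_image[symmetric] unfolding n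
    by (rule K.finprod_reindex[OF _ inj_on_shuffle_join])
      (use left_term_closed in \<open>auto simp: shuffle_join_image n\<close>)
  also have "\<dots> = finprod (K n) (\<lambda>(((k1, k2), (l1, l2)), ((\<alpha>1, \<beta>1), (\<alpha>2, \<beta>2))). right_term k1 k2 l1 l2 \<alpha>1 \<beta>1 \<alpha>2 \<beta>2)
     (shuffle_splittings k l)"
  proof (rule K.finprod_cong'[OF refl])
    fix u assume u: "u \<in> shuffle_splittings k l"
    obtain k1 k2 l1 l2 \<alpha>1 \<beta>1 \<alpha>2 \<beta>2 where u': "u = (((k1, k2), (l1, l2)), ((\<alpha>1, \<beta>1), (\<alpha>2, \<beta>2)))"
      using prod.collapse by metis
    show "(\<lambda>((\<alpha>, \<beta>), (p, q)). left_term \<alpha> \<beta> p q) (shuffle_join u) =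
      (\<lambda>(((k1, k2), (l1, l2)), ((\<alpha>1, \<beta>1), (\<alpha>2, \<beta>2))). right_term k1 k2 l1 l2 \<alpha>1 \<beta>1 \<alpha>2 \<beta>2) u"
      using left_term_join[OF u[unfolded u']] by (simp add: u')
  next
    \<comment> \<open>Membership of the summands on the right is inherited from those on the left
      through \<open>left_term_join\<close>.\<close>
    show "(\<lambda>(((k1, k2), (l1, l2)), ((\<alpha>1, \<beta>1), (\<alpha>2, \<beta>2))). right_term k1 k2 l1 l2 \<alpha>1 \<beta>1 \<alpha>2 \<beta>2)
       \<in> shuffle_splittings k l \<rightarrow> carrier (K n)"
    proof
      fix u assume u: "u \<in> shuffle_splittings k l"
      obtain k1 k2 l1 l2 \<alpha>1 \<beta>1 \<alpha>2 \<beta>2 where u': "u = (((k1, k2), (l1, l2)), ((\<alpha>1, \<beta>1), (\<alpha>2, \<beta>2)))"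
        using prod.collapse by metis
      have "shuffle_join u \<in> shuffles k l \<times> degree_pairs n"
        using imageI[OF u, of shuffle_join] unfolding shuffle_join_image n .
      then show "(\<lambda>(((k1, k2), (l1, l2)), ((\<alpha>1, \<beta>1), (\<alpha>2, \<beta>2))). right_term k1 k2 l1 l2 \<alpha>1 \<beta>1 \<alpha>2 \<beta>2) u
         \<in> carrier (K n)"
        using left_term_closed[of "shift_union (k1 + l1) \<alpha>1 \<alpha>2" "shift_union (k1 + l1) \<beta>1 \<beta>2" "k1 + l1" "k2 + l2"]
          left_term_join[OF u[unfolded u']] by (simp add: u')
    qed
  qed
  finally show ?thesis
    unfolding bialgebra_left_elt bialgebra_right_elt .
qed

end

text \<open>The inner tensor products are levelwise, so \<open>x\<close>, \<open>y\<close> share the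
  degree \<open>k\<close> and \<open>z\<close>, \<open>w\<close> the degree \<open>l\<close>. Hence
  the reduction to \<open>bialgebra_elt\<close> uses \<open>cx_tensor_hom_eqI\<close> once and
  \<open>tensor_hom_eqI\<close> for each of the two inner factors.\<close>

theorem bialgebra_C:
  assumes u: "u \<in> carrier (cgroup (C (X \<otimes>\<^sub>\<Delta> Y) \<otimes>\<^sub>C C (Z \<otimes>\<^sub>\<Delta> W)) n)"
  shows "via_shuffle n u = via_AW n u" (is "?\<phi> u = ?\<psi> u")
proof -
  have \<phi>: "?\<phi> \<in> hom (cx_tensor_group (C (X \<otimes>\<^sub>\<Delta> Y)) (C (Z \<otimes>\<^sub>\<Delta> W)) n) (K n)"
    using graded_homD[OF graded_hom_bialgebra_left, of n] by simp
  have \<psi>: "?\<psi> \<in> hom (cx_tensor_group (C (X \<otimes>\<^sub>\<Delta> Y)) (C (Z \<otimes>\<^sub>\<Delta> W)) n) (K n)"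
    using graded_homD[OF graded_hom_bialgebra_right, of n] by simp
  show ?thesis
  proof (rule cx_tensor_hom_eqI[OF ggC(7,8) comm_K \<phi> \<psi> _ u[unfolded cgroup_cx_tensor]])
    fix k l s t assume kl: "k + l = n" and s: "s \<in> carrier (cgroup (C (X \<otimes>\<^sub>\<Delta> Y)) k)"
      and t: "t \<in> carrier (cgroup (C (Z \<otimes>\<^sub>\<Delta> W)) l)"
    let ?E = "cx_tensor_elt (C (X \<otimes>\<^sub>\<Delta> Y)) (C (Z \<otimes>\<^sub>\<Delta> W)) k l"
    note bi = cx_tensor_elt_biadditive[OF ggC(7,8) kl]
    have *: "?\<phi> (?E s (tensor_elt (sgroup Z l) (sgroup W l) z w)) = ?\<psi> (?E s (tensor_elt (sgroup Z l) (sgroup W l) z w))"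
      if zw: "z \<in> carrier (sgroup Z l)" "w \<in> carrier (sgroup W l)" for z w
    proof -
      have t: "tensor_elt (sgroup Z l) (sgroup W l) z w \<in> carrier (cgroup (C (Z \<otimes>\<^sub>\<Delta> W)) l)"
        using zw by (simp add: tensor_elt_closed)
      note h = biadditiveD2[OF bi t, unfolded cgroup_C sgroup_simp_tensor]
      show ?thesis
        by (rule tensor_hom_eqI[OF X.group_sgroup Y.group_sgroup group_of_comm[OF comm_K] hom_o[OF h \<phi>] hom_o[OF h \<psi>]])
          (use s bialgebra_elt[OF kl _ _ zw] in auto)
    qed
    note h = biadditiveD1[OF bi s, unfolded cgroup_C sgroup_simp_tensor]
    show "?\<phi> (?E s t) = ?\<psi> (?E s t)"
      by (rule tensor_hom_eqI[OF Z.group_sgroup W.group_sgroup group_of_comm[OF comm_K] hom_o[OF h \<phi>] hom_o[OF h \<psi>]])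
        (use t * in auto)
  qed
qed

end

section \<open>Descent to normalized chains\<close>

lemma subgroup_finprod_closed:
  assumes "comm_group G" "subgroup H G" "\<And>i. i \<in> I \<Longrightarrow> f i \<in> H"
  shows "finprod G f I \<in> H"
proof -
  interpret G: comm_group G by fact
  interpret H: subgroup H G by fact
  show ?thesis using assms(3)
  proof (induction I rule: infinite_finite_induct)
    case (insert i I)
    then show ?case by (subst G.finprod_insert) (auto intro: H.m_closed H.mem_carrier)
  qed auto
qed

text \<open>Constancy of \<open>p' \<circ> f\<close> on the fibre of \<open>p\<close> through
  \<open>x\<close> makes the set inside \<open>the_elem\<close> a singleton.\<close>

lemma induced_map_eq:
  assumes "x \<in> S" "\<And>y. y \<in> S \<Longrightarrow> p y = p x \<Longrightarrow> p' (f y) = p' (f x)"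
  shows "induced_map S p p' f (p x) = p' (f x)"
proof -
  have "(\<lambda>x. p' (f x)) ` {y \<in> S. p y = p x} = {p' (f x)}"
    using assms(1) by (auto dest: assms(2))
  then show ?thesis by (simp add: induced_map_def)
qed

text \<open>Surjectivity of \<open>p\<close> lets every product in \<open>G'\<close> be computed on
  preimages. This turns the commuting squares of the induced maps into a proof that these are
  homomorphisms.\<close>

lemma hom_factorI:
  assumes "group G" and p: "p \<in> hom G G'" "p ` carrier G = carrier G'" and q: "q \<in> hom G H"
    and F: "\<And>x. x \<in> carrier G \<Longrightarrow> F (p x) = q x"
  shows "F \<in> hom G' H"
proof (rule homI)
  interpret G: group G by fact
  fix s assume "s \<in> carrier G'"
  then obtain x where x: "x \<in> carrier G" "s = p x" using p(2) by blast
  then show "F s \<in> carrier H" using F hom_in_carrier[OF q] by simp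
  fix t assume "t \<in> carrier G'"
  then obtain y where y: "y \<in> carrier G" "t = p y" using p(2) by blast
  have "F (s \<otimes>\<^bsub>G'\<^esub> t) = F (p (x \<otimes>\<^bsub>G\<^esub> y))"
    using x y hom_mult[OF p(1)] by simp
  then show "F (s \<otimes>\<^bsub>G'\<^esub> t) = F s \<otimes>\<^bsub>H\<^esub> F t"
    using F x y hom_mult[OF q] by simp
qed

text \<open>Compare the projection onto the cokernel with the trivial map.\<close>

lemma surj_if_epi:
  assumes H: "comm_group H" and f: "f \<in> hom G H" and G: "group G"
    and triv: "\<And>\<phi> \<psi> u. \<phi> \<in> hom H (H Mod f ` carrier G) \<Longrightarrow> \<psi> \<in> hom H (H Mod f ` carrier G) \<Longrightarrow>
      (\<And>x. x \<in> f ` carrier G \<Longrightarrow> \<phi> x = \<psi> x) \<Longrightarrow> comm_group (H Mod f ` carrier G) \<Longrightarrow>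
      u \<in> carrier H \<Longrightarrow> \<phi> u = \<psi> u"
  shows "f ` carrier G = carrier H"
proof
  interpret H: comm_group H by fact
  interpret f: group_hom G H f using G f by (simp add: group_hom_def group_hom_axioms_def)
  let ?I = "f ` carrier G"
  have I: "subgroup ?I H" by (rule f.img_is_subgroup)
  interpret I: normal ?I H using I by (rule H.subgroup_imp_normal)
  have Q: "comm_group (H Mod ?I)" using I by (rule H.abelian_FactGroup)
  show "?I \<subseteq> carrier H" by auto
  show "carrier H \<subseteq> ?I"
  proof
    fix u assume u: "u \<in> carrier H"
    have "?I #>\<^bsub>H\<^esub> u = \<one>\<^bsub>H Mod ?I\<^esub>"
    proof (rule triv[OF I.r_coset_hom_Mod hom_oneI[OF H.is_group Q] _ Q u])
      fix x assume "x \<in> ?I"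
      then show "?I #>\<^bsub>H\<^esub> x = \<one>\<^bsub>H Mod ?I\<^esub>"
        using H.coset_join2[OF _ I, of x] I.mem_carrier by simp
    qed
    then have "?I #>\<^bsub>H\<^esub> u = ?I" by simp
    then show "u \<in> ?I" using H.rcos_self[OF u I] by simp
  qed
qed

section \<open>Degenerate chains and the projection onto \<open>N\<close>\<close>

context simplicial_abelian_group
begin

lemma degenerate_closed: "degenerate A n \<subseteq> carrier (sgroup A n)"
  by (cases n) (auto intro: degen_closed)

lemma degen_in_degenerate:
  "i \<le> n \<Longrightarrow> x \<in> carrier (sgroup A n) \<Longrightarrow> degen A n i x \<in> degenerate A (Suc n)"
  by auto

lemma subgroup_generate_degenerate: "subgroup (generate (sgroup A n) (degenerate A n)) (sgroup A n)"
  by (rule group.generate_is_subgroup[OF group_sgroup degenerate_closed])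

text \<open>Both \<open>d_i s_i\<close> and \<open>d_(i+1) s_i\<close> are the identity and occur
  with opposite signs, so they cancel. Every other face of \<open>s_i x\<close> is again
  degenerate.\<close>

lemma cdiff_degenerate:
  assumes "s \<in> degenerate A (Suc n)"
  shows "cdiff (C A) n s \<in> generate (sgroup A n) (degenerate A n)" (is "_ \<in> ?D")
proof -
  interpret G: comm_group "sgroup A n" by (rule comm_group)
  interpret D: subgroup ?D "sgroup A n" by (rule subgroup_generate_degenerate)
  obtain i x where i: "i \<le> n" and x: "x \<in> carrier (sgroup A n)" and s: "s = degen A n i x"
    using assms by auto
  define t where "t j = face A (Suc n) j s [^]\<^bsub>sgroup A n\<^esub> ((- 1) ^ j :: int)" for j
  have sc: "s \<in> carrier (sgroup A (Suc n))" using i x s by (simp add: degen_closed)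
  have tc: "t j \<in> carrier (sgroup A n)" if "j \<le> Suc n" for j
    unfolding t_def using face_closed[OF that sc] by (rule G.int_pow_closed)
  let ?R = "{..Suc n} - {i, Suc i}"
  have tD: "t j \<in> ?D" if j: "j \<in> ?R" for j
  proof -
    obtain m where m: "n = Suc m" using j i by (cases n) auto
    have "face A (Suc n) j s \<in> degenerate A n"
    proof (cases "j < i")
      case True
      then have "face A (Suc n) j s = degen A m (i - 1) (face A n j x)"
        using i x by (simp add: s m face_degen_less)
      then show ?thesis using True i x face_closed[of j m x]
        by (auto simp: m simp del: degenerate.simps intro!: degen_in_degenerate)
    next
      case False
      then have j: "Suc i < j" "j \<le> Suc n" using j by auto
      then have "face A (Suc n) j s = degen A m i (face A n (j - 1) x)"
        using i x by (simp add: s m face_degen_greater)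
      then show ?thesis using j i x face_closed[of "j - 1" m x]
        by (auto simp: m simp del: degenerate.simps intro!: degen_in_degenerate)
    qed
    then have "face A (Suc n) j s \<in> ?D" by (rule generate.incl)
    then show ?thesis unfolding t_def
      by (rule group.subgroup_int_pow_closed[OF group_sgroup subgroup_generate_degenerate])
  qed
  have P: "finprod (sgroup A n) t ?R \<in> ?D"
    by (rule subgroup_finprod_closed[OF comm_group subgroup_generate_degenerate tD])
  have "{..Suc n} = insert i (insert (Suc i) ?R)" using i by auto
  then have "cdiff (C A) n s = finprod (sgroup A n) t (insert i (insert (Suc i) ?R))"
    by (simp add: C_def t_def[abs_def])
  also have "\<dots> = t i \<otimes>\<^bsub>sgroup A n\<^esub> (t (Suc i) \<otimes>\<^bsub>sgroup A n\<^esub> finprod (sgroup A n) t ?R)"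
    using i tc by (subst G.finprod_insert; (subst G.finprod_insert)?) auto
  also have "\<dots> = (t i \<otimes>\<^bsub>sgroup A n\<^esub> t (Suc i)) \<otimes>\<^bsub>sgroup A n\<^esub> finprod (sgroup A n) t ?R"
    using i tc P by (simp add: G.m_assoc)
  also have "t i \<otimes>\<^bsub>sgroup A n\<^esub> t (Suc i) = \<one>\<^bsub>sgroup A n\<^esub>"
    using i x by (simp add: t_def s face_degen_eq G.int_pow_mult[symmetric])
  finally show ?thesis using P by simp
qed

text \<open>Boundaries of degenerate simplices already lie in the span of the degenerate ones, so
  the generated subcomplex is that span.\<close>

lemma generated_subcomplex_degenerate:
  "generated_subcomplex (C A) (degenerate A) n = generate (sgroup A n) (degenerate A n)"
proof
  show "generated_subcomplex (C A) (degenerate A) n \<subseteq> generate (sgroup A n) (degenerate A n)"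
    unfolding generated_subcomplex_def cgroup_C
    by (rule group.generate_subgroup_incl[OF group_sgroup _ subgroup_generate_degenerate])
      (auto intro: generate.incl cdiff_degenerate simp del: degenerate.simps)
  show "generate (sgroup A n) (degenerate A n) \<subseteq> generated_subcomplex (C A) (degenerate A) n"
    unfolding generated_subcomplex_def cgroup_C
    by (rule group.mono_generate[OF group_sgroup]) auto
qed

lemma cgroup_N: "cgroup (N A) n = sgroup A n Mod generate (sgroup A n) (degenerate A n)"
  by (simp add: N_def quotient_complex_def generated_subcomplex_degenerate)

lemma N_proj_eq: "N_proj A n x = generate (sgroup A n) (degenerate A n) #>\<^bsub>sgroup A n\<^esub> x"
  by (simp add: N_proj_def quotient_proj_def generated_subcomplex_degenerate)

lemma graded_group_N: "graded_group (N A)"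
  by (simp add: graded_group_def cgroup_N comm_group.abelian_FactGroup[OF comm_group subgroup_generate_degenerate])

lemma normal_generate_degenerate: "generate (sgroup A n) (degenerate A n) \<lhd> sgroup A n"
  by (rule comm_group.subgroup_imp_normal[OF comm_group subgroup_generate_degenerate])

lemma graded_hom_N_proj: "graded_hom (C A) (N A) (N_proj A)"
  using normal.r_coset_hom_Mod[OF normal_generate_degenerate]
  by (simp add: graded_hom_def cgroup_N N_proj_eq[abs_def])

lemma N_proj_hom: "N_proj A n \<in> hom (sgroup A n) (cgroup (N A) n)"
  using graded_homD[OF graded_hom_N_proj] by simp

lemma N_proj_image: "N_proj A n ` carrier (sgroup A n) = carrier (cgroup (N A) n)"
  by (auto simp: cgroup_N N_proj_eq carrier_FactGroup)

lemma N_proj_degenerate: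
  assumes "x \<in> degenerate A n"
  shows "N_proj A n x = \<one>\<^bsub>cgroup (N A) n\<^esub>"
  using group.coset_join2[OF group_sgroup _ subgroup_generate_degenerate generate.incl[OF assms]] assms degenerate_closed
  by (auto simp: cgroup_N N_proj_eq)

text \<open>The universal property of the quotient, in the form that \<open>induced_map_eq\<close>
  asks for: a homomorphism that kills the generators has the whole span in its kernel.\<close>

lemma N_proj_eqD:
  assumes f: "f \<in> hom (sgroup A n) K" and K: "group K"
    and kill: "\<And>x. x \<in> degenerate A n \<Longrightarrow> f x = \<one>\<^bsub>K\<^esub>"
    and x: "x \<in> carrier (sgroup A n)" and y: "y \<in> carrier (sgroup A n)" and eq: "N_proj A n x = N_proj A n y"
  shows "f x = f y"
proof -
  let ?D = "generate (sgroup A n) (degenerate A n)"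
  interpret f: group_hom "sgroup A n" K f
    using f K group_sgroup by (simp add: group_hom_def group_hom_axioms_def)
  have "?D \<subseteq> kernel (sgroup A n) K f"
    using kill degenerate_closed by (intro f.G.generate_subgroup_incl f.subgroup_kernel) (auto simp: kernel_def)
  moreover have "x \<in> ?D #>\<^bsub>sgroup A n\<^esub> y"
    using f.G.rcos_self[OF x subgroup_generate_degenerate] eq by (simp add: N_proj_eq)
  then obtain d where "d \<in> ?D" "x = d \<otimes>\<^bsub>sgroup A n\<^esub> y" by (auto simp: r_coset_def)
  ultimately show ?thesis using y by (auto simp: kernel_def)
qed

text \<open>Any index \<open>j\<close> of \<open>T\<close> can be brought outermost: a larger index
  \<open>m\<close> passes it by \<open>s_m s_j = s_j s_(m-1)\<close>.\<close>

lemma degen_set_mem: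
  assumes "finite T" "T \<subseteq> {..<n + card T}" "j \<in> T" "x \<in> carrier (sgroup A n)"
  shows "\<exists>y\<in>carrier (sgroup A (n + card T - 1)). degen_set A n T x = degen A (n + card T - 1) j y"
  using assms
proof (induction T rule: finite_linorder_max_induct)
  case (insert m T)
  note s = subset_lessThan_of_insert[OF insert.prems(1) insert.hyps(1,2)[rule_format]]
  have e: "degen_set A n (insert m T) x = degen A (n + card T) m (degen_set A n T x)"
    using insert.hyps by (simp add: degen_set_insert_greater)
  show ?case
  proof (cases "j = m")
    case True
    then show ?thesis using e s(3) hom_in_carrier[OF degen_set_hom[OF insert.hyps(1) s(1)] insert.prems(3)] by auto
  next
    case False
    then have jT: "j \<in> T" using insert.prems by auto
    then have jm: "j < m" using insert.hyps by auto
    obtain y where y: "y \<in> carrier (sgroup A (n + card T - 1))" "degen_set A n T x = degen A (n + card T - 1) j y"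
      using insert.IH[OF s(1) jT insert.prems(3)] by auto
    obtain N where N: "n + card T = Suc N" using jm s(2) by (cases "n + card T") auto
    have "degen A (Suc N) m (degen A N j y) = degen A (Suc N) j (degen A N (m - 1) y)"
      using degen_degen[of j "m - 1" N y] jm s(2) y N by simp
    then show ?thesis using e y N s(2,3) jm degen_closed[of "m - 1" N y] by auto
  qed
qed simp

text \<open>
  \<open>S\<^sub>T s\<^sub>i\<close> is an iterated degeneracy with one index more than \<open>S\<^sub>T\<close>. For a shuffle \<open>(\<alpha>, \<beta>)\<close> and \<open>T = \<beta>\<close> the new
  index lies in \<open>\<alpha>\<close>, so that \<open>S\<^sub>\<beta> s\<^sub>i a \<otimes> S\<^sub>\<alpha> b\<close> is degenerate.
\<close>

lemma degen_set_degen: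
  assumes "finite T" "T \<subseteq> {..<Suc n + card T}" "i \<le> n" "x \<in> carrier (sgroup A n)"
  shows "\<exists>j<Suc n + card T. j \<notin> T \<and> (\<exists>y\<in>carrier (sgroup A (n + card T)).
    degen_set A (Suc n) T (degen A n i x) = degen A (n + card T) j y)"
  using assms
proof (induction T rule: finite_linorder_max_induct)
  case empty
  then show ?case by (intro exI[of _ i]) auto
next
  case (insert m T)
  note s = subset_lessThan_of_insert[OF insert.prems(1) insert.hyps(1,2)[rule_format]]
  have e: "degen_set A (Suc n) (insert m T) z = degen A (Suc n + card T) m (degen_set A (Suc n) T z)" for z
    using insert.hyps by (simp add: degen_set_insert_greater)
  obtain j y where j: "j < Suc n + card T" "j \<notin> T" and y: "y \<in> carrier (sgroup A (n + card T))"
      "degen_set A (Suc n) T (degen A n i x) = degen A (n + card T) j y"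
    using insert.IH[OF s(1) insert.prems(2,3)] by auto
  show ?case
  \<comment> \<open>If \<open>j < m\<close>, then \<open>s_m s_j = s_j s_(m-1)\<close> keeps the
    extra index \<open>j\<close>. Otherwise \<open>s_m s_j = s_(j+1) s_m\<close>, and the extra
    index becomes \<open>j + 1\<close>, which exceeds every element of
    \<open>insert m T\<close>.\<close>
  proof (cases "j < m")
    case True
    have "degen A (Suc (n + card T)) m (degen A (n + card T) j y) =
        degen A (Suc (n + card T)) j (degen A (n + card T) (m - 1) y)"
      using degen_degen[of j "m - 1" "n + card T" y] True s(2) y by simp
    then show ?thesis
      using e y(2) s True j degen_closed[of "m - 1" "n + card T" y] y(1)
      by (intro exI[of _ j]) auto
  next
    case False
    have "degen A (Suc (n + card T)) m (degen A (n + card T) j y) =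
        degen A (Suc (n + card T)) (Suc j) (degen A (n + card T) m y)"
      using degen_degen[of m j "n + card T" y] False j y by simp
    moreover have "Suc j \<notin> insert m T" using insert.hyps(2) False by auto
    ultimately show ?thesis
      using e y(2) s False j degen_closed[of m "n + card T" y] y(1)
      by (intro exI[of _ "Suc j"]) auto
  qed
qed

end

section \<open>Descent of the Alexander--Whitney and shuffle maps\<close>

context
  fixes A :: "'a simplicial" and B :: "'b simplicial"
  assumes A: "simplicial_abelian_group A" and B: "simplicial_abelian_group B"
begin

interpretation A: simplicial_abelian_group A by (rule A)
interpretation B: simplicial_abelian_group B by (rule B)
interpretation AB: simplicial_abelian_group "A \<otimes>\<^sub>\<Delta> B" using A B by (rule simplicial_abelian_group_tensor)

private lemmas gg = graded_group_C[OF A] graded_group_C[OF B] A.graded_group_N B.graded_group_N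

lemma graded_hom_N_tensor_proj: "graded_hom (C A \<otimes>\<^sub>C C B) (N A \<otimes>\<^sub>C N B) (N_tensor_proj A B)"
  unfolding N_tensor_proj_def by (intro graded_hom_cx_tensor_map gg A.graded_hom_N_proj B.graded_hom_N_proj)

private lemmas N_tensor_proj_hom = graded_homD[OF graded_hom_N_tensor_proj, unfolded cgroup_cx_tensor]

lemma N_tensor_proj_elt:
  assumes "p + q = n" "a \<in> carrier (sgroup A p)" "b \<in> carrier (sgroup B q)"
  shows "N_tensor_proj A B n (cx_tensor_elt (C A) (C B) p q a b) =
    cx_tensor_elt (N A) (N B) p q (N_proj A p a) (N_proj B q b)"
  unfolding N_tensor_proj_def using assms
  by (intro cx_tensor_map_elt gg A.graded_hom_N_proj B.graded_hom_N_proj) auto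

text \<open>Elementary tensors lift factor by factor. Testing surjectivity by homomorphisms into the
  cokernel lets \<open>cx_tensor_hom_eqI\<close> express that they generate.\<close>

lemma N_tensor_proj_image:
  "N_tensor_proj A B n ` carrier (cx_tensor_group (C A) (C B) n) = carrier (cx_tensor_group (N A) (N B) n)"
proof (rule surj_if_epi[OF comm_group_cx_tensor_group[OF gg(3,4)] N_tensor_proj_hom
    group_of_comm[OF comm_group_cx_tensor_group[OF gg(1,2)]]])
  let ?I = "N_tensor_proj A B n ` carrier (cx_tensor_group (C A) (C B) n)"
  let ?Q = "cx_tensor_group (N A) (N B) n Mod ?I"
  fix \<phi> \<psi> u assume h: "\<phi> \<in> hom (cx_tensor_group (N A) (N B) n) ?Q" "\<psi> \<in> hom (cx_tensor_group (N A) (N B) n) ?Q"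
    and eq: "\<And>x. x \<in> ?I \<Longrightarrow> \<phi> x = \<psi> x" and Q: "comm_group ?Q" and u: "u \<in> carrier (cx_tensor_group (N A) (N B) n)"
  show "\<phi> u = \<psi> u"
  proof (rule cx_tensor_hom_eqI[OF gg(3,4) Q h _ u])
    fix p q s t assume pq: "p + q = n" and s: "s \<in> carrier (cgroup (N A) p)" and t: "t \<in> carrier (cgroup (N B) q)"
    obtain a b where a: "a \<in> carrier (sgroup A p)" "s = N_proj A p a" and b: "b \<in> carrier (sgroup B q)" "t = N_proj B q b"
      using s t unfolding A.N_proj_image[symmetric] B.N_proj_image[symmetric] by blast
    have "cx_tensor_elt (N A) (N B) p q s t \<in> ?I"
      using N_tensor_proj_elt[OF pq a(1) b(1)] a b pq
        imageI[OF cx_tensor_elt_closed[OF gg(1,2) pq, of a b], of "N_tensor_proj A B n"] by simp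
    then show "\<phi> (cx_tensor_elt (N A) (N B) p q s t) = \<psi> (cx_tensor_elt (N A) (N B) p q s t)"
      by (rule eq)
  qed
qed

text \<open>In the summand of \<open>AW\<close> with cut \<open>(p, q)\<close>, the front face of
  \<open>s_i a\<close> is degenerate if \<open>i < p\<close>, and the back face of
  \<open>s_i b\<close> is degenerate otherwise. So every summand has a factor that vanishes in
  \<open>N\<close>.\<close>

lemma N_tensor_proj_AW_degenerate:
  assumes "s \<in> degenerate (A \<otimes>\<^sub>\<Delta> B) n"
  shows "N_tensor_proj A B n (AW A B n s) = \<one>\<^bsub>cx_tensor_group (N A) (N B) n\<^esub>"
proof -
  obtain m where n: "n = Suc m" using assms by (cases n) auto
  let ?K = "cx_tensor_group (N A) (N B) n"
  interpret K: comm_group ?K by (rule comm_group_cx_tensor_group[OF gg(3,4)])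
  obtain i t where i: "i \<le> m" and t: "t \<in> carrier (sgroup (A \<otimes>\<^sub>\<Delta> B) m)" and s: "s = degen (A \<otimes>\<^sub>\<Delta> B) m i t"
    using assms n by auto
  \<comment> \<open>A degenerate simplex is \<open>s_i t\<close> with \<open>t\<close> an arbitrary
    element of the tensor product. Additivity in \<open>t\<close> reduces the claim to elementary
    \<open>t\<close>.\<close>
  have h: "(\<lambda>t. N_tensor_proj A B n (AW A B n (degen (A \<otimes>\<^sub>\<Delta> B) m i t))) \<in> hom (sgroup (A \<otimes>\<^sub>\<Delta> B) m) ?K"
    using hom_o[OF hom_o[OF AB.degen_hom[OF i] graded_homD[OF graded_hom_AW[OF A B], of "Suc m", unfolded cgroup_C]]
      graded_homD[OF graded_hom_N_tensor_proj]] n by simp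
  have "N_tensor_proj A B n (AW A B n (degen (A \<otimes>\<^sub>\<Delta> B) m i t)) = \<one>\<^bsub>?K\<^esub>"
  proof (rule tensor_hom_eqI[OF A.group_sgroup B.group_sgroup K.is_group h[unfolded sgroup_simp_tensor] hom_oneI _ t[unfolded sgroup_simp_tensor]])
    show "group (tensor_group (sgroup A m) (sgroup B m))" using AB.group_sgroup[of m] by simp
    show "comm_group ?K" by (rule K.comm_group_axioms)
    fix a b assume a: "a \<in> carrier (sgroup A m)" and b: "b \<in> carrier (sgroup B m)"
    let ?a = "degen A m i a" and ?b = "degen B m i b"
    have ab: "?a \<in> carrier (sgroup A n)" "?b \<in> carrier (sgroup B n)"
      using A.degen_closed[OF i a] B.degen_closed[OF i b] n by auto
    have e: "AW A B n (degen (A \<otimes>\<^sub>\<Delta> B) m i (tensor_elt (sgroup A m) (sgroup B m) a b)) =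
      finprod (cx_tensor_group (C A) (C B) n)
      (\<lambda>(p, q). cx_tensor_elt (C A) (C B) p q (last_faces A n q ?a) (first_faces B n p ?b)) (degree_pairs n)"
      using degen_simp_tensor_elt[OF A B i a b] AW_elt[OF A B ab] n by simp
    have cl: "last_faces A n q ?a \<in> carrier (sgroup A p)" "first_faces B n p ?b \<in> carrier (sgroup B q)"
      if "p + q = n" for p q
      using that ab by (auto intro: last_faces_closed[OF A A] first_faces_closed[OF B B])
    have 1: "N_tensor_proj A B n (cx_tensor_elt (C A) (C B) p q (last_faces A n q ?a) (first_faces B n p ?b)) = \<one>\<^bsub>?K\<^esub>"
      if pq: "p + q = n" for p q
    proof -
      note bi = cx_tensor_elt_biadditive[OF gg(3,4) pq]
      note c = hom_in_carrier[OF A.N_proj_hom cl(1)[OF pq]] hom_in_carrier[OF B.N_proj_hom cl(2)[OF pq]]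
      show ?thesis
      proof (cases "i < p")
        case True
        then obtain p' where p': "p = Suc p'" by (cases p) auto
        have "last_faces A n q ?a = degen A p' i (last_faces A m q a)"
          using A.last_faces_degen_less[of p q m i a] pq n p' True a by simp
        then have "last_faces A n q ?a \<in> degenerate A p"
          using True p' last_faces_closed[OF A A, of p' q m a] a pq n
          by (auto simp del: degenerate.simps intro!: A.degen_in_degenerate)
        then have "N_proj A p (last_faces A n q ?a) = \<one>\<^bsub>cgroup (N A) p\<^esub>"
          by (rule A.N_proj_degenerate)
        then show ?thesis
          using hom_one[OF biadditiveD2[OF bi c(2)]] gg by (simp add: N_tensor_proj_elt[OF pq cl[OF pq]] graded_groupD' K.is_group)
      next
        case False
        have q': "q = Suc (m - p)" using False pq n i by simp
        have "first_faces B n p ?b = degen B (m - p) (i - p) (first_faces B m p b)"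
          using B.first_faces_degen_ge[of p i m b] False i b n by simp
        then have "first_faces B n p ?b \<in> degenerate B q"
          unfolding q' using False i first_faces_closed[OF B B, of p "m - p" m b] b
          by (auto simp del: degenerate.simps intro!: B.degen_in_degenerate)
        then have "N_proj B q (first_faces B n p ?b) = \<one>\<^bsub>cgroup (N B) q\<^esub>"
          by (rule B.N_proj_degenerate)
        then show ?thesis
          using hom_one[OF biadditiveD1[OF bi c(1)]] gg by (simp add: N_tensor_proj_elt[OF pq cl[OF pq]] graded_groupD' K.is_group)
      qed
    qed
    show "N_tensor_proj A B n (AW A B n (degen (A \<otimes>\<^sub>\<Delta> B) m i (tensor_elt (sgroup A m) (sgroup B m) a b))) = \<one>\<^bsub>?K\<^esub>"
      unfolding e using cl 1
      by (subst hom_finprod_eq[OF N_tensor_proj_hom comm_group_cx_tensor_group[OF gg(1,2)] K.comm_group_axioms])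
        (auto intro!: cx_tensor_elt_closed gg K.finprod_one_eqI)
  qed
  then show ?thesis using s by simp
qed

lemma AW_N_proj:
  assumes "s \<in> carrier (sgroup (A \<otimes>\<^sub>\<Delta> B) n)"
  shows "AW_N A B n (N_proj (A \<otimes>\<^sub>\<Delta> B) n s) = N_tensor_proj A B n (AW A B n s)"
  unfolding AW_N_def cgroup_C
  using hom_o[OF graded_homD[OF graded_hom_AW[OF A B], unfolded cgroup_C] graded_homD[OF graded_hom_N_tensor_proj], of n]
    N_tensor_proj_AW_degenerate comm_group_cx_tensor_group[OF gg(3,4)] assms
  by (intro induced_map_eq AB.N_proj_eqD[where f = "\<lambda>s. N_tensor_proj A B n (AW A B n s)"]) (auto intro: group_of_comm)

lemma graded_hom_AW_N: "graded_hom (N (A \<otimes>\<^sub>\<Delta> B)) (N A \<otimes>\<^sub>C N B) (AW_N A B)"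
  unfolding graded_hom_def
proof
  fix n
  show "AW_N A B n \<in> hom (cgroup (N (A \<otimes>\<^sub>\<Delta> B)) n) (cgroup (N A \<otimes>\<^sub>C N B) n)"
    by (rule hom_factorI[where q = "\<lambda>s. N_tensor_proj A B n (AW A B n s)",
        OF AB.group_sgroup AB.N_proj_hom AB.N_proj_image _ AW_N_proj])
      (rule hom_o[OF graded_homD[OF graded_hom_AW[OF A B], unfolded cgroup_C] graded_homD[OF graded_hom_N_tensor_proj]])
qed

text \<open>A common outer degeneracy \<open>s_j\<close> of both factors makes the levelwise tensor
  degenerate. The degenerate argument supplies an index \<open>j\<close> outside its own set; as
  \<alpha> and \<beta> cover all indices, \<open>j\<close> lies in the other set, and
  \<open>degen_set_mem\<close> brings it outermost there too.\<close>

lemma shuffle_term_degenerate: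
  assumes s: "(\<alpha>, \<beta>) \<in> shuffles k l" and kl: "k + l = n"
    and a: "a \<in> carrier (sgroup A k)" and b: "b \<in> carrier (sgroup B l)"
    and ab: "a \<in> degenerate A k \<or> b \<in> degenerate B l"
  shows "tensor_elt (sgroup A n) (sgroup B n) (degen_set A k \<beta> a) (degen_set B l \<alpha> b) \<in> degenerate (A \<otimes>\<^sub>\<Delta> B) n"
proof -
  note d = shufflesD[OF s]
  have "\<exists>j<n. (\<exists>x\<in>carrier (sgroup A (n - 1)). degen_set A k \<beta> a = degen A (n - 1) j x) \<and>
      (\<exists>y\<in>carrier (sgroup B (n - 1)). degen_set B l \<alpha> b = degen B (n - 1) j y)"
    using ab
  proof
    assume "a \<in> degenerate A k"
    then obtain m i a' where m: "k = Suc m" and i: "i \<le> m" and a': "a' \<in> carrier (sgroup A m)" "a = degen A m i a'"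
      by (cases k) auto
    obtain j x where j: "j < n" "j \<notin> \<beta>" and x: "x \<in> carrier (sgroup A (n - 1))" "degen_set A k \<beta> a = degen A (n - 1) j x"
      using A.degen_set_degen[OF d(2) _ i a'(1)] d m kl a'(2) by auto
    have "j \<in> \<alpha>" using j d(8) kl by auto
    then show ?thesis
      using B.degen_set_mem[OF d(1) _ _ b, of j] d kl j x by (auto simp: add.commute)
  next
    assume "b \<in> degenerate B l"
    then obtain m i b' where m: "l = Suc m" and i: "i \<le> m" and b': "b' \<in> carrier (sgroup B m)" "b = degen B m i b'"
      by (cases l) auto
    obtain j x where j: "j < n" "j \<notin> \<alpha>" and x: "x \<in> carrier (sgroup B (n - 1))" "degen_set B l \<alpha> b = degen B (n - 1) j x"
      using B.degen_set_degen[OF d(1) _ i b'(1)] d m kl b'(2) by (auto simp: add.commute)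
    have "j \<in> \<beta>" using j d(8) kl by auto
    then show ?thesis
      using A.degen_set_mem[OF d(2) _ _ a, of j] d kl j x by auto
  qed
  then obtain j x y where j: "j < n" and x: "x \<in> carrier (sgroup A (n - 1))" "degen_set A k \<beta> a = degen A (n - 1) j x"
    and y: "y \<in> carrier (sgroup B (n - 1))" "degen_set B l \<alpha> b = degen B (n - 1) j y"
    by blast
  obtain m where m: "n = Suc m" using j by (cases n) auto
  have "tensor_elt (sgroup A n) (sgroup B n) (degen_set A k \<beta> a) (degen_set B l \<alpha> b) =
    degen (A \<otimes>\<^sub>\<Delta> B) m j (tensor_elt (sgroup A m) (sgroup B m) x y)"
    using degen_simp_tensor_elt[OF A B, of j m x y] j x y m by simp
  then show ?thesis
    using j x y m AB.degen_in_degenerate[of j m "tensor_elt (sgroup A m) (sgroup B m) x y"]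
    by (simp add: tensor_elt_closed del: degenerate.simps)
qed

lemma N_proj_shuffle_map_degenerate:
  assumes kl: "k + l = n"
    and a: "a \<in> carrier (sgroup A k)" and b: "b \<in> carrier (sgroup B l)"
    and ab: "a \<in> degenerate A k \<or> b \<in> degenerate B l"
  shows "N_proj (A \<otimes>\<^sub>\<Delta> B) n (shuffle_map A B n (cx_tensor_elt (C A) (C B) k l a b)) = \<one>\<^bsub>cgroup (N (A \<otimes>\<^sub>\<Delta> B)) n\<^esub>"
proof -
  let ?T = "tensor_group (sgroup A n) (sgroup B n)"
  interpret T: comm_group ?T using AB.comm_group[of n] by simp
  interpret K: comm_group "cgroup (N (A \<otimes>\<^sub>\<Delta> B)) n" by (rule graded_groupD[OF AB.graded_group_N])
  have P: "N_proj (A \<otimes>\<^sub>\<Delta> B) n \<in> hom ?T (cgroup (N (A \<otimes>\<^sub>\<Delta> B)) n)" using AB.N_proj_hom[of n] by simp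
  let ?t = "\<lambda>\<alpha> \<beta>. tensor_elt (sgroup A n) (sgroup B n) (degen_set A k \<beta> a) (degen_set B l \<alpha> b)"
  have c: "?t \<alpha> \<beta> \<in> carrier ?T" if "(\<alpha>, \<beta>) \<in> shuffles k l" for \<alpha> \<beta>
    using shuffle_term_degenerate[OF that kl a b ab] AB.degenerate_closed[of n] by auto
  have 1: "N_proj (A \<otimes>\<^sub>\<Delta> B) n (?t \<alpha> \<beta> [^]\<^bsub>?T\<^esub> (z::int)) = \<one>\<^bsub>cgroup (N (A \<otimes>\<^sub>\<Delta> B)) n\<^esub>" if "(\<alpha>, \<beta>) \<in> shuffles k l" for \<alpha> \<beta> z
    using hom_int_pow[OF P c[OF that] T.is_group K.is_group, of z]
      AB.N_proj_degenerate[OF shuffle_term_degenerate[OF that kl a b ab]] by (simp add: K.int_pow_one)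
  show ?thesis
    unfolding shuffle_map_elt[OF A B kl a b] using c 1
    by (subst hom_finprod_eq[OF P T.comm_group_axioms K.comm_group_axioms])
      (auto intro!: T.int_pow_closed K.finprod_one_eqI)
qed

text \<open>Since \<open>\<nabla>\<close> descends in each variable separately, it factors through \<open>N A \<otimes> N B\<close>; this avoids
  computing the kernel of \<open>C A \<otimes> C B \<rightarrow> N A \<otimes> N B\<close>.\<close>

lemma N_proj_shuffle_map_factor:
  obtains L where "L \<in> hom (cx_tensor_group (N A) (N B) n) (cgroup (N (A \<otimes>\<^sub>\<Delta> B)) n)"
    and "\<And>u. u \<in> carrier (cx_tensor_group (C A) (C B) n) \<Longrightarrow>
      L (N_tensor_proj A B n u) = N_proj (A \<otimes>\<^sub>\<Delta> B) n (shuffle_map A B n u)"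
proof -
  let ?K = "cgroup (N (A \<otimes>\<^sub>\<Delta> B)) n"
  interpret K: comm_group ?K by (rule graded_groupD[OF AB.graded_group_N])
  define f where "f k l a b = N_proj (A \<otimes>\<^sub>\<Delta> B) n (shuffle_map A B n (cx_tensor_elt (C A) (C B) k l a b))" for k l a b
  \<comment> \<open>Representatives of classes in \<open>N\<close>, chosen without regard to
    addition; \<open>f_r\<close> shows that \<open>f\<close> is insensitive to the choice.\<close>
  define r r' where "r k s = (SOME a. a \<in> carrier (sgroup A k) \<and> N_proj A k a = s)"
    and "r' l t = (SOME b. b \<in> carrier (sgroup B l) \<and> N_proj B l b = t)" for k s l t
  have P: "(\<lambda>u. N_proj (A \<otimes>\<^sub>\<Delta> B) n (shuffle_map A B n u)) \<in> hom (cx_tensor_group (C A) (C B) n) ?K"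
    using hom_o[OF graded_homD[OF graded_hom_shuffle_map[OF A B], of n] graded_homD[OF AB.graded_hom_N_proj]] by simp
  have bi: "biadditive (sgroup A k) (sgroup B l) ?K (f k l)" if "k + l = n" for k l
    using biadditive_post[OF cx_tensor_elt_biadditive[OF gg(1,2) that] P] unfolding f_def cgroup_C .
  have r: "r k (N_proj A k a) \<in> carrier (sgroup A k)" "N_proj A k (r k (N_proj A k a)) = N_proj A k a"
    if "a \<in> carrier (sgroup A k)" for k a
    using someI[of "\<lambda>x. x \<in> carrier (sgroup A k) \<and> N_proj A k x = N_proj A k a" a] that by (auto simp: r_def)
  have r': "r' l (N_proj B l b) \<in> carrier (sgroup B l)" "N_proj B l (r' l (N_proj B l b)) = N_proj B l b"
    if "b \<in> carrier (sgroup B l)" for l b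
    using someI[of "\<lambda>x. x \<in> carrier (sgroup B l) \<and> N_proj B l x = N_proj B l b" b] that by (auto simp: r'_def)
  \<comment> \<open>One variable is changed at a time: with the other held fixed, \<open>f\<close>
    is a homomorphism that kills degenerate simplices, so it depends only on the class.\<close>
  have f_r: "f k l (r k (N_proj A k a)) (r' l (N_proj B l b)) = f k l a b"
    if kl: "k + l = n" and a: "a \<in> carrier (sgroup A k)" and b: "b \<in> carrier (sgroup B l)" for k l a b
  proof -
    have "f k l (r k (N_proj A k a)) b = f k l a b"
      by (rule A.N_proj_eqD[OF biadditiveD2[OF bi[OF kl] b] K.is_group _ r(1)[OF a] a r(2)[OF a]])
        (use N_proj_shuffle_map_degenerate[OF kl _ b] A.degenerate_closed in \<open>auto simp: f_def\<close>)
    moreover have "f k l (r k (N_proj A k a)) (r' l (N_proj B l b)) = f k l (r k (N_proj A k a)) b"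
      by (rule B.N_proj_eqD[OF biadditiveD1[OF bi[OF kl] r(1)[OF a]] K.is_group _ r'(1)[OF b] b r'(2)[OF b]])
        (use N_proj_shuffle_map_degenerate[OF kl r(1)[OF a]] B.degenerate_closed in \<open>auto simp: f_def\<close>)
    ultimately show ?thesis by simp
  qed
  let ?g = "\<lambda>k l s t. f k l (r k s) (r' l t)"
  \<comment> \<open>By \<open>f_r\<close>, composing \<open>?g\<close> with a projection in one
    variable gives back \<open>f\<close>, whose additivity then transfers along the surjective
    projection.\<close>
  have g: "biadditive (cgroup (N A) k) (cgroup (N B) l) ?K (?g k l)" if kl: "k + l = n" for k l
  proof (rule biadditiveI)
    fix s assume "s \<in> carrier (cgroup (N A) k)"
    then obtain a where a: "a \<in> carrier (sgroup A k)" "s = N_proj A k a" unfolding A.N_proj_image[symmetric] by blast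
    show "?g k l s \<in> hom (cgroup (N B) l) ?K"
      by (rule hom_factorI[OF B.group_sgroup B.N_proj_hom B.N_proj_image biadditiveD1[OF bi[OF kl] a(1)]])
        (use a f_r[OF kl] in auto)
  next
    fix t assume "t \<in> carrier (cgroup (N B) l)"
    then obtain b where b: "b \<in> carrier (sgroup B l)" "t = N_proj B l b" unfolding B.N_proj_image[symmetric] by blast
    show "(\<lambda>s. ?g k l s t) \<in> hom (cgroup (N A) k) ?K"
      by (rule hom_factorI[OF A.group_sgroup A.N_proj_hom A.N_proj_image biadditiveD2[OF bi[OF kl] b(1)]])
        (use b f_r[OF kl] in auto)
  qed
  let ?L = "cx_tensor_lift ?K ?g n"
  have L: "?L \<in> hom (cx_tensor_group (N A) (N B) n) ?K"
    by (rule cx_tensor_lift_hom[OF gg(3,4) K.comm_group_axioms g])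
  have "?L (N_tensor_proj A B n u) = N_proj (A \<otimes>\<^sub>\<Delta> B) n (shuffle_map A B n u)"
    if u: "u \<in> carrier (cx_tensor_group (C A) (C B) n)" for u
  proof (rule cx_tensor_hom_eqI[OF gg(1,2) K.comm_group_axioms hom_o[OF N_tensor_proj_hom L] P _ u])
    fix k l a b assume kl: "k + l = n" and "a \<in> carrier (cgroup (C A) k)" and "b \<in> carrier (cgroup (C B) l)"
    then have a: "a \<in> carrier (sgroup A k)" and b: "b \<in> carrier (sgroup B l)" by simp_all
    have "?L (cx_tensor_elt (N A) (N B) k l (N_proj A k a) (N_proj B l b)) = ?g k l (N_proj A k a) (N_proj B l b)"
      by (rule cx_tensor_lift_elt[OF gg(3,4) K.comm_group_axioms g kl])
        (simp_all add: hom_in_carrier[OF A.N_proj_hom a] hom_in_carrier[OF B.N_proj_hom b])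
    then show "?L (N_tensor_proj A B n (cx_tensor_elt (C A) (C B) k l a b)) =
      N_proj (A \<otimes>\<^sub>\<Delta> B) n (shuffle_map A B n (cx_tensor_elt (C A) (C B) k l a b))"
      unfolding N_tensor_proj_elt[OF kl a b] f_r[OF kl a b] f_def[of k l a b] .
  qed
  with L show ?thesis by (rule that)
qed

lemma shuffle_map_N_proj:
  assumes u: "u \<in> carrier (cx_tensor_group (C A) (C B) n)"
  shows "shuffle_map_N A B n (N_tensor_proj A B n u) = N_proj (A \<otimes>\<^sub>\<Delta> B) n (shuffle_map A B n u)"
proof -
  obtain L where L: "\<And>u. u \<in> carrier (cx_tensor_group (C A) (C B) n) \<Longrightarrow>
      L (N_tensor_proj A B n u) = N_proj (A \<otimes>\<^sub>\<Delta> B) n (shuffle_map A B n u)"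
    using N_proj_shuffle_map_factor by metis
  show ?thesis
    unfolding shuffle_map_N_def cgroup_cx_tensor
  proof (rule induced_map_eq[OF u])
    fix v assume "v \<in> carrier (cx_tensor_group (C A) (C B) n)" "N_tensor_proj A B n v = N_tensor_proj A B n u"
    then show "N_proj (A \<otimes>\<^sub>\<Delta> B) n (shuffle_map A B n v) = N_proj (A \<otimes>\<^sub>\<Delta> B) n (shuffle_map A B n u)"
      using L[OF u] L[of v] by simp
  qed
qed

lemma graded_hom_shuffle_map_N: "graded_hom (N A \<otimes>\<^sub>C N B) (N (A \<otimes>\<^sub>\<Delta> B)) (shuffle_map_N A B)"
  unfolding graded_hom_def cgroup_cx_tensor
proof
  fix n
  show "shuffle_map_N A B n \<in> hom (cx_tensor_group (N A) (N B) n) (cgroup (N (A \<otimes>\<^sub>\<Delta> B)) n)"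
  proof (rule hom_factorI[OF _ _ N_tensor_proj_image])
    show "group (cx_tensor_group (C A) (C B) n)"
      by (rule group_of_comm[OF comm_group_cx_tensor_group[OF gg(1,2)]])
    show "N_tensor_proj A B n \<in> hom (cx_tensor_group (C A) (C B) n) (cx_tensor_group (N A) (N B) n)"
      by (rule N_tensor_proj_hom)
    show "(\<lambda>u. N_proj (A \<otimes>\<^sub>\<Delta> B) n (shuffle_map A B n u)) \<in> hom (cx_tensor_group (C A) (C B) n) (cgroup (N (A \<otimes>\<^sub>\<Delta> B)) n)"
      by (rule hom_o[OF graded_homD[OF graded_hom_shuffle_map[OF A B], unfolded cgroup_cx_tensor] graded_homD[OF AB.graded_hom_N_proj]])
  qed (rule shuffle_map_N_proj)
qed

end

text \<open>Compatibility with the degeneracies sends degenerate simplices to degenerate ones, which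
  is what descent to \<open>N\<close> requires.\<close>

lemma N_map_proj:
  assumes A: "simplicial_abelian_group A" and B: "simplicial_abelian_group B"
    and f: "graded_hom (C A) (C B) f"
    and degen: "\<And>n i x. i \<le> n \<Longrightarrow> x \<in> carrier (sgroup A n) \<Longrightarrow> f (Suc n) (degen A n i x) = degen B n i (f n x)"
    and x: "x \<in> carrier (sgroup A n)"
  shows "N_map A B f n (N_proj A n x) = N_proj B n (f n x)"
proof -
  interpret A: simplicial_abelian_group A by (rule A)
  interpret B: simplicial_abelian_group B by (rule B)
  have h: "(\<lambda>x. N_proj B n (f n x)) \<in> hom (sgroup A n) (cgroup (N B) n)"
    using hom_o[OF graded_homD[OF f, of n, unfolded cgroup_C] B.N_proj_hom] .
  have kill: "N_proj B n (f n s) = \<one>\<^bsub>cgroup (N B) n\<^esub>" if s: "s \<in> degenerate A n" for s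
  proof (rule B.N_proj_degenerate)
    obtain m i t where "n = Suc m" "i \<le> m" "t \<in> carrier (sgroup A m)" "s = degen A m i t"
      using s by (cases n) auto
    then show "f n s \<in> degenerate B n"
      using degen[of i m t] graded_hom_closed[OF f, of t m] by auto
  qed
  show ?thesis
    unfolding N_map_def cgroup_C C_map_def using x
    by (intro induced_map_eq A.N_proj_eqD[OF h graded_groupD'[OF B.graded_group_N] kill]) auto
qed


text \<open>The composites \<open>h\<close> and \<open>k\<close> are prescribed separately and
  compared on carriers only, so a commuting square can be applied inside a tensor product: the
  left-hand composite may be one path and \<open>h\<close> the other.\<close>

lemma cx_tensor_map_compose:
  assumes "graded_group A" "graded_group B" "graded_group A'" "graded_group B'" "graded_group A''" "graded_group B''"
    and f: "graded_hom A A' f" "graded_hom A' A'' f'" and g: "graded_hom B B' g" "graded_hom B' B'' g'"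
    and h: "graded_hom A A'' h" "graded_hom B B'' k"
    and eq: "\<And>n a. a \<in> carrier (cgroup A n) \<Longrightarrow> f' n (f n a) = h n a" "\<And>n b. b \<in> carrier (cgroup B n) \<Longrightarrow> g' n (g n b) = k n b"
    and u: "u \<in> carrier (cx_tensor_group A B n)"
  shows "cx_tensor_map A'' B'' f' g' n (cx_tensor_map A' B' f g n u) = cx_tensor_map A'' B'' h k n u"
proof (rule cx_tensor_hom_eqI[OF assms(1,2) _ _ _ _ u])
  note m1 = graded_hom_cx_tensor_map[OF assms(1-4) f(1) g(1)] and m2 = graded_hom_cx_tensor_map[OF assms(3-6) f(2) g(2)]
    and m3 = graded_hom_cx_tensor_map[OF assms(1,2,5,6) h]
  show "comm_group (cx_tensor_group A'' B'' n)" by (rule comm_group_cx_tensor_group[OF assms(5,6)])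
  show "(\<lambda>u. cx_tensor_map A'' B'' f' g' n (cx_tensor_map A' B' f g n u)) \<in> hom (cx_tensor_group A B n) (cx_tensor_group A'' B'' n)"
    using hom_o[OF graded_homD[OF m1, of n] graded_homD[OF m2]] by simp
  show "cx_tensor_map A'' B'' h k n \<in> hom (cx_tensor_group A B n) (cx_tensor_group A'' B'' n)"
    using graded_homD[OF m3, of n] by simp
  fix p q a b assume pq: "p + q = n" and ab: "a \<in> carrier (cgroup A p)" "b \<in> carrier (cgroup B q)"
  show "cx_tensor_map A'' B'' f' g' n (cx_tensor_map A' B' f g n (cx_tensor_elt A B p q a b)) =
    cx_tensor_map A'' B'' h k n (cx_tensor_elt A B p q a b)"
    unfolding cx_tensor_map_elt[OF assms(1-4) f(1) g(1) pq ab] cx_tensor_map_elt[OF assms(1,2,5,6) h pq ab]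
      cx_tensor_map_elt[OF assms(3-6) f(2) g(2) pq graded_hom_closed[OF f(1) ab(1)] graded_hom_closed[OF g(1) ab(2)]]
    using eq ab by simp
qed

lemma tensor_hom_eqI2:
  assumes G: "group G" and H: "group H" and K: "group K" and L: "group L" and M: "group M"
    and \<phi>: "\<phi> \<in> hom (tensor_group (tensor_group G H) (tensor_group K L)) M"
    and \<psi>: "\<psi> \<in> hom (tensor_group (tensor_group G H) (tensor_group K L)) M"
    and eq: "\<And>a b c d. \<lbrakk>a \<in> carrier G; b \<in> carrier H; c \<in> carrier K; d \<in> carrier L\<rbrakk> \<Longrightarrow>
      \<phi> (tensor_elt (tensor_group G H) (tensor_group K L) (tensor_elt G H a b) (tensor_elt K L c d)) =
      \<psi> (tensor_elt (tensor_group G H) (tensor_group K L) (tensor_elt G H a b) (tensor_elt K L c d))"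
    and t: "t \<in> carrier (tensor_group (tensor_group G H) (tensor_group K L))"
  shows "\<phi> t = \<psi> t"
proof -
  note GH = group_of_comm[OF comm_group_tensor_group[OF G H]] and KL = group_of_comm[OF comm_group_tensor_group[OF K L]]
  note bi = tensor_elt_biadditive[OF GH KL]
  show ?thesis
  proof (rule tensor_hom_eqI[OF GH KL M \<phi> \<psi> _ t])
    fix u v assume u: "u \<in> carrier (tensor_group G H)" and v: "v \<in> carrier (tensor_group K L)"
    show "\<phi> (tensor_elt (tensor_group G H) (tensor_group K L) u v) = \<psi> (tensor_elt (tensor_group G H) (tensor_group K L) u v)"
    proof (rule tensor_hom_eqI[OF G H M hom_o[OF biadditiveD2[OF bi v] \<phi>] hom_o[OF biadditiveD2[OF bi v] \<psi>] _ u])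
      fix a b assume ab: "a \<in> carrier G" "b \<in> carrier H"
      note h = biadditiveD1[OF bi tensor_elt_closed[OF ab]]
      show "\<phi> (tensor_elt (tensor_group G H) (tensor_group K L) (tensor_elt G H a b) v) =
        \<psi> (tensor_elt (tensor_group G H) (tensor_group K L) (tensor_elt G H a b) v)"
        by (rule tensor_hom_eqI[OF K L M hom_o[OF h \<phi>] hom_o[OF h \<psi>] _ v]) (rule eq[OF ab])
    qed
  qed
qed

section \<open>The bialgebra identity on normalized chains\<close>

context
  fixes X :: "'x simplicial" and Y :: "'y simplicial"
    and Z :: "'z simplicial" and W :: "'w simplicial"
  assumes X: "simplicial_abelian_group X" and Y: "simplicial_abelian_group Y"
    and Z: "simplicial_abelian_group Z" and W: "simplicial_abelian_group W"
begin

interpretation X: simplicial_abelian_group X by (rule X)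
interpretation Y: simplicial_abelian_group Y by (rule Y)
interpretation Z: simplicial_abelian_group Z by (rule Z)
interpretation W: simplicial_abelian_group W by (rule W)
interpretation XY: simplicial_abelian_group "X \<otimes>\<^sub>\<Delta> Y" using X Y by (rule simplicial_abelian_group_tensor)
interpretation ZW: simplicial_abelian_group "Z \<otimes>\<^sub>\<Delta> W" using Z W by (rule simplicial_abelian_group_tensor)
interpretation XZ: simplicial_abelian_group "X \<otimes>\<^sub>\<Delta> Z" using X Z by (rule simplicial_abelian_group_tensor)
interpretation YW: simplicial_abelian_group "Y \<otimes>\<^sub>\<Delta> W" using Y W by (rule simplicial_abelian_group_tensor)

private lemmas sXY = XY.simplicial_abelian_group_axioms and sZW = ZW.simplicial_abelian_group_axioms
  and sXZ = XZ.simplicial_abelian_group_axioms and sYW = YW.simplicial_abelian_group_axioms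

private lemmas XYZW_groups = X.group_sgroup Y.group_sgroup Z.group_sgroup W.group_sgroup

text \<open>A degeneracy acts on all four tensor factors with the same index, so it commutes with
  their permutation. This is the hypothesis of \<open>N_map_proj\<close> for the middle
  swap.\<close>

lemma simp_middle_swap_degen:
  assumes i: "i \<le> n" and t: "t \<in> carrier (sgroup ((X \<otimes>\<^sub>\<Delta> Y) \<otimes>\<^sub>\<Delta> (Z \<otimes>\<^sub>\<Delta> W)) n)"
  shows "simp_middle_swap X Y Z W (Suc n) (degen ((X \<otimes>\<^sub>\<Delta> Y) \<otimes>\<^sub>\<Delta> (Z \<otimes>\<^sub>\<Delta> W)) n i t) =
    degen ((X \<otimes>\<^sub>\<Delta> Z) \<otimes>\<^sub>\<Delta> (Y \<otimes>\<^sub>\<Delta> W)) n i (simp_middle_swap X Y Z W n t)"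
proof -
  interpret S: simplicial_abelian_group "(X \<otimes>\<^sub>\<Delta> Y) \<otimes>\<^sub>\<Delta> (Z \<otimes>\<^sub>\<Delta> W)" using sXY sZW by (rule simplicial_abelian_group_tensor)
  interpret T: simplicial_abelian_group "(X \<otimes>\<^sub>\<Delta> Z) \<otimes>\<^sub>\<Delta> (Y \<otimes>\<^sub>\<Delta> W)" using sXZ sYW by (rule simplicial_abelian_group_tensor)
  note m = graded_homD[OF graded_hom_simp_middle_swap[OF X Y Z W], unfolded cgroup_C C_map_def]
  show ?thesis
  proof (rule tensor_hom_eqI2[OF XYZW_groups T.group_sgroup[of "Suc n"]
      hom_o[OF S.degen_hom[OF i] m, unfolded sgroup_simp_tensor[of "X \<otimes>\<^sub>\<Delta> Y"] sgroup_simp_tensor[of X] sgroup_simp_tensor[of Z]]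
      hom_o[OF m T.degen_hom[OF i], unfolded sgroup_simp_tensor[of "X \<otimes>\<^sub>\<Delta> Y"] sgroup_simp_tensor[of X Y] sgroup_simp_tensor[of Z W]]
      _ t[unfolded sgroup_simp_tensor]])
    fix x y z w assume c: "x \<in> carrier (sgroup X n)" "y \<in> carrier (sgroup Y n)" "z \<in> carrier (sgroup Z n)" "w \<in> carrier (sgroup W n)"
    note d = X.degen_closed[OF i c(1)] Y.degen_closed[OF i c(2)] Z.degen_closed[OF i c(3)] W.degen_closed[OF i c(4)]
    let ?t = "tensor_elt (tensor_group (sgroup X n) (sgroup Y n)) (tensor_group (sgroup Z n) (sgroup W n))
      (tensor_elt (sgroup X n) (sgroup Y n) x y) (tensor_elt (sgroup Z n) (sgroup W n) z w)"
    show "simp_middle_swap X Y Z W (Suc n) (degen ((X \<otimes>\<^sub>\<Delta> Y) \<otimes>\<^sub>\<Delta> (Z \<otimes>\<^sub>\<Delta> W)) n i ?t) =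
      degen ((X \<otimes>\<^sub>\<Delta> Z) \<otimes>\<^sub>\<Delta> (Y \<otimes>\<^sub>\<Delta> W)) n i (simp_middle_swap X Y Z W n ?t)"
      using degen_simp_tensor_elt[OF sXY sZW i, of "tensor_elt (sgroup X n) (sgroup Y n) x y" "tensor_elt (sgroup Z n) (sgroup W n) z w"]
        degen_simp_tensor_elt[OF sXZ sYW i, of "tensor_elt (sgroup X n) (sgroup Z n) x z" "tensor_elt (sgroup Y n) (sgroup W n) y w"]
        degen_simp_tensor_elt[OF X Y i c(1,2)] degen_simp_tensor_elt[OF Z W i c(3,4)]
        degen_simp_tensor_elt[OF X Z i c(1,3)] degen_simp_tensor_elt[OF Y W i c(2,4)]
        tensor_middle_swap_elt[OF XYZW_groups c] tensor_middle_swap_elt[OF XYZW_groups d] c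
      by (simp add: simp_middle_swap_def tensor_elt_closed)
  qed
qed

private lemmas graded_C_XYZW = graded_group_C[OF X] graded_group_C[OF Y] graded_group_C[OF Z] graded_group_C[OF W]
private lemmas graded_N_XYZW = X.graded_group_N Y.graded_group_N Z.graded_group_N W.graded_group_N
private lemmas graded_C_tensors = graded_group_C[OF sXY] graded_group_C[OF sZW] graded_group_C[OF sXZ] graded_group_C[OF sYW]
private lemmas graded_N_tensors = XY.graded_group_N ZW.graded_group_N XZ.graded_group_N YW.graded_group_N

theorem bialgebra_N:
  assumes u: "u \<in> carrier (cgroup (N (X \<otimes>\<^sub>\<Delta> Y) \<otimes>\<^sub>C N (Z \<otimes>\<^sub>\<Delta> W)) n)"
  shows "(AW_N (X \<otimes>\<^sub>\<Delta> Z) (Y \<otimes>\<^sub>\<Delta> W) \<circ>\<^sub>g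
      N_map ((X \<otimes>\<^sub>\<Delta> Y) \<otimes>\<^sub>\<Delta> (Z \<otimes>\<^sub>\<Delta> W)) ((X \<otimes>\<^sub>\<Delta> Z) \<otimes>\<^sub>\<Delta> (Y \<otimes>\<^sub>\<Delta> W)) (simp_middle_swap X Y Z W) \<circ>\<^sub>g
      shuffle_map_N (X \<otimes>\<^sub>\<Delta> Y) (Z \<otimes>\<^sub>\<Delta> W)) n u =
    (cx_tensor_map (N (X \<otimes>\<^sub>\<Delta> Z)) (N (Y \<otimes>\<^sub>\<Delta> W)) (shuffle_map_N X Z) (shuffle_map_N Y W) \<circ>\<^sub>g
      cx_middle_swap (N X) (N Y) (N Z) (N W) \<circ>\<^sub>g
      cx_tensor_map (N X \<otimes>\<^sub>C N Y) (N Z \<otimes>\<^sub>C N W) (AW_N X Y) (AW_N Z W)) n u"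
proof -
  let ?MXY = "cx_tensor_map (N X \<otimes>\<^sub>C N Y) (N Z \<otimes>\<^sub>C N W)"
  let ?MZ = "cx_tensor_map (N (X \<otimes>\<^sub>\<Delta> Z)) (N (Y \<otimes>\<^sub>\<Delta> W))"
  let ?MXZ = "cx_tensor_map (N X \<otimes>\<^sub>C N Z) (N Y \<otimes>\<^sub>C N W)"
  let ?MC = "cx_tensor_map (C X \<otimes>\<^sub>C C Y) (C Z \<otimes>\<^sub>C C W)"
  note gCXY = graded_group_cx_tensor[OF graded_C_XYZW(1,2)] graded_group_cx_tensor[OF graded_C_XYZW(3,4)]
  note gNXY = graded_group_cx_tensor[OF graded_N_XYZW(1,2)] graded_group_cx_tensor[OF graded_N_XYZW(3,4)]
  note gCXZ = graded_group_cx_tensor[OF graded_C_XYZW(1,3)] graded_group_cx_tensor[OF graded_C_XYZW(2,4)]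
  note gNXZ = graded_group_cx_tensor[OF graded_N_XYZW(1,3)] graded_group_cx_tensor[OF graded_N_XYZW(2,4)]
  note N_AW = graded_hom_comp[OF graded_hom_AW[OF X Y] graded_hom_N_tensor_proj[OF X Y]]
        graded_hom_comp[OF graded_hom_AW[OF Z W] graded_hom_N_tensor_proj[OF Z W]]
  note N_shuffle = graded_hom_comp[OF graded_hom_shuffle_map[OF X Z] XZ.graded_hom_N_proj]
        graded_hom_comp[OF graded_hom_shuffle_map[OF Y W] YW.graded_hom_N_proj]
  let ?A = "(X \<otimes>\<^sub>\<Delta> Y) \<otimes>\<^sub>\<Delta> (Z \<otimes>\<^sub>\<Delta> W)" and ?B = "(X \<otimes>\<^sub>\<Delta> Z) \<otimes>\<^sub>\<Delta> (Y \<otimes>\<^sub>\<Delta> W)"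
  have sA: "simplicial_abelian_group ?A" using sXY sZW by (rule simplicial_abelian_group_tensor)
  have sB: "simplicial_abelian_group ?B" using sXZ sYW by (rule simplicial_abelian_group_tensor)
  \<comment> \<open>Surjectivity of the projection lifts \<open>u\<close> to unnormalized chains,
    where \<open>bialgebra_C\<close> is available.\<close>
  obtain v where v: "v \<in> carrier (cx_tensor_group (C (X \<otimes>\<^sub>\<Delta> Y)) (C (Z \<otimes>\<^sub>\<Delta> W)) n)"
    and uv: "u = N_tensor_proj (X \<otimes>\<^sub>\<Delta> Y) (Z \<otimes>\<^sub>\<Delta> W) n v"
    using u unfolding cgroup_cx_tensor N_tensor_proj_image[OF sXY sZW, symmetric] by blast
  let ?s = "shuffle_map (X \<otimes>\<^sub>\<Delta> Y) (Z \<otimes>\<^sub>\<Delta> W) n v"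
  have s: "?s \<in> carrier (sgroup ?A n)"
    using graded_hom_closed[OF graded_hom_shuffle_map[OF sXY sZW]] v by simp
  have m: "simp_middle_swap X Y Z W n ?s \<in> carrier (sgroup ?B n)"
    using graded_hom_closed[OF graded_hom_simp_middle_swap[OF X Y Z W, unfolded C_map_def], of ?s n] s by simp
  \<comment> \<open>Each of the three maps of the first composite commutes with the projections, so
    these move outward one map at a time.\<close>
  have left: "AW_N (X \<otimes>\<^sub>\<Delta> Z) (Y \<otimes>\<^sub>\<Delta> W) n (N_map ?A ?B (simp_middle_swap X Y Z W) n
      (shuffle_map_N (X \<otimes>\<^sub>\<Delta> Y) (Z \<otimes>\<^sub>\<Delta> W) n u)) =
    N_tensor_proj (X \<otimes>\<^sub>\<Delta> Z) (Y \<otimes>\<^sub>\<Delta> W) n (AW (X \<otimes>\<^sub>\<Delta> Z) (Y \<otimes>\<^sub>\<Delta> W) n (simp_middle_swap X Y Z W n ?s))"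
  proof -
    have "N_map ?A ?B (simp_middle_swap X Y Z W) n (N_proj ?A n ?s) = N_proj ?B n (simp_middle_swap X Y Z W n ?s)"
      by (rule N_map_proj[OF sA sB graded_hom_simp_middle_swap[OF X Y Z W, unfolded C_map_def] simp_middle_swap_degen s])
    then show ?thesis
      by (simp only: uv shuffle_map_N_proj[OF sXY sZW v] AW_N_proj[OF sXZ sYW m])
  qed
  \<comment> \<open>The projection applied before \<open>AW_N\<close> on each factor is traded for
    the projection applied after \<open>AW\<close>; both equal the tensor product of the composites
    \<open>N_tensor_proj \<circ>\<^sub>g AW\<close>.\<close>
  have "?MXY (AW_N X Y) (AW_N Z W) n u =
    ?MXY (N_tensor_proj X Y \<circ>\<^sub>g AW X Y) (N_tensor_proj Z W \<circ>\<^sub>g AW Z W) n v"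
    unfolding uv N_tensor_proj_def[of "X \<otimes>\<^sub>\<Delta> Y"]
    by (rule cx_tensor_map_compose[OF graded_C_tensors(1,2) graded_N_tensors(1,2) gNXY
        XY.graded_hom_N_proj graded_hom_AW_N[OF X Y] ZW.graded_hom_N_proj graded_hom_AW_N[OF Z W]
        N_AW _ _ v])
      (simp_all add: graded_comp_def AW_N_proj[OF X Y] AW_N_proj[OF Z W])
  also have "\<dots> = ?MXY (N_tensor_proj X Y) (N_tensor_proj Z W) n
      (?MC (AW X Y) (AW Z W) n v)"
    by (rule cx_tensor_map_compose[OF graded_C_tensors(1,2) gCXY
        gNXY
        graded_hom_AW[OF X Y] graded_hom_N_tensor_proj[OF X Y] graded_hom_AW[OF Z W] graded_hom_N_tensor_proj[OF Z W]
        N_AW _ _ v, symmetric])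
      (simp_all add: graded_comp_def)
  finally have 1: "?MXY (AW_N X Y) (AW_N Z W) n u = \<dots>" .
  let ?a = "?MC (AW X Y) (AW Z W) n v"
  have a: "?a \<in> carrier (cx_tensor_group (C X \<otimes>\<^sub>C C Y) (C Z \<otimes>\<^sub>C C W) n)"
    using graded_hom_closed[OF graded_hom_cx_tensor_map[OF graded_C_tensors(1,2) gCXY graded_hom_AW[OF X Y] graded_hom_AW[OF Z W]], of v n] v by simp
  let ?b = "cx_middle_swap (C X) (C Y) (C Z) (C W) n ?a"
  have b: "?b \<in> carrier (cx_tensor_group (C X \<otimes>\<^sub>C C Z) (C Y \<otimes>\<^sub>C C W) n)"
    using graded_hom_closed[OF graded_hom_cx_middle_swap[OF graded_C_XYZW], of ?a n] a by simp
  have 2: "cx_middle_swap (N X) (N Y) (N Z) (N W) n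
      (?MXY (N_tensor_proj X Y) (N_tensor_proj Z W) n ?a) =
    ?MXZ (N_tensor_proj X Z) (N_tensor_proj Y W) n ?b"
    unfolding N_tensor_proj_def
    by (rule cx_middle_swap_natural[OF graded_C_XYZW graded_N_XYZW X.graded_hom_N_proj Y.graded_hom_N_proj Z.graded_hom_N_proj W.graded_hom_N_proj a])
  \<comment> \<open>The same exchange for the shuffle maps; it ends with the projection outermost,
    as on the left-hand side.\<close>
  have "?MZ (shuffle_map_N X Z) (shuffle_map_N Y W) n
      (?MXZ (N_tensor_proj X Z) (N_tensor_proj Y W) n ?b) =
    ?MZ (N_proj (X \<otimes>\<^sub>\<Delta> Z) \<circ>\<^sub>g shuffle_map X Z) (N_proj (Y \<otimes>\<^sub>\<Delta> W) \<circ>\<^sub>g shuffle_map Y W) n ?b"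
    by (rule cx_tensor_map_compose[OF gCXZ
        gNXZ graded_N_tensors(3,4)
        graded_hom_N_tensor_proj[OF X Z] graded_hom_shuffle_map_N[OF X Z] graded_hom_N_tensor_proj[OF Y W] graded_hom_shuffle_map_N[OF Y W]
        N_shuffle _ _ b])
      (simp_all add: graded_comp_def shuffle_map_N_proj[OF X Z] shuffle_map_N_proj[OF Y W])
  also have "\<dots> = N_tensor_proj (X \<otimes>\<^sub>\<Delta> Z) (Y \<otimes>\<^sub>\<Delta> W) n
      (cx_tensor_map (C (X \<otimes>\<^sub>\<Delta> Z)) (C (Y \<otimes>\<^sub>\<Delta> W)) (shuffle_map X Z) (shuffle_map Y W) n ?b)"
    unfolding N_tensor_proj_def
    by (rule cx_tensor_map_compose[OF gCXZ graded_C_tensors(3,4) graded_N_tensors(3,4)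
        graded_hom_shuffle_map[OF X Z] XZ.graded_hom_N_proj graded_hom_shuffle_map[OF Y W] YW.graded_hom_N_proj
        N_shuffle _ _ b, symmetric])
      (simp_all add: graded_comp_def)
  finally have right: "?MZ (shuffle_map_N X Z) (shuffle_map_N Y W) n
      (cx_middle_swap (N X) (N Y) (N Z) (N W) n
        (?MXY (AW_N X Y) (AW_N Z W) n u)) = \<dots>"
    unfolding 1 2 .
  show ?thesis
    using bialgebra_C[OF X Y Z W, unfolded cgroup_cx_tensor, OF v]
    unfolding graded_comp_def comp_def C_map_def left right by (rule arg_cong)
qed

end

theorem theorem2p4:
  fixes X :: "'x simplicial" and Y :: "'y simplicial"
    and Z :: "'z simplicial" and W :: "'w simplicial"
  assumes "simplicial_abelian_group X" and "simplicial_abelian_group Y"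
    and "simplicial_abelian_group Z" and "simplicial_abelian_group W"
  shows "(\<forall>n. \<forall>u\<in>carrier (cgroup (C (X \<otimes>\<^sub>\<Delta> Y) \<otimes>\<^sub>C C (Z \<otimes>\<^sub>\<Delta> W)) n).
           (AW (X \<otimes>\<^sub>\<Delta> Z) (Y \<otimes>\<^sub>\<Delta> W) \<circ>\<^sub>g
            C_map (simp_middle_swap X Y Z W) \<circ>\<^sub>g
            shuffle_map (X \<otimes>\<^sub>\<Delta> Y) (Z \<otimes>\<^sub>\<Delta> W)) n u =
           (cx_tensor_map (C (X \<otimes>\<^sub>\<Delta> Z)) (C (Y \<otimes>\<^sub>\<Delta> W)) (shuffle_map X Z) (shuffle_map Y W) \<circ>\<^sub>g
            cx_middle_swap (C X) (C Y) (C Z) (C W) \<circ>\<^sub>g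
            cx_tensor_map (C X \<otimes>\<^sub>C C Y) (C Z \<otimes>\<^sub>C C W) (AW X Y) (AW Z W)) n u) \<and>
         (\<forall>n. \<forall>u\<in>carrier (cgroup (N (X \<otimes>\<^sub>\<Delta> Y) \<otimes>\<^sub>C N (Z \<otimes>\<^sub>\<Delta> W)) n).
           (AW_N (X \<otimes>\<^sub>\<Delta> Z) (Y \<otimes>\<^sub>\<Delta> W) \<circ>\<^sub>g
            N_map ((X \<otimes>\<^sub>\<Delta> Y) \<otimes>\<^sub>\<Delta> (Z \<otimes>\<^sub>\<Delta> W)) ((X \<otimes>\<^sub>\<Delta> Z) \<otimes>\<^sub>\<Delta> (Y \<otimes>\<^sub>\<Delta> W)) (simp_middle_swap X Y Z W) \<circ>\<^sub>g
            shuffle_map_N (X \<otimes>\<^sub>\<Delta> Y) (Z \<otimes>\<^sub>\<Delta> W)) n u =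
           (cx_tensor_map (N (X \<otimes>\<^sub>\<Delta> Z)) (N (Y \<otimes>\<^sub>\<Delta> W)) (shuffle_map_N X Z) (shuffle_map_N Y W) \<circ>\<^sub>g
            cx_middle_swap (N X) (N Y) (N Z) (N W) \<circ>\<^sub>g
            cx_tensor_map (N X \<otimes>\<^sub>C N Y) (N Z \<otimes>\<^sub>C N W) (AW_N X Y) (AW_N Z W)) n u)"
  using bialgebra_C[OF assms] bialgebra_N[OF assms] by blast

end
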